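(* Assume $\mathrm{MA}(\text{powerfully ccc})$ and $\neg\mathrm{CH}$, and let $\pi:[\omega_1]^2\to2$ be a coloring such that $\mathcal{H}_0$ and $\mathcal{H}_1$ are ccc. Suppose moreover that (i) if $\mathcal{P}$ is a ccc poset which forces that $\pi$ has no uncountable $l$-homogeneous subset for any $l<2$, then $\mathrm{MA}(\{\mathcal{P}\})$ holds; and (ii) for every $A\in[\omega_1]^{\omega_1}$ and $l<2$ there are $m<\omega$ and an uncountable non-overlapping family $\mathscr{B}\subseteq[A]^m$ such that for all $a<b$ in $\mathscr{B}$, $\pi(a(i),b(i))=l$ for some $i<m$. Then powerfully ccc is closed under finite support iterated forcing: for every finite support iteration $\langle\mathcal{P}_\alpha,\dot{\mathcal{Q}}_\beta:\alpha\le\nu,\ \beta<\nu\rangle$ such that $\Vdash_{\mathcal{P}_\beta}$ "$\dot{\mathcal{Q}}_\beta$ is powerfully ccc" for each $\beta<\nu$, the poset $\mathcal{P}_\nu$ is powerfully ccc.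
   Context: For a finite set of ordinals $a$ and $i<|a|$, $a(i)$ denotes the $i$-th element of $a$ in increasing order; $\pi(x,y)$ denotes $\pi(\{x,y\})$. For nonempty finite sets of ordinals $a,b$, $a<b$ means $\max a<\min b$; a family of nonempty finite sets of ordinals is non-overlapping if any two distinct members $a,b$ satisfy $a<b$ or $b<a$. For $l<2$, $X\subseteq\omega_1$ is $l$-homogeneous if $\pi(\alpha,\beta)=l$ for all $\alpha<\beta$ in $X$; $\mathcal{H}_l$ is the poset of finite $l$-homogeneous subsets of $\omega_1$ ordered by reverse inclusion. A poset is ccc if every uncountable subset contains two elements with a common lower bound, and powerfully ccc if all its finite powers are ccc. For a class $\Psi$ of ccc posets and a cardinal $\lambda$, $\mathrm{MA}_\lambda(\Psi)$ says: whenever $\mathcal{P}\in\Psi$ and $\{D_\alpha:\alpha<\lambda\}$ are dense subsets of $\mathcal{P}$, some filter on $\mathcal{P}$ meets every $D_\alpha$; $\mathrm{MA}(\Psi)$ means $\mathrm{MA}_\lambda(\Psi)$ for all $\lambda<2^\omega$. *)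

theory Defs
  imports Complex_Main "HOL-Library.Countable_Set_Type" "HOL-Library.Equipollence" "HOL-Library.Ramsey"
begin

section \<open>The first uncountable ordinal, the continuum\<close>

text \<open>\<open>cardSuc natLeq\<close> is a well-order on a set of sets of natural numbers whose order type is the
  least uncountable cardinal.\<close>

lemma omega1_card_order: "Card_order (cardSuc natLeq)"
  and omega1_greater: "(natLeq, cardSuc natLeq) \<in> ordLess"
  by (simp_all add: cardSuc_Card_order cardSuc_greater natLeq_Card_order)

typedef omega1 = "Field (cardSuc natLeq)"
proof -
  have "Field (cardSuc natLeq) \<noteq> {}"
    using cardSuc_greater[OF natLeq_Card_order] cardSuc_finite natLeq_Card_order
    by (metis Field_natLeq finite.emptyI infinite_UNIV_nat)
  then show ?thesis by blast
qed

instantiation omega1 :: wellorder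
begin
definition less_eq_omega1 :: "omega1 \<Rightarrow> omega1 \<Rightarrow> bool" where
  "x \<le> y \<longleftrightarrow> (Rep_omega1 x, Rep_omega1 y) \<in> cardSuc natLeq"
definition less_omega1 :: "omega1 \<Rightarrow> omega1 \<Rightarrow> bool" where
  "x < y \<longleftrightarrow> x \<le> y \<and> \<not> y \<le> (x::omega1)"

instance
proof
  have wo: "Well_order (cardSuc natLeq)"
    using omega1_card_order by (simp add: card_order_on_def)
  then have R: "refl_on (Field (cardSuc natLeq)) (cardSuc natLeq)"
    and T: "trans (cardSuc natLeq)" and S: "antisym (cardSuc natLeq)"
    and Tot: "total_on (Field (cardSuc natLeq)) (cardSuc natLeq)"
    and W: "wf (cardSuc natLeq - Id)"
    by (auto simp: well_order_on_def linear_order_on_def partial_order_on_def preorder_on_def)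
  fix x y z :: omega1
  show "(x < y) = (x \<le> y \<and> \<not> y \<le> x)" by (rule less_omega1_def)
  show "x \<le> x"
    using R Rep_omega1[of x] by (auto simp: less_eq_omega1_def refl_on_def)
  show "x \<le> y \<Longrightarrow> y \<le> z \<Longrightarrow> x \<le> z"
    using T by (auto simp: less_eq_omega1_def dest: transD)
  show "x \<le> y \<Longrightarrow> y \<le> x \<Longrightarrow> x = y"
    using S by (auto simp: less_eq_omega1_def Rep_omega1_inject dest: antisymD)
  show total: "x \<le> y \<or> y \<le> x" for x y :: omega1
    using Tot R Rep_omega1[of x] Rep_omega1[of y] unfolding less_eq_omega1_def
    by (cases "Rep_omega1 x = Rep_omega1 y") (auto simp: refl_on_def total_on_def)
  fix Q :: "omega1 \<Rightarrow> bool" and a :: omega1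
  assume step: "\<And>x. (\<And>y. y < x \<Longrightarrow> Q y) \<Longrightarrow> Q x"
  have "wf (inv_image (cardSuc natLeq - Id) Rep_omega1)"
    using W by (rule wf_inv_image)
  then show "Q a"
  proof (induction a rule: wf_induct_rule)
    case (less x)
    show ?case
    proof (rule step)
      fix y assume "y < x"
      then show "Q y"
        by (intro less) (auto simp: less_eq_omega1_def less_omega1_def)
    qed
  qed
qed
end

lemma uncountable_omega1:
  includes cardinal_syntax
  shows "uncountable (UNIV :: omega1 set)"
proof
  assume "countable (UNIV :: omega1 set)"
  then have "countable (range Rep_omega1)" by simp
  then have "countable (Field (cardSuc natLeq))"
    using type_definition.Rep_range[OF type_definition_omega1] by simp
  then have "|Field (cardSuc natLeq)| \<le>o natLeq"
    by (simp add: countable_card_le_natLeq)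
  then show False
    using omega1_greater card_of_Field_ordIso[OF omega1_card_order]
    by (meson not_ordLess_ordLeq ordIso_ordLeq_trans ordIso_symmetric)
qed

lemma countable_initial_segment_omega1:
  includes cardinal_syntax
  shows "countable {..<\<alpha> :: omega1}"
proof -
  let ?r = "cardSuc natLeq"
  have "|underS ?r (Rep_omega1 \<alpha>)| <o ?r"
    by (rule card_of_underS[OF omega1_card_order Rep_omega1])
  then have "countable (underS ?r (Rep_omega1 \<alpha>))"
    by (simp add: countable_card_le_natLeq cardSuc_ordLeq_ordLess natLeq_Card_order card_of_Card_order)
  moreover have "Rep_omega1 ` {..<\<alpha>} \<subseteq> underS ?r (Rep_omega1 \<alpha>)"
    by (auto simp: underS_def less_omega1_def less_eq_omega1_def)
  ultimately show ?thesis
    by (meson countable_image_inj_on countable_subset Rep_omega1_inject inj_onI)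
qed

text \<open>The power set of \<open>\<omega>\<close> stands for \<open>2^\<omega>\<close>.\<close>

definition CH :: bool where
  "CH \<longleftrightarrow> (UNIV :: nat set set) \<approx> (UNIV :: omega1 set)"


section \<open>Posets, chain conditions and Martin's axiom\<close>

text \<open>A poset is given by its order relation \<open>{(p, q). p \<le> q}\<close>; its underlying set is the field of
  that relation. As usual in forcing, and as is needed for iterations, antisymmetry is not required.\<close>

definition forcing_poset :: "'a rel \<Rightarrow> bool" where
  "forcing_poset P \<longleftrightarrow> Preorder P \<and> Field P \<noteq> {}"

definition compatible :: "'a rel \<Rightarrow> 'a \<Rightarrow> 'a \<Rightarrow> bool" where
  "compatible P p q \<longleftrightarrow> (\<exists>r. (r, p) \<in> P \<and> (r, q) \<in> P)"

definition ccc :: "'a rel \<Rightarrow> bool" where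
  "ccc P \<longleftrightarrow> (\<forall>A \<subseteq> Field P. uncountable A \<longrightarrow> (\<exists>p\<in>A. \<exists>q\<in>A. p \<noteq> q \<and> compatible P p q))"

definition poset_power :: "'a rel \<Rightarrow> nat \<Rightarrow> 'a list rel" where
  "poset_power P n = {(ps, qs). length ps = n \<and> list_all2 (\<lambda>p q. (p, q) \<in> P) ps qs}"

definition powerfully_ccc :: "'a rel \<Rightarrow> bool" where
  "powerfully_ccc P \<longleftrightarrow> (\<forall>n. ccc (poset_power P n))"

definition dense_in :: "'a set \<Rightarrow> 'a rel \<Rightarrow> bool" where
  "dense_in D P \<longleftrightarrow> D \<subseteq> Field P \<and> (\<forall>p\<in>Field P. \<exists>d\<in>D. (d, p) \<in> P)"

definition filter_on :: "'a set \<Rightarrow> 'a rel \<Rightarrow> bool" where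
  "filter_on G P \<longleftrightarrow> G \<subseteq> Field P \<and> G \<noteq> {} \<and>
     (\<forall>p\<in>G. \<forall>q. (p, q) \<in> P \<longrightarrow> q \<in> G) \<and>
     (\<forall>p\<in>G. \<forall>q\<in>G. \<exists>r\<in>G. (r, p) \<in> P \<and> (r, q) \<in> P)"

text \<open>The cardinal \<open>\<lambda>\<close> is represented by an index set \<open>\<Lambda>\<close> of that cardinality. Every cardinal below
  the continuum is the cardinality of a set of sets of natural numbers.\<close>

definition MA_at :: "'l set \<Rightarrow> 'a rel set \<Rightarrow> bool" where
  "MA_at \<Lambda> \<Psi> \<longleftrightarrow> (\<forall>P\<in>\<Psi>. \<forall>D :: 'l \<Rightarrow> 'a set. (\<forall>\<xi>\<in>\<Lambda>. dense_in (D \<xi>) P) \<longrightarrow>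
     (\<exists>G. filter_on G P \<and> (\<forall>\<xi>\<in>\<Lambda>. G \<inter> D \<xi> \<noteq> {})))"

definition MA :: "'a rel set \<Rightarrow> bool" where
  "MA \<Psi> \<longleftrightarrow> (\<forall>\<Lambda> :: nat set set. \<Lambda> \<prec> (UNIV :: nat set set) \<longrightarrow> MA_at \<Lambda> \<Psi>)"


section \<open>Colorings of pairs of countable ordinals\<close>

definition homogeneous :: "(omega1 set \<Rightarrow> nat) \<Rightarrow> nat \<Rightarrow> omega1 set \<Rightarrow> bool" where
  "homogeneous \<pi> l X \<longleftrightarrow> (\<forall>\<alpha>\<in>X. \<forall>\<beta>\<in>X. \<alpha> < \<beta> \<longrightarrow> \<pi> {\<alpha>, \<beta>} = l)"

definition homog_poset :: "(omega1 set \<Rightarrow> nat) \<Rightarrow> nat \<Rightarrow> omega1 set rel" where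
  "homog_poset \<pi> l = {(s, t). finite s \<and> homogeneous \<pi> l s \<and> finite t \<and> homogeneous \<pi> l t \<and> t \<subseteq> s}"

definition set_before :: "omega1 set \<Rightarrow> omega1 set \<Rightarrow> bool" where
  "set_before a b \<longleftrightarrow> Max a < Min b"

definition non_overlapping :: "omega1 set set \<Rightarrow> bool" where
  "non_overlapping \<B> \<longleftrightarrow> (\<forall>a\<in>\<B>. finite a \<and> a \<noteq> {}) \<and>
     (\<forall>a\<in>\<B>. \<forall>b\<in>\<B>. a \<noteq> b \<longrightarrow> set_before a b \<or> set_before b a)"

text \<open>\<open>a(i)\<close>\<close>

definition nth_elem :: "omega1 set \<Rightarrow> nat \<Rightarrow> omega1" where
  "nth_elem a i = sorted_list_of_set a ! i"


section \<open>Names\<close>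

text \<open>A name is a set of pairs of names and conditions. For a type \<open>'p\<close> of conditions, a value of
  the following type stands for the set \<open>elts \<tau>\<close> below. An entry \<open>(\<sigma>, C)\<close> contributes the pairs
  \<open>(\<sigma>, s)\<close> for \<open>s \<in> C\<close>. So the type contains exactly the names for which, hereditarily, the number
  of first components is at most the cardinality of \<open>'i\<close>. Every name
  occurs for a suitable \<open>'i\<close>. The type \<open>'i\<close> should have at least the cardinality of the
  continuum. Then there are canonical names for \<open>\<omega>\<^sub>1\<close> and its colorings, and for the names of
  reals, of subsets of \<open>\<omega>\<^sub>1\<close> and of families of \<open>\<omega>\<^sub>1\<close> many finite tuples over a ccc poset the
  bound is no restriction.\<close>

datatype ('p, 'i) name = Name (entry: "'i \<Rightarrow> (('p, 'i) name \<times> 'p set) option")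

definition elts :: "('p, 'i) name \<Rightarrow> (('p, 'i) name \<times> 'p) set" where
  "elts \<tau> = {(\<sigma>, s). \<exists>i C. entry \<tau> i = Some (\<sigma>, C) \<and> s \<in> C}"

inductive is_name :: "'p rel \<Rightarrow> ('p, 'i) name \<Rightarrow> bool" for P where
  "(\<And>\<sigma> s. (\<sigma>, s) \<in> elts \<tau> \<Longrightarrow> s \<in> Field P \<and> is_name P \<sigma>) \<Longrightarrow> is_name P \<tau>"

text \<open>The name with a given set of pairs, if there is one (up to the choice of the indexing).\<close>

definition mk_name :: "(('p, 'i) name \<times> 'p) set \<Rightarrow> ('p, 'i) name" where
  "mk_name S = (SOME \<tau>. elts \<tau> = S)"

lemma elts_mk_name:
  fixes S :: "(('p, 'i) name \<times> 'p) set"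
  assumes "fst ` S \<lesssim> (UNIV :: 'i set)"
  shows "elts (mk_name S) = S"
proof -
  obtain f :: "('p, 'i) name \<Rightarrow> 'i" where f: "inj_on f (fst ` S)"
    using assms by (auto simp: lepoll_def)
  define \<tau> where "\<tau> = Name (\<lambda>i. if i \<in> f ` fst ` S
      then Some (inv_into (fst ` S) f i, S `` {inv_into (fst ` S) f i}) else None)"
  have "elts \<tau> = S"
  proof (intro set_eqI iffI)
    fix z assume "z \<in> elts \<tau>"
    then show "z \<in> S" by (auto simp: elts_def \<tau>_def split: if_splits)
  next
    fix z assume z: "z \<in> S"
    obtain x s where [simp]: "z = (x, s)" by (cases z)
    have x: "x \<in> fst ` S" using z by force
    then have "inv_into (fst ` S) f (f x) = x" using f by simp
    then have "entry \<tau> (f x) = Some (x, S `` {x})" using x by (simp add: \<tau>_def)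
    then show "z \<in> elts \<tau>" using z by (auto simp: elts_def)
  qed
  then show ?thesis unfolding mk_name_def by (rule someI)
qed

definition name_child :: "(('p, 'i) name) rel" where
  "name_child = {(\<sigma>, \<tau>). \<exists>s. (\<sigma>, s) \<in> elts \<tau>}"

lemma wf_name_child: "wf (name_child :: (('p, 'i) name) rel)"
proof (rule wfUNIVI)
  fix Q :: "('p, 'i) name \<Rightarrow> bool" and \<tau> :: "('p, 'i) name"
  assume step: "\<forall>\<tau>. (\<forall>\<sigma>. (\<sigma>, \<tau>) \<in> name_child \<longrightarrow> Q \<sigma>) \<longrightarrow> Q \<tau>"
  show "Q \<tau>"
  proof (induction \<tau>)
    case (Name f)
    have "Q \<sigma>" if "(\<sigma>, Name f) \<in> name_child" for \<sigma>
    proof -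
      from that obtain i C where "f i = Some (\<sigma>, C)"
        by (auto simp: name_child_def elts_def)
      then show ?thesis
        using Name[of "Some (\<sigma>, C)" "(\<sigma>, C)" \<sigma>] by (metis fsts.intros fst_conv option.set_intros rangeI)
    qed
    with step show ?case by blast
  qed
qed


section \<open>The forcing relation\<close>

text \<open>Formulas of the forcing language are represented by the forcing relation they induce:
  \<open>\<phi> P p\<close> says that \<open>p\<close> forces \<open>\<phi>\<close> over \<open>P\<close>. All formulas below are built from equality and
  membership of names by the logical connectives.\<close>

type_synonym 'p fml = "'p rel \<Rightarrow> 'p \<Rightarrow> bool"

function forces_eq :: "'p rel \<Rightarrow> ('p, 'i) name \<Rightarrow> ('p, 'i) name \<Rightarrow> 'p \<Rightarrow> bool" where
  "forces_eq P \<sigma> \<tau> p \<longleftrightarrow>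
     (\<forall>(x, s)\<in>elts \<sigma>. \<forall>q. (q, p) \<in> P \<and> (q, s) \<in> P \<longrightarrow>
        (\<exists>r. (r, q) \<in> P \<and> (\<exists>(y, t)\<in>elts \<tau>. (r, t) \<in> P \<and> forces_eq P x y r))) \<and>
     (\<forall>(y, t)\<in>elts \<tau>. \<forall>q. (q, p) \<in> P \<and> (q, t) \<in> P \<longrightarrow>
        (\<exists>r. (r, q) \<in> P \<and> (\<exists>(x, s)\<in>elts \<sigma>. (r, s) \<in> P \<and> forces_eq P x y r)))"
  by pat_completeness auto
termination
  by (relation "inv_image name_child (\<lambda>(P, \<sigma>, \<tau>, p). \<sigma>)")
    (use wf_name_child in auto, auto simp: name_child_def)

definition fEq :: "('p, 'i) name \<Rightarrow> ('p, 'i) name \<Rightarrow> 'p fml" (infix "\<^bold>=" 50) where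
  "(\<sigma> \<^bold>= \<tau>) P p \<longleftrightarrow> forces_eq P \<sigma> \<tau> p"

definition fMem :: "('p, 'i) name \<Rightarrow> ('p, 'i) name \<Rightarrow> 'p fml" (infix "\<^bold>\<in>" 50) where
  "(\<sigma> \<^bold>\<in> \<tau>) P p \<longleftrightarrow> (\<forall>q. (q, p) \<in> P \<longrightarrow>
     (\<exists>r. (r, q) \<in> P \<and> (\<exists>(y, t)\<in>elts \<tau>. (r, t) \<in> P \<and> forces_eq P \<sigma> y r)))"

definition fNot :: "'p fml \<Rightarrow> 'p fml" ("\<^bold>\<not> _" [40] 40) where
  "(\<^bold>\<not> \<phi>) P p \<longleftrightarrow> (\<forall>q. (q, p) \<in> P \<longrightarrow> \<not> \<phi> P q)"

definition fAnd :: "'p fml \<Rightarrow> 'p fml \<Rightarrow> 'p fml" (infixr "\<^bold>\<and>" 35) where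
  "(\<phi> \<^bold>\<and> \<psi>) P p \<longleftrightarrow> \<phi> P p \<and> \<psi> P p"

definition fAll :: "(('p, 'i) name \<Rightarrow> 'p fml) \<Rightarrow> 'p fml" (binder "\<^bold>\<forall>" 10) where
  "(\<^bold>\<forall>x. F x) P p \<longleftrightarrow> (\<forall>x. is_name P x \<longrightarrow> F x P p)"

definition fOr :: "'p fml \<Rightarrow> 'p fml \<Rightarrow> 'p fml" (infixr "\<^bold>\<or>" 30) where
  "(\<phi> \<^bold>\<or> \<psi>) = (\<^bold>\<not> (\<^bold>\<not> \<phi> \<^bold>\<and> \<^bold>\<not> \<psi>))"

definition fImp :: "'p fml \<Rightarrow> 'p fml \<Rightarrow> 'p fml" (infixr "\<^bold>\<longrightarrow>" 25) where
  "(\<phi> \<^bold>\<longrightarrow> \<psi>) = (\<^bold>\<not> (\<phi> \<^bold>\<and> \<^bold>\<not> \<psi>))"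

definition fIff :: "'p fml \<Rightarrow> 'p fml \<Rightarrow> 'p fml" (infixr "\<^bold>\<longleftrightarrow>" 25) where
  "(\<phi> \<^bold>\<longleftrightarrow> \<psi>) = ((\<phi> \<^bold>\<longrightarrow> \<psi>) \<^bold>\<and> (\<psi> \<^bold>\<longrightarrow> \<phi>))"

definition fEx :: "(('p, 'i) name \<Rightarrow> 'p fml) \<Rightarrow> 'p fml" (binder "\<^bold>\<exists>" 10) where
  "(\<^bold>\<exists>x. F x) = (\<^bold>\<not> (\<^bold>\<forall>x. \<^bold>\<not> F x))"

definition forces :: "'p rel \<Rightarrow> 'p fml \<Rightarrow> bool" where
  "forces P \<phi> \<longleftrightarrow> (\<forall>p\<in>Field P. \<phi> P p)"


section \<open>Some formulas of set theory\<close>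

definition fSubset :: "('p, 'i) name \<Rightarrow> ('p, 'i) name \<Rightarrow> 'p fml" (infix "\<^bold>\<subseteq>" 50) where
  "a \<^bold>\<subseteq> b = (\<^bold>\<forall>x. x \<^bold>\<in> a \<^bold>\<longrightarrow> x \<^bold>\<in> b)"

text \<open>\<open>z = {x, y}\<close>, \<open>z = (x, y)\<close>, and \<open>(x, y) \<in> R\<close>\<close>

definition fUpair :: "('p, 'i) name \<Rightarrow> ('p, 'i) name \<Rightarrow> ('p, 'i) name \<Rightarrow> 'p fml" where
  "fUpair z x y = (\<^bold>\<forall>w. w \<^bold>\<in> z \<^bold>\<longleftrightarrow> w \<^bold>= x \<^bold>\<or> w \<^bold>= y)"

definition fOpair :: "('p, 'i) name \<Rightarrow> ('p, 'i) name \<Rightarrow> ('p, 'i) name \<Rightarrow> 'p fml" where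
  "fOpair z x y = (\<^bold>\<exists>u v. fUpair u x x \<^bold>\<and> fUpair v x y \<^bold>\<and> fUpair z u v)"

definition fRel :: "('p, 'i) name \<Rightarrow> ('p, 'i) name \<Rightarrow> ('p, 'i) name \<Rightarrow> 'p fml" where
  "fRel R x y = (\<^bold>\<exists>z. fOpair z x y \<^bold>\<and> z \<^bold>\<in> R)"

text \<open>\<open>f\<close> is a function from \<open>A\<close> to \<open>B\<close>\<close>

definition fFun :: "('p, 'i) name \<Rightarrow> ('p, 'i) name \<Rightarrow> ('p, 'i) name \<Rightarrow> 'p fml" where
  "fFun f A B =
     ((\<^bold>\<forall>z. z \<^bold>\<in> f \<^bold>\<longrightarrow>
         (\<^bold>\<exists>x y. x \<^bold>\<in> A \<^bold>\<and> y \<^bold>\<in> B \<^bold>\<and> fOpair z x y)) \<^bold>\<and>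
      (\<^bold>\<forall>x. x \<^bold>\<in> A \<^bold>\<longrightarrow> (\<^bold>\<exists>y. fRel f x y)) \<^bold>\<and>
      (\<^bold>\<forall>x y y'. fRel f x y \<^bold>\<and> fRel f x y' \<^bold>\<longrightarrow> y \<^bold>= y'))"

definition fInj :: "('p, 'i) name \<Rightarrow> 'p fml" where
  "fInj f = (\<^bold>\<forall>x x' y. fRel f x y \<^bold>\<and> fRel f x' y \<^bold>\<longrightarrow> x \<^bold>= x')"

text \<open>Zero and successor; a natural number is an ordinal \<open>n\<close> such that every element of
  \<open>n \<union> {n}\<close> is zero or a successor.\<close>

definition fEmpty :: "('p, 'i) name \<Rightarrow> 'p fml" where
  "fEmpty n = (\<^bold>\<forall>x. \<^bold>\<not> x \<^bold>\<in> n)"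

definition fSucc :: "('p, 'i) name \<Rightarrow> ('p, 'i) name \<Rightarrow> 'p fml" where
  "fSucc m k = (\<^bold>\<forall>x. x \<^bold>\<in> m \<^bold>\<longleftrightarrow> x \<^bold>\<in> k \<^bold>\<or> x \<^bold>= k)"

definition fTransitive :: "('p, 'i) name \<Rightarrow> 'p fml" where
  "fTransitive n = (\<^bold>\<forall>x. x \<^bold>\<in> n \<^bold>\<longrightarrow> x \<^bold>\<subseteq> n)"

definition fNat :: "('p, 'i) name \<Rightarrow> 'p fml" where
  "fNat n = (fTransitive n \<^bold>\<and>
     (\<^bold>\<forall>x. x \<^bold>\<in> n \<^bold>\<longrightarrow> fTransitive x) \<^bold>\<and>
     (\<^bold>\<forall>m. m \<^bold>\<in> n \<^bold>\<or> m \<^bold>= n \<^bold>\<longrightarrow>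
        fEmpty m \<^bold>\<or> (\<^bold>\<exists>k. fSucc m k)))"

definition fCountable :: "('p, 'i) name \<Rightarrow> 'p fml" where
  "fCountable A = (\<^bold>\<exists>w f.
     (\<^bold>\<forall>n. n \<^bold>\<in> w \<^bold>\<longleftrightarrow> fNat n) \<^bold>\<and> fFun f A w \<^bold>\<and> fInj f)"

text \<open>\<open>(Q, L)\<close> is a poset, where \<open>L = {(x, y). x \<le> y}\<close>\<close>

definition fPoset :: "('p, 'i) name \<Rightarrow> ('p, 'i) name \<Rightarrow> 'p fml" where
  "fPoset Q L =
     (\<^bold>\<not> fEmpty Q \<^bold>\<and>
      (\<^bold>\<forall>z. z \<^bold>\<in> L \<^bold>\<longrightarrow>
         (\<^bold>\<exists>x y. x \<^bold>\<in> Q \<^bold>\<and> y \<^bold>\<in> Q \<^bold>\<and> fOpair z x y)) \<^bold>\<and>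
      (\<^bold>\<forall>x. x \<^bold>\<in> Q \<^bold>\<longrightarrow> fRel L x x) \<^bold>\<and>
      (\<^bold>\<forall>x y z. fRel L x y \<^bold>\<and> fRel L y z \<^bold>\<longrightarrow> fRel L x z))"

text \<open>\<open>h \<le> f\<close> in the \<open>n\<close>-th power of \<open>(Q, L)\<close>, whose elements are the functions from \<open>n\<close> to \<open>Q\<close>\<close>

definition fPower_le :: "('p, 'i) name \<Rightarrow> ('p, 'i) name \<Rightarrow> ('p, 'i) name \<Rightarrow> ('p, 'i) name \<Rightarrow> 'p fml" where
  "fPower_le n L h f = (\<^bold>\<forall>k. k \<^bold>\<in> n \<^bold>\<longrightarrow>
     (\<^bold>\<exists>x y. fRel h k x \<^bold>\<and> fRel f k y \<^bold>\<and> fRel L x y))"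

definition fPower_ccc :: "('p, 'i) name \<Rightarrow> ('p, 'i) name \<Rightarrow> ('p, 'i) name \<Rightarrow> 'p fml" where
  "fPower_ccc n Q L = (\<^bold>\<forall>A.
     (\<^bold>\<forall>f. f \<^bold>\<in> A \<^bold>\<longrightarrow> fFun f n Q) \<^bold>\<and> \<^bold>\<not> fCountable A \<^bold>\<longrightarrow>
     (\<^bold>\<exists>f g. f \<^bold>\<in> A \<^bold>\<and> g \<^bold>\<in> A \<^bold>\<and> \<^bold>\<not> f \<^bold>= g \<^bold>\<and>
        (\<^bold>\<exists>h. fFun h n Q \<^bold>\<and> fPower_le n L h f \<^bold>\<and> fPower_le n L h g)))"

definition fPowerfully_ccc :: "('p, 'i) name \<Rightarrow> ('p, 'i) name \<Rightarrow> 'p fml" where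
  "fPowerfully_ccc Q L = (\<^bold>\<forall>n. fNat n \<^bold>\<longrightarrow> fPower_ccc n Q L)"


section \<open>Forcing statements about colorings\<close>

text \<open>Canonical names for von Neumann ordinals, sets of ordinals and the coloring. A poset need not
  have a largest element, so all conditions are attached to each element.\<close>

function ord_name :: "'p rel \<Rightarrow> 'w::wellorder \<Rightarrow> ('p, 'i) name" where
  "ord_name P \<alpha> = mk_name (\<Union>\<beta>\<in>{..<\<alpha>}. {ord_name P \<beta>} \<times> Field P)"
  by pat_completeness auto
termination
  by (relation "inv_image {(x :: 'w::wellorder, y). x < y} snd") (auto simp: wellorder_class.wf)

declare ord_name.simps [simp del] forces_eq.simps [simp del]

definition ord_set_name :: "'p rel \<Rightarrow> 'w::wellorder set \<Rightarrow> ('p, 'i) name" where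
  "ord_set_name P S = mk_name (\<Union>\<alpha>\<in>S. {ord_name P \<alpha>} \<times> Field P)"

definition upair_name :: "'p rel \<Rightarrow> ('p, 'i) name \<Rightarrow> ('p, 'i) name \<Rightarrow> ('p, 'i) name" where
  "upair_name P x y = mk_name ({x, y} \<times> Field P)"

definition opair_name :: "'p rel \<Rightarrow> ('p, 'i) name \<Rightarrow> ('p, 'i) name \<Rightarrow> ('p, 'i) name" where
  "opair_name P x y = upair_name P (upair_name P x x) (upair_name P x y)"

definition coloring_name :: "'p rel \<Rightarrow> (omega1 set \<Rightarrow> nat) \<Rightarrow> ('p, 'i) name" where
  "coloring_name P \<pi> =
     mk_name (\<Union>s\<in>[UNIV]\<^bsup>2\<^esup>. {opair_name P (ord_set_name P s) (ord_name P (\<pi> s))} \<times> Field P)"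

text \<open>\<open>c\<close> maps \<open>{x, y}\<close> to \<open>l\<close> for all \<open>x \<in> y\<close> in \<open>X\<close>\<close>

definition fHomogeneous :: "('p, 'i) name \<Rightarrow> ('p, 'i) name \<Rightarrow> ('p, 'i) name \<Rightarrow> 'p fml" where
  "fHomogeneous c l X = (\<^bold>\<forall>x y. x \<^bold>\<in> X \<^bold>\<and> y \<^bold>\<in> X \<^bold>\<and> x \<^bold>\<in> y \<^bold>\<longrightarrow>
     (\<^bold>\<exists>u. fUpair u x y \<^bold>\<and> fRel c u l))"

definition fNo_homogeneous :: "('p, 'i) name \<Rightarrow> ('p, 'i) name \<Rightarrow> ('p, 'i) name \<Rightarrow> 'p fml" where
  "fNo_homogeneous c W l = (\<^bold>\<not> (\<^bold>\<exists>X.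
     X \<^bold>\<subseteq> W \<^bold>\<and> \<^bold>\<not> fCountable X \<^bold>\<and> fHomogeneous c l X))"

text \<open>\<open>P\<close> forces that \<open>\<pi>\<close> has no uncountable \<open>l\<close>-homogeneous subset for any \<open>l < 2\<close>. The second
  argument only fixes the bound \<open>'i\<close> on the size of names.\<close>

definition forces_no_homogeneous :: "'p rel \<Rightarrow> 'i itself \<Rightarrow> (omega1 set \<Rightarrow> nat) \<Rightarrow> bool" where
  "forces_no_homogeneous P _ \<pi> \<longleftrightarrow>
     (let c = coloring_name P \<pi> :: ('p, 'i) name; W = ord_set_name P (UNIV :: omega1 set)
      in forces P (fNo_homogeneous c W (ord_name P (0::nat)) \<^bold>\<and>
                   fNo_homogeneous c W (ord_name P (1::nat))))"


section \<open>Finite support iterations\<close>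

text \<open>The ordinals up to the length \<open>\<nu>\<close> are elements of a well-ordered type. A condition of the
  \<open>\<alpha>\<close>-th stage is a sequence \<open>p\<close> of length \<open>\<alpha>\<close> with finite support. It is undefined outside its
  support; an undefined coordinate plays the role of the largest element of the iterand. A defined
  coordinate is a name in the domain of the name \<open>Q \<beta>\<close> for the underlying set of the iterand such that
  the restriction of \<open>p\<close> to \<open>\<beta>\<close> forces it to be in \<open>Q \<beta>\<close>. The value \<open>p \<beta>\<close> records this name by
  its index in \<open>Q \<beta>\<close> (a sequence of names over sequences of names would need a recursive type).\<close>

definition name_dom :: "('p, 'i) name \<Rightarrow> 'i set" where
  "name_dom \<tau> = {i. \<exists>\<sigma> C. entry \<tau> i = Some (\<sigma>, C) \<and> C \<noteq> {}}"

definition name_at :: "('p, 'i) name \<Rightarrow> 'i \<Rightarrow> ('p, 'i) name" where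
  "name_at \<tau> i = fst (the (entry \<tau> i))"

type_synonym ('o, 'i) cond = "'o \<Rightarrow> 'i option"

type_synonym ('o, 'i) iname = "(('o, 'i) cond, 'i) name"

definition fs_conditions ::
  "('o::wellorder \<Rightarrow> ('o, 'i) cond rel) \<Rightarrow> ('o \<Rightarrow> ('o, 'i) iname) \<Rightarrow> 'o \<Rightarrow> ('o, 'i) cond set" where
  "fs_conditions P Q \<alpha> = {p. finite (dom p) \<and> dom p \<subseteq> {..<\<alpha>} \<and>
     (\<forall>\<beta>\<in>dom p. p |` {..<\<beta>} \<in> Field (P \<beta>) \<and> the (p \<beta>) \<in> name_dom (Q \<beta>) \<and>
        (name_at (Q \<beta>) (the (p \<beta>)) \<^bold>\<in> Q \<beta>) (P \<beta>) (p |` {..<\<beta>}))}"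

text \<open>\<open>P \<alpha>\<close> for \<open>\<alpha> \<le> \<nu>\<close> are the stages; \<open>(Q \<beta>, L \<beta>)\<close> for \<open>\<beta> < \<nu>\<close> are the names of the iterands.\<close>

definition fs_iteration ::
  "'o::wellorder \<Rightarrow> ('o \<Rightarrow> ('o, 'i) cond rel) \<Rightarrow> ('o \<Rightarrow> ('o, 'i) iname) \<Rightarrow> ('o \<Rightarrow> ('o, 'i) iname) \<Rightarrow> bool"
  where
  "fs_iteration \<nu> P Q L \<longleftrightarrow>
     (\<forall>\<alpha>\<le>\<nu>. P \<alpha> = {(p, q). p \<in> fs_conditions P Q \<alpha> \<and> q \<in> fs_conditions P Q \<alpha> \<and>
        (\<forall>\<beta>\<in>dom q. \<beta> \<in> dom p \<and>
           fRel (L \<beta>) (name_at (Q \<beta>) (the (p \<beta>))) (name_at (Q \<beta>) (the (q \<beta>)))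
             (P \<beta>) (p |` {..<\<beta>}))}) \<and>
     (\<forall>\<beta><\<nu>. is_name (P \<beta>) (Q \<beta>) \<and> is_name (P \<beta>) (L \<beta>) \<and> forces (P \<beta>) (fPoset (Q \<beta>) (L \<beta>)))"

end

theory Submission
  imports Defs
begin

text \<open>Every stage of the iteration has precaliber \<open>\<omega>\<^sub>1\<close>, which implies that it is powerfully ccc. This is
  proved by induction. At limits one forms a \<open>\<Delta>\<close>-system of supports. For a successor stage
  \<open>P * Q\<close>, let \<open>(r\<^sub>x, q\<^sub>x)\<close> for \<open>x \<in> A\<close> be uncountably many conditions. As \<open>P\<close> has precaliber
  \<open>\<omega>\<^sub>1\<close>, we may assume that the \<open>r\<^sub>x\<close> are centered. Hypothesis (ii) for the color \<open>l\<close> yields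
  finite tuples \<open>a\<close> of indices, and for each of them a common lower bound of the \<open>r\<^sub>x\<close> for \<open>x \<in> a\<close>
  and the tuple of the names \<open>q\<^sub>x\<close>. Since \<open>P\<close> is ccc and forces the powers of \<open>Q\<close> to be ccc, two such
  tuples \<open>a < b\<close> are coordinatewise compatible, and \<open>\<pi>(a(i), b(i)) = l\<close> for some \<open>i\<close>. Hence among
  uncountably many conditions there are compatible ones whose indices have any prescribed color. So
  \<open>P * Q\<close> is ccc, and neither it nor any of its restrictions below a condition adds an uncountable
  homogeneous set. By hypothesis (i), Martin's axiom holds for these restrictions, and as CH fails it
  may be applied to \<open>\<omega>\<^sub>1\<close> many dense sets. This gives the precaliber.\<close>

section \<open>Forced equality and membership\<close>

text \<open>Precaliber \<open>\<omega>\<^sub>1\<close> is the property carried through the induction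
  because a chain condition only yields compatible pairs, whereas (ii) groups indices into finite
  tuples, each of which needs one condition below all the restrictions involved. A centered family
  supplies that condition.

  In (ii) the coordinate that has the prescribed color is not known in advance, so two tuples must
  be made compatible at every coordinate simultaneously. This is where arbitrary finite powers of
  the iterand enter. Both colors matter: an l-homogeneous set is refuted by a compatible pair of
  color 1 - l.

  Martin's axiom is used below a condition because the dense sets have to catch uncountably many
  members of the given family, and they are dense only below a condition every extension of which is
  compatible with uncountably many members.

  The whole argument stays in the ground model. That the iterand is powerfully ccc is a forced
  formula, so it can be applied only to names: families of tuples, functions on natural numbers and
  enumerations have to be built as names, and forced natural numbers and ordinals have to be decided
  by extensions. This is the purpose of the material on names.\<close>

text \<open>The parameter \<open>ty\<close> only fixes the bound \<open>'i\<close> on the size of names.\<close>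

locale forcing =
  fixes P :: "'p rel" and ty :: "'i itself"
  assumes preorder: "Preorder P" and large: "(UNIV :: nat set set) \<lesssim> (UNIV :: 'i set)"
begin

abbreviation le (infix "\<preceq>" 50) where "q \<preceq> p \<equiv> (q, p) \<in> P"

abbreviation forced :: "'p \<Rightarrow> 'p fml \<Rightarrow> bool" (infix "\<tturnstile>" 45) where "p \<tturnstile> \<phi> \<equiv> \<phi> P p"

lemma le_refl: "p \<in> Field P \<Longrightarrow> p \<preceq> p"
  using preorder by (auto simp: preorder_on_def refl_on_def)

lemma le_trans: "r \<preceq> q \<Longrightarrow> q \<preceq> p \<Longrightarrow> r \<preceq> p"
  using preorder by (auto simp: preorder_on_def dest: transD)

lemma le_Field: "q \<preceq> p \<Longrightarrow> q \<in> Field P" "q \<preceq> p \<Longrightarrow> p \<in> Field P"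
  by (auto simp: Field_def)

lemma le_refl': "q \<preceq> p \<Longrightarrow> q \<preceq> q"
  by (simp add: le_refl le_Field)

text \<open>Stability is monotonicity and closure under density. Outside the field of \<open>P\<close> the quantifiers over
  extensions are vacuous, so that every stable formula is forced there.\<close>

definition stable :: "'p fml \<Rightarrow> bool" where
  "stable \<phi> \<longleftrightarrow> (\<forall>p q. p \<tturnstile> \<phi> \<longrightarrow> q \<preceq> p \<longrightarrow> q \<tturnstile> \<phi>) \<and>
     (\<forall>p. (\<forall>q. q \<preceq> p \<longrightarrow> (\<exists>r. r \<preceq> q \<and> r \<tturnstile> \<phi>)) \<longrightarrow> p \<tturnstile> \<phi>)"

lemma stable_mono: "stable \<phi> \<Longrightarrow> p \<tturnstile> \<phi> \<Longrightarrow> q \<preceq> p \<Longrightarrow> q \<tturnstile> \<phi>"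
  unfolding stable_def by blast

lemma stable_dense: "stable \<phi> \<Longrightarrow> (\<And>q. q \<preceq> p \<Longrightarrow> \<exists>r. r \<preceq> q \<and> r \<tturnstile> \<phi>) \<Longrightarrow> p \<tturnstile> \<phi>"
  unfolding stable_def by blast

lemma stable_Not [intro]: "stable \<phi> \<Longrightarrow> stable (\<^bold>\<not> \<phi>)"
  unfolding stable_def fNot_def by (meson le_trans le_refl')

lemma stable_And [intro]: "stable \<phi> \<Longrightarrow> stable \<psi> \<Longrightarrow> stable (\<phi> \<^bold>\<and> \<psi>)"
  unfolding stable_def fAnd_def by (meson le_trans le_refl')

lemma stable_All [intro]: "(\<And>x. stable (F x)) \<Longrightarrow> stable (\<^bold>\<forall>x. F x)"
  unfolding stable_def fAll_def by (meson le_trans le_refl')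

lemma stable_Or [intro]: "stable \<phi> \<Longrightarrow> stable \<psi> \<Longrightarrow> stable (\<phi> \<^bold>\<or> \<psi>)"
  unfolding fOr_def by blast

lemma stable_Imp [intro]: "stable \<phi> \<Longrightarrow> stable \<psi> \<Longrightarrow> stable (\<phi> \<^bold>\<longrightarrow> \<psi>)"
  unfolding fImp_def by blast

lemma stable_Iff [intro]: "stable \<phi> \<Longrightarrow> stable \<psi> \<Longrightarrow> stable (\<phi> \<^bold>\<longleftrightarrow> \<psi>)"
  unfolding fIff_def by blast

lemma stable_Ex [intro]: "(\<And>x. stable (F x)) \<Longrightarrow> stable (\<^bold>\<exists>x. F x)"
  unfolding fEx_def by blast

section \<open>Forcing clauses for the connectives\<close>

lemma forced_Not: "p \<tturnstile> (\<^bold>\<not> \<phi>) \<longleftrightarrow> (\<forall>q. q \<preceq> p \<longrightarrow> \<not> q \<tturnstile> \<phi>)"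
  by (simp add: fNot_def)

lemma forced_And: "p \<tturnstile> (\<phi> \<^bold>\<and> \<psi>) \<longleftrightarrow> p \<tturnstile> \<phi> \<and> p \<tturnstile> \<psi>"
  by (simp add: fAnd_def)

lemma forced_All: "p \<tturnstile> (\<^bold>\<forall>x. F x) \<longleftrightarrow> (\<forall>x. is_name P x \<longrightarrow> p \<tturnstile> F x)"
  by (simp add: fAll_def)

lemma forced_Or:
  "p \<tturnstile> (\<phi> \<^bold>\<or> \<psi>) \<longleftrightarrow> (\<forall>q. q \<preceq> p \<longrightarrow> (\<exists>r. r \<preceq> q \<and> (r \<tturnstile> \<phi> \<or> r \<tturnstile> \<psi>)))"
  unfolding fOr_def fNot_def fAnd_def by blast

lemma forced_Ex:
  "p \<tturnstile> (\<^bold>\<exists>x. F x) \<longleftrightarrow> (\<forall>q. q \<preceq> p \<longrightarrow> (\<exists>r. r \<preceq> q \<and> (\<exists>x. is_name P x \<and> r \<tturnstile> F x)))"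
  unfolding fEx_def fNot_def fAll_def by blast

text \<open>Unfolding the negations gives the conclusion only densely below each extension that
  forces the premise. Monotonicity of \<open>\<phi>\<close> and closure of \<open>\<psi>\<close>
  under density remove the detour.\<close>

lemma forced_Imp:
  assumes "stable \<phi>" "stable \<psi>"
  shows "p \<tturnstile> (\<phi> \<^bold>\<longrightarrow> \<psi>) \<longleftrightarrow> (\<forall>q. q \<preceq> p \<longrightarrow> q \<tturnstile> \<phi> \<longrightarrow> q \<tturnstile> \<psi>)"
proof -
  have "p \<tturnstile> (\<phi> \<^bold>\<longrightarrow> \<psi>) \<longleftrightarrow> (\<forall>q. q \<preceq> p \<longrightarrow> q \<tturnstile> \<phi> \<longrightarrow> (\<exists>r. r \<preceq> q \<and> r \<tturnstile> \<psi>))"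
    unfolding fImp_def fNot_def fAnd_def by blast
  then show ?thesis
    using assms unfolding stable_def by (meson le_trans le_refl')
qed

lemma forced_Iff:
  assumes "stable \<phi>" "stable \<psi>"
  shows "p \<tturnstile> (\<phi> \<^bold>\<longleftrightarrow> \<psi>) \<longleftrightarrow> (\<forall>q. q \<preceq> p \<longrightarrow> q \<tturnstile> \<phi> \<longleftrightarrow> q \<tturnstile> \<psi>)"
  unfolding fIff_def using assms by (auto simp: forced_And forced_Imp)

section \<open>Equality and membership of names as a congruence\<close>

lemma eq_refl: "p \<tturnstile> \<sigma> \<^bold>= \<sigma>" for \<sigma> :: "('p, 'i) name"
  unfolding fEq_def
proof (induction \<sigma> arbitrary: p rule: wf_induct_rule[OF wf_name_child])
  case (1 \<sigma>)
  then have "forces_eq P x x q" if "(x, s) \<in> elts \<sigma>" for x s q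
    using that by (auto simp: name_child_def)
  then show ?case
    by (subst forces_eq.simps) (blast intro: le_refl')
qed

lemma eq_sym: "p \<tturnstile> \<sigma> \<^bold>= \<tau> \<Longrightarrow> p \<tturnstile> \<tau> \<^bold>= \<sigma>" for \<sigma> \<tau> :: "('p, 'i) name"
  unfolding fEq_def
proof (induction \<sigma> arbitrary: \<tau> p rule: wf_induct_rule[OF wf_name_child])
  case (1 \<sigma>)
  have IH: "forces_eq P y x q" if "(x, s) \<in> elts \<sigma>" "forces_eq P x y q" for x y s q
    using that 1(1) by (auto simp: name_child_def)
  have L: "\<And>x s q. (x, s) \<in> elts \<sigma> \<Longrightarrow> q \<preceq> p \<Longrightarrow> q \<preceq> s \<Longrightarrow>
      \<exists>r. r \<preceq> q \<and> (\<exists>y t. (y, t) \<in> elts \<tau> \<and> r \<preceq> t \<and> forces_eq P x y r)"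
    "\<And>y t q. (y, t) \<in> elts \<tau> \<Longrightarrow> q \<preceq> p \<Longrightarrow> q \<preceq> t \<Longrightarrow>
      \<exists>r. r \<preceq> q \<and> (\<exists>x s. (x, s) \<in> elts \<sigma> \<and> r \<preceq> s \<and> forces_eq P x y r)"
    using 1(2) by (auto simp: forces_eq.simps[of P \<sigma> \<tau> p] Ball_def Bex_def)
  have "\<exists>r. r \<preceq> q \<and> (\<exists>x s. (x, s) \<in> elts \<sigma> \<and> r \<preceq> s \<and> forces_eq P y x r)"
    if "(y, t) \<in> elts \<tau>" "q \<preceq> p" "q \<preceq> t" for y t q
    using L(2)[OF that] IH by blast
  moreover have "\<exists>r. r \<preceq> q \<and> (\<exists>y t. (y, t) \<in> elts \<tau> \<and> r \<preceq> t \<and> forces_eq P y x r)"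
    if "(x, s) \<in> elts \<sigma>" "q \<preceq> p" "q \<preceq> s" for x s q
    using L(1)[OF that] IH[OF that(1)] by blast
  ultimately show ?case
    by (simp add: forces_eq.simps[of P \<tau> \<sigma> p] Ball_def Bex_def)
qed

lemma forced_mem:
  "p \<tturnstile> \<sigma> \<^bold>\<in> \<tau> \<longleftrightarrow> (\<forall>q. q \<preceq> p \<longrightarrow>
     (\<exists>r. r \<preceq> q \<and> (\<exists>y t. (y, t) \<in> elts \<tau> \<and> r \<preceq> t \<and> r \<tturnstile> \<sigma> \<^bold>= y)))"
  for \<sigma> \<tau> :: "('p, 'i) name"
  unfolding fMem_def fEq_def by (auto simp: Bex_def)

text \<open>Expresses the recursion for equality through membership, the form in which later
  arguments use it. The recursion always puts the child of \<open>\<sigma>\<close> before the child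
  of \<open>\<tau>\<close>, while membership puts the element first; symmetry reconciles the
  two.\<close>

lemma forced_eq:
  "p \<tturnstile> \<sigma> \<^bold>= \<tau> \<longleftrightarrow>
    (\<forall>x s q. (x, s) \<in> elts \<sigma> \<longrightarrow> q \<preceq> p \<longrightarrow> q \<preceq> s \<longrightarrow> q \<tturnstile> x \<^bold>\<in> \<tau>) \<and>
    (\<forall>y t q. (y, t) \<in> elts \<tau> \<longrightarrow> q \<preceq> p \<longrightarrow> q \<preceq> t \<longrightarrow> q \<tturnstile> y \<^bold>\<in> \<sigma>)"
  (is "?L \<longleftrightarrow> ?R")
  for \<sigma> \<tau> :: "('p, 'i) name"
proof
  assume ?L
  then have *: "\<And>x s q. (x, s) \<in> elts \<sigma> \<Longrightarrow> q \<preceq> p \<Longrightarrow> q \<preceq> s \<Longrightarrow>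
      \<exists>r. r \<preceq> q \<and> (\<exists>y t. (y, t) \<in> elts \<tau> \<and> r \<preceq> t \<and> r \<tturnstile> x \<^bold>= y)"
    "\<And>y t q. (y, t) \<in> elts \<tau> \<Longrightarrow> q \<preceq> p \<Longrightarrow> q \<preceq> t \<Longrightarrow>
      \<exists>r. r \<preceq> q \<and> (\<exists>x s. (x, s) \<in> elts \<sigma> \<and> r \<preceq> s \<and> r \<tturnstile> x \<^bold>= y)"
    by (auto simp: fEq_def forces_eq.simps[of P \<sigma> \<tau> p] Ball_def Bex_def)
  show ?R
    unfolding forced_mem
    apply (intro conjI allI impI)
     apply (meson le_trans *(1))
    apply (meson le_trans *(2) eq_sym)
    done
next
  assume R: ?R
  have 1: "\<exists>r. r \<preceq> q \<and> (\<exists>y t. (y, t) \<in> elts \<tau> \<and> r \<preceq> t \<and> r \<tturnstile> x \<^bold>= y)"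
    if "(x, s) \<in> elts \<sigma>" "q \<preceq> p" "q \<preceq> s" for x s q
    using R that unfolding forced_mem by (meson le_refl')
  have 2: "\<exists>r. r \<preceq> q \<and> (\<exists>y t. (y, t) \<in> elts \<sigma> \<and> r \<preceq> t \<and> r \<tturnstile> y \<^bold>= x)"
    if "(x, s) \<in> elts \<tau>" "q \<preceq> p" "q \<preceq> s" for x s q
    using R that unfolding forced_mem by (meson le_refl' eq_sym)
  show ?L
    unfolding fEq_def using 1[unfolded fEq_def] 2[unfolded fEq_def]
    by (subst forces_eq.simps) (auto simp: Ball_def Bex_def)
qed

lemma stable_mem [intro]: "stable (\<sigma> \<^bold>\<in> \<tau>)" for \<sigma> \<tau> :: "('p, 'i) name"
  unfolding stable_def forced_mem by (meson le_trans le_refl')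

text \<open>Closure under density is visible for membership, whose definition is itself a density
  statement. \<open>forced_eq\<close> transfers it to equality.\<close>

lemma stable_eq [intro]: "stable (\<sigma> \<^bold>= \<tau>)" for \<sigma> \<tau> :: "('p, 'i) name"
  unfolding stable_def
proof (intro conjI allI impI)
  fix p q assume "p \<tturnstile> \<sigma> \<^bold>= \<tau>" "q \<preceq> p"
  then show "q \<tturnstile> \<sigma> \<^bold>= \<tau>" unfolding forced_eq by (meson le_trans)
next
  fix p assume *: "\<forall>q. q \<preceq> p \<longrightarrow> (\<exists>r. r \<preceq> q \<and> r \<tturnstile> \<sigma> \<^bold>= \<tau>)"
  show "p \<tturnstile> \<sigma> \<^bold>= \<tau>"
    unfolding forced_eq
  proof (intro conjI allI impI)
    fix x s q assume a: "(x, s) \<in> elts \<sigma>" "q \<preceq> p" "q \<preceq> s"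
    show "q \<tturnstile> x \<^bold>\<in> \<tau>"
    proof (rule stable_dense[OF stable_mem])
      fix r assume r: "r \<preceq> q"
      then obtain t where "t \<preceq> r" "t \<tturnstile> \<sigma> \<^bold>= \<tau>" using * a le_trans by meson
      with a r show "\<exists>t. t \<preceq> r \<and> t \<tturnstile> x \<^bold>\<in> \<tau>"
        unfolding forced_eq by (meson le_trans le_refl')
    qed
  next
    fix x s q assume a: "(x, s) \<in> elts \<tau>" "q \<preceq> p" "q \<preceq> s"
    show "q \<tturnstile> x \<^bold>\<in> \<sigma>"
    proof (rule stable_dense[OF stable_mem])
      fix r assume r: "r \<preceq> q"
      then obtain t where "t \<preceq> r" "t \<tturnstile> \<sigma> \<^bold>= \<tau>" using * a le_trans by meson
      with a r show "\<exists>t. t \<preceq> r \<and> t \<tturnstile> x \<^bold>\<in> \<sigma>"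
        unfolding forced_eq by (meson le_trans le_refl')
    qed
  qed
qed

lemmas eq_mono = stable_mono[OF stable_eq]
lemmas mem_mono = stable_mono[OF stable_mem]

text \<open>Induction on \<open>\<sigma>\<close> alone is enough: in the second half the chain runs
  from a child of \<open>\<upsilon>\<close> to a child of \<open>\<sigma>\<close>, and symmetry
  reverses it so that it starts at the child of \<open>\<sigma>\<close> again.\<close>

lemma eq_trans: "p \<tturnstile> \<sigma> \<^bold>= \<tau> \<Longrightarrow> p \<tturnstile> \<tau> \<^bold>= \<upsilon> \<Longrightarrow> p \<tturnstile> \<sigma> \<^bold>= \<upsilon>"
  for \<sigma> \<tau> \<upsilon> :: "('p, 'i) name"
proof (induction \<sigma> arbitrary: \<tau> \<upsilon> p rule: wf_induct_rule[OF wf_name_child])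
  case (1 \<sigma>)
  have IH: "q \<tturnstile> x \<^bold>= z" if "(x, s) \<in> elts \<sigma>" "q \<tturnstile> x \<^bold>= y" "q \<tturnstile> y \<^bold>= z" for x y z s q
    by (rule 1(1)[OF _ that(2,3)]) (use that(1) in \<open>auto simp: name_child_def\<close>)
  show ?case
    unfolding forced_eq[of \<sigma> \<upsilon>]
  proof (intro conjI allI impI)
    fix x s q assume a: "(x, s) \<in> elts \<sigma>" "q \<preceq> p" "q \<preceq> s"
    have m: "q \<tturnstile> x \<^bold>\<in> \<tau>" using 1(2) a by (auto simp: forced_eq[of _ _ p])
    show "q \<tturnstile> x \<^bold>\<in> \<upsilon>"
      unfolding forced_mem
    proof (intro allI impI)
      fix r assume r: "r \<preceq> q"
      obtain u y t where u: "u \<preceq> r" "(y, t) \<in> elts \<tau>" "u \<preceq> t" "u \<tturnstile> x \<^bold>= y"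
        using m r unfolding forced_mem by blast
      have "u \<preceq> p" using u r a le_trans by meson
      then have "u \<tturnstile> y \<^bold>\<in> \<upsilon>" using 1(3) u by (auto simp: forced_eq[of _ _ p])
      then obtain v z w where "v \<preceq> u" "(z, w) \<in> elts \<upsilon>" "v \<preceq> w" "v \<tturnstile> y \<^bold>= z"
        using le_refl'[OF u(1)] unfolding forced_mem by blast
      then show "\<exists>v. v \<preceq> r \<and> (\<exists>z w. (z, w) \<in> elts \<upsilon> \<and> v \<preceq> w \<and> v \<tturnstile> x \<^bold>= z)"
        using u IH[OF a(1)] by (meson eq_mono le_trans)
    qed
  next
    fix z w q assume a: "(z, w) \<in> elts \<upsilon>" "q \<preceq> p" "q \<preceq> w"
    have m: "q \<tturnstile> z \<^bold>\<in> \<tau>" using 1(3) a by (auto simp: forced_eq[of _ _ p])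
    show "q \<tturnstile> z \<^bold>\<in> \<sigma>"
      unfolding forced_mem
    proof (intro allI impI)
      fix r assume r: "r \<preceq> q"
      obtain u y t where u: "u \<preceq> r" "(y, t) \<in> elts \<tau>" "u \<preceq> t" "u \<tturnstile> z \<^bold>= y"
        using m r unfolding forced_mem by blast
      have "u \<preceq> p" using u r a le_trans by meson
      then have "u \<tturnstile> y \<^bold>\<in> \<sigma>" using 1(2) u by (auto simp: forced_eq[of _ _ p])
      then obtain v x s where "v \<preceq> u" "(x, s) \<in> elts \<sigma>" "v \<preceq> s" "v \<tturnstile> y \<^bold>= x"
        using le_refl'[OF u(1)] unfolding forced_mem by blast
      then show "\<exists>v. v \<preceq> r \<and> (\<exists>x s. (x, s) \<in> elts \<sigma> \<and> v \<preceq> s \<and> v \<tturnstile> z \<^bold>= x)"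
        using u IH by (meson eq_mono eq_sym le_trans)
    qed
  qed
qed

lemma mem_cong_left: "p \<tturnstile> x \<^bold>= x' \<Longrightarrow> p \<tturnstile> x \<^bold>\<in> y \<Longrightarrow> p \<tturnstile> x' \<^bold>\<in> y"
  for x x' y :: "('p, 'i) name"
  unfolding forced_mem by (meson eq_mono eq_sym eq_trans le_trans)

lemma mem_cong_right:
  fixes x y y' :: "('p, 'i) name"
  assumes "p \<tturnstile> y \<^bold>= y'" "p \<tturnstile> x \<^bold>\<in> y"
  shows "p \<tturnstile> x \<^bold>\<in> y'"
proof (rule stable_dense[OF stable_mem])
  fix q assume q: "q \<preceq> p"
  then obtain r z t where r: "r \<preceq> q" "(z, t) \<in> elts y" "r \<preceq> t" "r \<tturnstile> x \<^bold>= z"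
    using assms(2) unfolding forced_mem by blast
  moreover have "r \<preceq> p" using r q le_trans by meson
  ultimately have "r \<tturnstile> z \<^bold>\<in> y'" using assms(1) unfolding forced_eq by blast
  then show "\<exists>r. r \<preceq> q \<and> r \<tturnstile> x \<^bold>\<in> y'" using r mem_cong_left eq_sym by meson
qed

lemma child_mem: "(x, s) \<in> elts \<tau> \<Longrightarrow> p \<preceq> s \<Longrightarrow> p \<tturnstile> x \<^bold>\<in> \<tau>" for x \<tau> :: "('p, 'i) name"
  unfolding forced_mem by (meson eq_refl le_trans le_refl')

lemma is_name_child: "is_name P \<tau> \<Longrightarrow> (x, s) \<in> elts \<tau> \<Longrightarrow> is_name P x \<and> s \<in> Field P"
  for x \<tau> :: "('p, 'i) name"
  by (auto elim: is_name.cases)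

text \<open>Extensionality with the quantifier restricted to names over \<open>P\<close>, as in
  \<open>fAll\<close>. It suffices to test names because the children of a name are names.\<close>

lemma eq_ext:
  fixes \<sigma> \<tau> :: "('p, 'i) name"
  assumes "is_name P \<sigma>" "is_name P \<tau>"
    and "\<And>q x. q \<preceq> p \<Longrightarrow> is_name P x \<Longrightarrow> q \<tturnstile> x \<^bold>\<in> \<sigma> \<longleftrightarrow> q \<tturnstile> x \<^bold>\<in> \<tau>"
  shows "p \<tturnstile> \<sigma> \<^bold>= \<tau>"
  unfolding forced_eq using assms is_name_child child_mem by blast

section \<open>Names of small families\<close>

lemma countable_lepoll_names: "countable J \<Longrightarrow> J \<lesssim> (UNIV :: 'i set)"
proof -
  assume "countable J"
  then have "J \<lesssim> (UNIV :: nat set)" by (auto simp: countable_def lepoll_def)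
  also have "(UNIV :: nat set) \<lesssim> (UNIV :: nat set set)"
    by (metis Pow_UNIV lepoll_Pow_self)
  also note large
  finally show ?thesis .
qed

lemma elts_mk:
  assumes "J \<lesssim> (UNIV :: 'i set)"
  shows "elts (mk_name (\<Union>j\<in>J. {t j :: ('p, 'i) name} \<times> C j)) = (\<Union>j\<in>J. {t j} \<times> C j)"
proof (rule elts_mk_name)
  have "fst ` (\<Union>j\<in>J. {t j} \<times> C j) \<subseteq> t ` J" by auto
  then show "fst ` (\<Union>j\<in>J. {t j} \<times> C j) \<lesssim> (UNIV :: 'i set)"
    by (meson assms image_lepoll subset_imp_lepoll lepoll_trans)
qed

lemma is_name_mk:
  assumes "J \<lesssim> (UNIV :: 'i set)"
    and "\<And>j. j \<in> J \<Longrightarrow> is_name P (t j :: ('p, 'i) name)" "\<And>j. j \<in> J \<Longrightarrow> C j \<subseteq> Field P"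
  shows "is_name P (mk_name (\<Union>j\<in>J. {t j} \<times> C j))"
  using assms(2,3) by (intro is_name.intros) (auto simp: elts_mk[OF assms(1)])

lemma mem_mk:
  fixes x :: "('p, 'i) name"
  assumes "J \<lesssim> (UNIV :: 'i set)"
  shows "p \<tturnstile> x \<^bold>\<in> mk_name (\<Union>j\<in>J. {t j} \<times> C j) \<longleftrightarrow>
    (\<forall>q. q \<preceq> p \<longrightarrow> (\<exists>r. r \<preceq> q \<and> (\<exists>j\<in>J. \<exists>s\<in>C j. r \<preceq> s \<and> r \<tturnstile> x \<^bold>= t j)))"
proof -
  have "(\<exists>y s. (y, s) \<in> (\<Union>j\<in>J. {t j} \<times> C j) \<and> r \<preceq> s \<and> r \<tturnstile> x \<^bold>= y) \<longleftrightarrow>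
      (\<exists>j\<in>J. \<exists>s\<in>C j. r \<preceq> s \<and> r \<tturnstile> x \<^bold>= t j)" for r
    by blast
  then show ?thesis unfolding forced_mem elts_mk[OF assms] by (simp only:)
qed

text \<open>When every condition is attached to each entry, the extension \<open>r\<close> can serve
  as its own attached condition, and the side condition \<open>r \<preceq> s\<close>
  disappears.\<close>

lemma mem_mk_Field:
  fixes x :: "('p, 'i) name"
  assumes "J \<lesssim> (UNIV :: 'i set)"
  shows "p \<tturnstile> x \<^bold>\<in> mk_name (\<Union>j\<in>J. {t j} \<times> Field P) \<longleftrightarrow>
    (\<forall>q. q \<preceq> p \<longrightarrow> (\<exists>r. r \<preceq> q \<and> (\<exists>j\<in>J. r \<tturnstile> x \<^bold>= t j)))"
  unfolding mem_mk[OF assms] by (meson le_Field le_refl)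

section \<open>Unordered and ordered pairs\<close>

lemma upair_name_eq: "upair_name P x y = mk_name (\<Union>j\<in>{x, y}. {j} \<times> Field P)"
  by (auto simp: upair_name_def intro!: arg_cong[where f = mk_name])

lemma is_name_upair [intro]:
  "is_name P x \<Longrightarrow> is_name P y \<Longrightarrow> is_name P (upair_name P x y)" for x y :: "('p, 'i) name"
  unfolding upair_name_eq by (intro is_name_mk countable_lepoll_names) auto

lemma is_name_opair [intro]:
  "is_name P x \<Longrightarrow> is_name P y \<Longrightarrow> is_name P (opair_name P x y)" for x y :: "('p, 'i) name"
  unfolding opair_name_def by (intro is_name_upair)

lemma mem_upair: "p \<tturnstile> z \<^bold>\<in> upair_name P x y \<longleftrightarrow>
    (\<forall>q. q \<preceq> p \<longrightarrow> (\<exists>r. r \<preceq> q \<and> (r \<tturnstile> z \<^bold>= x \<or> r \<tturnstile> z \<^bold>= y)))"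
  for x y z :: "('p, 'i) name"
  unfolding upair_name_eq by (subst mem_mk_Field) (auto intro: countable_lepoll_names)

lemma stable_Upair [intro]: "stable (fUpair z x y)" for x y z :: "('p, 'i) name"
  unfolding fUpair_def by blast

lemma forced_Upair:
  fixes x y z :: "('p, 'i) name"
  assumes "is_name P x" "is_name P y" "is_name P z"
  shows "p \<tturnstile> fUpair z x y \<longleftrightarrow> p \<tturnstile> z \<^bold>= upair_name P x y"
proof -
  have "p \<tturnstile> fUpair z x y \<longleftrightarrow>
      (\<forall>w. is_name P w \<longrightarrow> (\<forall>q. q \<preceq> p \<longrightarrow> q \<tturnstile> w \<^bold>\<in> z \<longleftrightarrow> q \<tturnstile> w \<^bold>\<in> upair_name P x y))"
    unfolding fUpair_def forced_All
    by (simp add: forced_Iff stable_mem stable_eq stable_Or forced_Or mem_upair)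
  also have "\<dots> \<longleftrightarrow> p \<tturnstile> z \<^bold>= upair_name P x y"
    using assms eq_ext[of z "upair_name P x y" p]
    by (meson is_name_upair mem_cong_right eq_sym eq_mono)
  finally show ?thesis .
qed

lemma upair_cong:
  fixes x y x' y' :: "('p, 'i) name"
  assumes "p \<tturnstile> x \<^bold>= x'" "p \<tturnstile> y \<^bold>= y'" 
    and "is_name P x" "is_name P y" "is_name P x'" "is_name P y'"
  shows "p \<tturnstile> upair_name P x y \<^bold>= upair_name P x' y'"
proof (rule eq_ext)
  fix q z assume q: "q \<preceq> p"
  then have "r \<tturnstile> z \<^bold>= x \<longleftrightarrow> r \<tturnstile> z \<^bold>= x'" "r \<tturnstile> z \<^bold>= y \<longleftrightarrow> r \<tturnstile> z \<^bold>= y'" if "r \<preceq> q" for r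
    using assms(1,2) that by (meson eq_mono eq_sym eq_trans)+
  then show "q \<tturnstile> z \<^bold>\<in> upair_name P x y \<longleftrightarrow> q \<tturnstile> z \<^bold>\<in> upair_name P x' y'"
    unfolding mem_upair by (meson le_trans)
qed (use assms in blast)+

lemma opair_cong:
  fixes x y x' y' :: "('p, 'i) name"
  assumes "p \<tturnstile> x \<^bold>= x'" "p \<tturnstile> y \<^bold>= y'" 
    and "is_name P x" "is_name P y" "is_name P x'" "is_name P y'"
  shows "p \<tturnstile> opair_name P x y \<^bold>= opair_name P x' y'"
  unfolding opair_name_def using assms by (intro upair_cong is_name_upair)

lemma upair_mem_left: "p \<tturnstile> x \<^bold>\<in> upair_name P x y" and upair_mem_right: "p \<tturnstile> y \<^bold>\<in> upair_name P x y"
  for x y :: "('p, 'i) name"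
  unfolding mem_upair using eq_refl le_refl' by blast+

text \<open>The elements match only up to a swap, and \<open>p\<close> need not decide which way, so
  the conclusion is about an extension. Four successive refinements decide, for each of the four
  elements, which element of the other pair it equals.\<close>

lemma upair_inject:
  fixes a b c d :: "('p, 'i) name"
  assumes e: "p \<tturnstile> upair_name P a b \<^bold>= upair_name P c d" and q: "q \<preceq> p"
  shows "\<exists>r. r \<preceq> q \<and> (r \<tturnstile> a \<^bold>= c \<and> r \<tturnstile> b \<^bold>= d \<or> r \<tturnstile> a \<^bold>= d \<and> r \<tturnstile> b \<^bold>= c)"
proof -
  have m: "p \<tturnstile> a \<^bold>\<in> upair_name P c d" "p \<tturnstile> b \<^bold>\<in> upair_name P c d"
      "p \<tturnstile> c \<^bold>\<in> upair_name P a b" "p \<tturnstile> d \<^bold>\<in> upair_name P a b"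
    using e upair_mem_left upair_mem_right mem_cong_right eq_sym by blast+
  obtain r1 where r1: "r1 \<preceq> q" "r1 \<tturnstile> a \<^bold>= c \<or> r1 \<tturnstile> a \<^bold>= d"
    using m(1) q unfolding mem_upair by blast
  then have "r1 \<preceq> p" using q le_trans by blast
  then obtain r2 where r2: "r2 \<preceq> r1" "r2 \<tturnstile> b \<^bold>= c \<or> r2 \<tturnstile> b \<^bold>= d"
    using m(2) unfolding mem_upair by blast
  then have "r2 \<preceq> p" using \<open>r1 \<preceq> p\<close> le_trans by blast
  then obtain r3 where r3: "r3 \<preceq> r2" "r3 \<tturnstile> c \<^bold>= a \<or> r3 \<tturnstile> c \<^bold>= b"
    using m(3) unfolding mem_upair by blast
  then have "r3 \<preceq> p" using \<open>r2 \<preceq> p\<close> le_trans by blast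
  then obtain r4 where r4: "r4 \<preceq> r3" "r4 \<tturnstile> d \<^bold>= a \<or> r4 \<tturnstile> d \<^bold>= b"
    using m(4) unfolding mem_upair by blast
  have "r4 \<preceq> q" using r1 r2 r3 r4 le_trans by blast
  moreover have "r4 \<tturnstile> a \<^bold>= c \<or> r4 \<tturnstile> a \<^bold>= d" "r4 \<tturnstile> b \<^bold>= c \<or> r4 \<tturnstile> b \<^bold>= d"
    "r4 \<tturnstile> c \<^bold>= a \<or> r4 \<tturnstile> c \<^bold>= b" "r4 \<tturnstile> d \<^bold>= a \<or> r4 \<tturnstile> d \<^bold>= b"
    using r1 r2 r3 r4 le_trans eq_mono by meson+
  ultimately show ?thesis by (meson eq_sym eq_trans)
qed

text \<open>Here both ways of matching the inner pairs lead to the same equations, so the equations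
  hold densely below \<open>p\<close> and hence at \<open>p\<close> itself.\<close>

lemma opair_inject:
  fixes a b c d :: "('p, 'i) name"
  assumes e: "p \<tturnstile> opair_name P a b \<^bold>= opair_name P c d"
  shows "p \<tturnstile> a \<^bold>= c" "p \<tturnstile> b \<^bold>= d"
proof -
  have "\<exists>r. r \<preceq> q \<and> r \<tturnstile> a \<^bold>= c \<and> r \<tturnstile> b \<^bold>= d" if q: "q \<preceq> p" for q
  proof -
    obtain r where r: "r \<preceq> q" 
        "r \<tturnstile> upair_name P a a \<^bold>= upair_name P c c \<and> r \<tturnstile> upair_name P a b \<^bold>= upair_name P c d \<or>
         r \<tturnstile> upair_name P a a \<^bold>= upair_name P c d \<and> r \<tturnstile> upair_name P a b \<^bold>= upair_name P c c"
      using upair_inject[OF e[unfolded opair_name_def] q] by blast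
    from r(2) show ?thesis
    proof (elim disjE conjE)
      assume *: "r \<tturnstile> upair_name P a a \<^bold>= upair_name P c c" "r \<tturnstile> upair_name P a b \<^bold>= upair_name P c d"
      obtain r1 where r1: "r1 \<preceq> r" "r1 \<tturnstile> a \<^bold>= c"
        using upair_inject[OF *(1) le_refl'[OF r(1)]] by blast
      obtain r2 where "r2 \<preceq> r1" "r2 \<tturnstile> a \<^bold>= c \<and> r2 \<tturnstile> b \<^bold>= d \<or> r2 \<tturnstile> a \<^bold>= d \<and> r2 \<tturnstile> b \<^bold>= c"
        using upair_inject[OF *(2) r1(1)] by blast
      then show ?thesis using r r1 by (meson eq_mono eq_sym eq_trans le_trans)
    next
      \<comment> \<open>The crossed match makes \<open>a\<close>, \<open>c\<close> and
        \<open>d\<close> equal, and \<open>b\<close> equal to \<open>c\<close>, so that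
        \<open>b\<close> equals \<open>d\<close> as well.\<close>
      assume *: "r \<tturnstile> upair_name P a a \<^bold>= upair_name P c d" "r \<tturnstile> upair_name P a b \<^bold>= upair_name P c c"
      obtain r1 where r1: "r1 \<preceq> r" "r1 \<tturnstile> a \<^bold>= c" "r1 \<tturnstile> a \<^bold>= d"
        using upair_inject[OF *(1) le_refl'[OF r(1)]] by blast
      obtain r2 where "r2 \<preceq> r1" "r2 \<tturnstile> b \<^bold>= c"
        using upair_inject[OF *(2) r1(1)] by blast
      then show ?thesis using r r1 by (meson eq_mono eq_sym eq_trans le_trans)
    qed
  qed
  then show "p \<tturnstile> a \<^bold>= c" "p \<tturnstile> b \<^bold>= d"
    using stable_dense[OF stable_eq] by meson+
qed

lemma stable_Opair [intro]: "stable (fOpair z x y)" for x y z :: "('p, 'i) name"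
  unfolding fOpair_def by blast

lemma forced_Opair:
  fixes x y z :: "('p, 'i) name"
  assumes [simp]: "is_name P x" "is_name P y" "is_name P z"
  shows "p \<tturnstile> fOpair z x y \<longleftrightarrow> p \<tturnstile> z \<^bold>= opair_name P x y"
proof
  assume *: "p \<tturnstile> fOpair z x y"
  show "p \<tturnstile> z \<^bold>= opair_name P x y"
  proof (rule stable_dense[OF stable_eq])
    fix q assume q: "q \<preceq> p"
    then obtain r1 u where r1: "r1 \<preceq> q" "is_name P u"
        "r1 \<tturnstile> (\<^bold>\<exists>v. fUpair u x x \<^bold>\<and> fUpair v x y \<^bold>\<and> fUpair z u v)"
      using * unfolding fOpair_def forced_Ex[of _ p] by blast
    then obtain r2 v where r2: "r2 \<preceq> r1" "is_name P v"
        "r2 \<tturnstile> fUpair u x x" "r2 \<tturnstile> fUpair v x y" "r2 \<tturnstile> fUpair z u v"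
      using le_refl'[OF r1(1)] unfolding forced_Ex forced_And by blast
    then have "r2 \<tturnstile> z \<^bold>= opair_name P x y"
      using r1 unfolding opair_name_def
      by (simp add: forced_Upair) (meson assms is_name_upair upair_cong eq_trans)
    then show "\<exists>r. r \<preceq> q \<and> r \<tturnstile> z \<^bold>= opair_name P x y" using r1 r2 le_trans by blast
  qed
next
  assume *: "p \<tturnstile> z \<^bold>= opair_name P x y"
  have "q \<tturnstile> fUpair (upair_name P x x) x x \<and> q \<tturnstile> fUpair (upair_name P x y) x y \<and>
      q \<tturnstile> fUpair z (upair_name P x x) (upair_name P x y)" if "q \<preceq> p" for q
    using eq_mono[OF * that] by (simp add: forced_Upair is_name_upair eq_refl opair_name_def)
  then show "p \<tturnstile> fOpair z x y"
    unfolding fOpair_def forced_Ex forced_And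
    by (meson assms is_name_upair le_refl' le_trans)
qed

lemma stable_Rel [intro]: "stable (fRel R x y)" for x y R :: "('p, 'i) name"
  unfolding fRel_def by blast

text \<open>From here on relations and functions are handled through the canonical name of a pair.
  This replaces the quantifier over all sets that code the pair.\<close>

lemma forced_Rel:
  fixes x y R :: "('p, 'i) name"
  assumes [simp]: "is_name P x" "is_name P y"
  shows "p \<tturnstile> fRel R x y \<longleftrightarrow> p \<tturnstile> opair_name P x y \<^bold>\<in> R"
proof
  assume *: "p \<tturnstile> fRel R x y"
  show "p \<tturnstile> opair_name P x y \<^bold>\<in> R"
  proof (rule stable_dense[OF stable_mem])
    fix q assume q: "q \<preceq> p"
    then obtain r z where "r \<preceq> q" "is_name P z" "r \<tturnstile> fOpair z x y" "r \<tturnstile> z \<^bold>\<in> R"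
      using * unfolding fRel_def forced_Ex forced_And by blast
    then show "\<exists>r. r \<preceq> q \<and> r \<tturnstile> opair_name P x y \<^bold>\<in> R"
      by (auto simp: forced_Opair intro: mem_cong_left)
  qed
next
  assume *: "p \<tturnstile> opair_name P x y \<^bold>\<in> R"
  have "q \<tturnstile> fOpair (opair_name P x y) x y" for q
    by (simp add: forced_Opair is_name_opair eq_refl)
  then show "p \<tturnstile> fRel R x y"
    unfolding fRel_def forced_Ex forced_And
    by (meson * assms is_name_opair le_refl' mem_mono)
qed

lemma Rel_cong:
  fixes x y x' y' R :: "('p, 'i) name"
  assumes "p \<tturnstile> x \<^bold>= x'" "p \<tturnstile> y \<^bold>= y'" "p \<tturnstile> fRel R x y"
    and "is_name P x" "is_name P y" "is_name P x'" "is_name P y'"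
  shows "p \<tturnstile> fRel R x' y'"
  using assms by (simp add: forced_Rel) (meson mem_cong_left opair_cong)

end

section \<open>Cardinality bounds and names of functions\<close>

text \<open>Treats \<open>omega1\<close> and \<open>nat\<close> together. Countable segments ensure
  that the canonical name of each element has only countably many entries, well within the bound
  \<open>'i\<close>.\<close>

class countable_segments = wellorder +
  assumes countable_segment: "countable {..<a}"

instance omega1 :: countable_segments
  by standard (rule countable_initial_segment_omega1)

instance nat :: countable_segments
  by standard simp

lemma omega1_lepoll_uncountable:
  assumes "uncountable A"
  shows "(UNIV :: omega1 set) \<lesssim> A"
proof -
  have "(natLeq, card_of A) \<in> ordLess"
    using assms by (simp add: countable_card_le_natLeq not_ordLeq_iff_ordLess[symmetric]
        natLeq_Well_order card_of_Well_order)
  then have "(cardSuc natLeq, card_of A) \<in> ordLeq"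
    by (simp add: cardSuc_least natLeq_Card_order card_of_Card_order)
  then have "(card_of (Field (cardSuc natLeq)), card_of A) \<in> ordLeq"
    using card_of_Field_ordIso[OF omega1_card_order] ordIso_ordLeq_trans by blast
  then obtain f where f: "inj_on f (Field (cardSuc natLeq))" "f ` Field (cardSuc natLeq) \<subseteq> A"
    unfolding card_of_ordLeq[symmetric] by blast
  have "inj (\<lambda>x. f (Rep_omega1 x))"
    by (metis (mono_tags) Rep_omega1 Rep_omega1_inject f(1) inj_onD injI)
  moreover have "range (\<lambda>x. f (Rep_omega1 x)) \<subseteq> A"
    using f(2) Rep_omega1 by blast
  ultimately show ?thesis unfolding lepoll_def by blast
qed

lemma uncountable_omega1_embedding:
  assumes "uncountable A"
  obtains e :: "omega1 \<Rightarrow> 'a" where "inj e" "\<And>\<xi>. e \<xi> \<in> A"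
  using omega1_lepoll_uncountable[OF assms] that unfolding lepoll_def by blast

lemma omega1_lepoll: "(UNIV :: omega1 set) \<lesssim> (UNIV :: nat set set)"
proof (rule omega1_lepoll_uncountable)
  have "\<not> (\<exists>f :: nat \<Rightarrow> nat set. range f = UNIV)"
    using Cantors_theorem[of "UNIV :: nat set"] by simp
  then show "uncountable (UNIV :: nat set set)"
    by (metis UNIV_not_empty range_from_nat_into)
qed

text \<open>A pair is coded by its minimum and maximum, and the square of an infinite cardinal is
  that cardinal. Thus the canonical name of a coloring has few enough entries to exist.\<close>

lemma omega1_pairs_lepoll: "([UNIV :: omega1 set]\<^bsup>2\<^esup>) \<lesssim> (UNIV :: omega1 set)"
proof -
  have "infinite (UNIV :: omega1 set)"
    using uncountable_omega1 countable_finite by blast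
  then have "(card_of ((UNIV :: omega1 set) \<times> (UNIV :: omega1 set)), card_of (UNIV :: omega1 set)) \<in> ordLeq"
    using card_of_Times_same_infinite ordIso_iff_ordLeq by blast
  then obtain f :: "omega1 \<times> omega1 \<Rightarrow> omega1" where f: "inj f"
    unfolding card_of_ordLeq[symmetric] by auto
  have "inj_on (\<lambda>s. f (Min s, Max s)) ([UNIV]\<^bsup>2\<^esup>)"
  proof (rule inj_onI)
    fix s t :: "omega1 set" assume "s \<in> [UNIV]\<^bsup>2\<^esup>" "t \<in> [UNIV]\<^bsup>2\<^esup>" "f (Min s, Max s) = f (Min t, Max t)"
    moreover have "s = {Min s, Max s}" if s: "s \<in> [UNIV]\<^bsup>2\<^esup>" for s :: "omega1 set"
    proof -
      obtain x y where xy: "s = {x, y}" "x \<noteq> y"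
        using s unfolding nsets_2_eq by blast
      then have "x < y \<or> y < x" by auto
      then obtain x y where "s = {x, y}" "x < y" using xy(1) by (metis insert_commute)
      then show ?thesis by (simp add: min_def max_def insert_commute)
    qed
    ultimately show "s = t" using f by (metis injD Pair_inject)
  qed
  then show ?thesis unfolding lepoll_def by blast
qed

context forcing
begin

section \<open>Stability of the formulas of set theory\<close>

lemmas stable_simps [simp] = stable_mem stable_eq stable_Not stable_And stable_All stable_Or stable_Imp
  stable_Iff stable_Ex stable_Upair stable_Opair stable_Rel

lemma stable_Subset [simp]: "stable (x \<^bold>\<subseteq> y)" for x y :: "('p, 'i) name"
  unfolding fSubset_def by simp

lemma stable_Fun [simp]: "stable (fFun f A B)" for f A B :: "('p, 'i) name"
  unfolding fFun_def by simp

lemma stable_Inj [simp]: "stable (fInj f)" for f :: "('p, 'i) name"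
  unfolding fInj_def by simp

lemma stable_Empty [simp]: "stable (fEmpty f)" for f :: "('p, 'i) name"
  unfolding fEmpty_def by simp

lemma stable_Succ [simp]: "stable (fSucc m k)" for m k :: "('p, 'i) name"
  unfolding fSucc_def by simp

lemma stable_Transitive [simp]: "stable (fTransitive m)" for m :: "('p, 'i) name"
  unfolding fTransitive_def by simp

lemma stable_Nat [simp]: "stable (fNat m)" for m :: "('p, 'i) name"
  unfolding fNat_def by simp

lemma stable_Countable [simp]: "stable (fCountable m)" for m :: "('p, 'i) name"
  unfolding fCountable_def by simp

lemma forced_Ex2:
  fixes F :: "('p, 'i) name \<Rightarrow> ('p, 'i) name \<Rightarrow> 'p fml"
  assumes "\<And>x y. stable (F x y)"
  shows "p \<tturnstile> (\<^bold>\<exists>x y. F x y) \<longleftrightarrow>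
    (\<forall>q. q \<preceq> p \<longrightarrow> (\<exists>r. r \<preceq> q \<and> (\<exists>x y. is_name P x \<and> is_name P y \<and> r \<tturnstile> F x y)))"
    (is "?L \<longleftrightarrow> ?R")
proof
  assume L: ?L
  show ?R
  proof (intro allI impI)
    fix q assume q: "q \<preceq> p"
    then obtain r x where r: "r \<preceq> q" "is_name P x" "r \<tturnstile> (\<^bold>\<exists>y. F x y)"
      using L unfolding forced_Ex[of "\<lambda>x. \<^bold>\<exists>y. F x y"] by blast
    then obtain s y where "s \<preceq> r" "is_name P y" "s \<tturnstile> F x y"
      using le_refl'[OF r(1)] unfolding forced_Ex by blast
    then show "\<exists>r. r \<preceq> q \<and> (\<exists>x y. is_name P x \<and> is_name P y \<and> r \<tturnstile> F x y)"
      using r le_trans by blast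
  qed
next
  assume R: ?R
  have "r \<tturnstile> (\<^bold>\<exists>y. F x y)" if "is_name P y" "r \<tturnstile> F x y" for r x y
    unfolding forced_Ex using that stable_mono[OF assms] le_refl' by blast
  then show ?L
    unfolding forced_Ex[of "\<lambda>x. \<^bold>\<exists>y. F x y"] using R by blast
qed

section \<open>Functions and injections in the forcing language\<close>

lemma FunI:
  fixes f A B :: "('p, 'i) name"
  assumes "\<And>q z. q \<preceq> p \<Longrightarrow> is_name P z \<Longrightarrow> q \<tturnstile> z \<^bold>\<in> f \<Longrightarrow>
      \<exists>r. r \<preceq> q \<and> (\<exists>x y. is_name P x \<and> is_name P y \<and> r \<tturnstile> x \<^bold>\<in> A \<and> r \<tturnstile> y \<^bold>\<in> B \<and> r \<tturnstile> z \<^bold>= opair_name P x y)"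
    and "\<And>q x. q \<preceq> p \<Longrightarrow> is_name P x \<Longrightarrow> q \<tturnstile> x \<^bold>\<in> A \<Longrightarrow>
      \<exists>r. r \<preceq> q \<and> (\<exists>y. is_name P y \<and> r \<tturnstile> opair_name P x y \<^bold>\<in> f)"
    and "\<And>q x y y'. q \<preceq> p \<Longrightarrow> is_name P x \<Longrightarrow> is_name P y \<Longrightarrow> is_name P y' \<Longrightarrow>
      q \<tturnstile> opair_name P x y \<^bold>\<in> f \<Longrightarrow> q \<tturnstile> opair_name P x y' \<^bold>\<in> f \<Longrightarrow> q \<tturnstile> y \<^bold>= y'"
  shows "p \<tturnstile> fFun f A B"
  unfolding fFun_def forced_And
proof (intro conjI)
  have "q \<tturnstile> (\<^bold>\<exists>x y. x \<^bold>\<in> A \<^bold>\<and> y \<^bold>\<in> B \<^bold>\<and> fOpair z x y)"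
    if "q \<preceq> p" "is_name P z" "q \<tturnstile> z \<^bold>\<in> f" for q z
  proof -
    have "\<exists>r. r \<preceq> q' \<and> (\<exists>x y. is_name P x \<and> is_name P y \<and> r \<tturnstile> x \<^bold>\<in> A \<and> r \<tturnstile> y \<^bold>\<in> B \<and> r \<tturnstile> fOpair z x y)"
      if "q' \<preceq> q" for q'
      using assms(1)[OF le_trans[OF that \<open>q \<preceq> p\<close>] \<open>is_name P z\<close> mem_mono[OF \<open>q \<tturnstile> z \<^bold>\<in> f\<close> that]]
        \<open>is_name P z\<close> by (metis forced_Opair)
    then show ?thesis by (simp add: forced_Ex2 forced_And)
  qed
  then show "p \<tturnstile> (\<^bold>\<forall>z. z \<^bold>\<in> f \<^bold>\<longrightarrow> (\<^bold>\<exists>x y. x \<^bold>\<in> A \<^bold>\<and> y \<^bold>\<in> B \<^bold>\<and> fOpair z x y))"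
    by (simp add: forced_All forced_Imp)
  have "q \<tturnstile> (\<^bold>\<exists>y. fRel f x y)" if "q \<preceq> p" "is_name P x" "q \<tturnstile> x \<^bold>\<in> A" for q x
  proof -
    have "\<exists>r. r \<preceq> q' \<and> (\<exists>y. is_name P y \<and> r \<tturnstile> fRel f x y)" if "q' \<preceq> q" for q'
      using assms(2)[OF le_trans[OF that \<open>q \<preceq> p\<close>] \<open>is_name P x\<close> mem_mono[OF \<open>q \<tturnstile> x \<^bold>\<in> A\<close> that]]
        \<open>is_name P x\<close> by (metis forced_Rel)
    then show ?thesis by (simp add: forced_Ex)
  qed
  then show "p \<tturnstile> (\<^bold>\<forall>x. x \<^bold>\<in> A \<^bold>\<longrightarrow> (\<^bold>\<exists>y. fRel f x y))"
    by (simp add: forced_All forced_Imp)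
  show "p \<tturnstile> (\<^bold>\<forall>x y y'. fRel f x y \<^bold>\<and> fRel f x y' \<^bold>\<longrightarrow> y \<^bold>= y')"
    using assms(3) by (simp add: forced_All forced_Imp forced_And forced_Rel)
qed

lemma Fun_elem:
  fixes f A B :: "('p, 'i) name"
  assumes "p \<tturnstile> fFun f A B" "is_name P z" "q \<preceq> p" "q \<tturnstile> z \<^bold>\<in> f"
  shows "\<exists>r. r \<preceq> q \<and> (\<exists>x y. is_name P x \<and> is_name P y \<and> r \<tturnstile> x \<^bold>\<in> A \<and> r \<tturnstile> y \<^bold>\<in> B \<and> r \<tturnstile> z \<^bold>= opair_name P x y)"
proof -
  have "p \<tturnstile> (\<^bold>\<forall>z. z \<^bold>\<in> f \<^bold>\<longrightarrow> (\<^bold>\<exists>x y. x \<^bold>\<in> A \<^bold>\<and> y \<^bold>\<in> B \<^bold>\<and> fOpair z x y))"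
    using assms(1) unfolding fFun_def forced_And by blast
  then have "q \<tturnstile> (\<^bold>\<exists>x y. x \<^bold>\<in> A \<^bold>\<and> y \<^bold>\<in> B \<^bold>\<and> fOpair z x y)"
    using assms(2-) by (simp add: forced_All forced_Imp)
  then obtain r x y where "r \<preceq> q" "is_name P x" "is_name P y" "r \<tturnstile> x \<^bold>\<in> A" "r \<tturnstile> y \<^bold>\<in> B" "r \<tturnstile> fOpair z x y"
    using le_refl'[OF assms(3)] by (auto simp: forced_Ex2 forced_And)
  then show ?thesis using assms(2) by (auto simp: forced_Opair)
qed

lemma Fun_total:
  fixes f A B :: "('p, 'i) name"
  assumes "p \<tturnstile> fFun f A B" "is_name P x" "q \<preceq> p" "q \<tturnstile> x \<^bold>\<in> A"
  shows "\<exists>r. r \<preceq> q \<and> (\<exists>y. is_name P y \<and> r \<tturnstile> opair_name P x y \<^bold>\<in> f)"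
proof -
  have "p \<tturnstile> (\<^bold>\<forall>x. x \<^bold>\<in> A \<^bold>\<longrightarrow> (\<^bold>\<exists>y. fRel f x y))"
    using assms(1) unfolding fFun_def forced_And by blast
  then have "q \<tturnstile> (\<^bold>\<exists>y. fRel f x y)"
    using assms(2-) by (simp add: forced_All forced_Imp)
  then obtain r y where "r \<preceq> q" "is_name P y" "r \<tturnstile> fRel f x y"
    using le_refl'[OF assms(3)] by (auto simp: forced_Ex)
  then show ?thesis using assms(2) by (auto simp: forced_Rel)
qed

lemma Fun_unique:
  fixes f A B :: "('p, 'i) name"
  assumes "p \<tturnstile> fFun f A B" "is_name P x" "is_name P y" "is_name P y'" "q \<preceq> p"
    "q \<tturnstile> opair_name P x y \<^bold>\<in> f" "q \<tturnstile> opair_name P x y' \<^bold>\<in> f"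
  shows "q \<tturnstile> y \<^bold>= y'"
proof -
  have "p \<tturnstile> (\<^bold>\<forall>x y y'. fRel f x y \<^bold>\<and> fRel f x y' \<^bold>\<longrightarrow> y \<^bold>= y')"
    using assms(1) unfolding fFun_def forced_And by blast
  then show ?thesis
    using assms(2-) by (simp add: forced_All forced_Imp forced_And forced_Rel)
qed

lemma Fun_cong:
  fixes f f' A B :: "('p, 'i) name"
  assumes "p \<tturnstile> f \<^bold>= f'" "p \<tturnstile> fFun f A B"
  shows "p \<tturnstile> fFun f' A B"
proof -
  have m: "q \<tturnstile> z \<^bold>\<in> f \<longleftrightarrow> q \<tturnstile> z \<^bold>\<in> f'" if "q \<preceq> p" for q z
    using eq_mono[OF assms(1) that] eq_sym mem_cong_right by blast
  show ?thesis
  proof (rule FunI)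
    fix q z assume "q \<preceq> p" "is_name P z" "q \<tturnstile> z \<^bold>\<in> f'"
    then show "\<exists>r. r \<preceq> q \<and> (\<exists>x y. is_name P x \<and> is_name P y \<and> r \<tturnstile> x \<^bold>\<in> A \<and> r \<tturnstile> y \<^bold>\<in> B \<and> r \<tturnstile> z \<^bold>= opair_name P x y)"
      using m Fun_elem[OF assms(2)] by blast
  next
    fix q x assume "q \<preceq> p" "is_name P x" "q \<tturnstile> x \<^bold>\<in> A"
    then show "\<exists>r. r \<preceq> q \<and> (\<exists>y. is_name P y \<and> r \<tturnstile> opair_name P x y \<^bold>\<in> f')"
      using m Fun_total[OF assms(2)] le_trans by meson
  next
    fix q x y y' assume q: "q \<preceq> p" and n: "is_name P x" "is_name P y" "is_name P y'"
      and "q \<tturnstile> opair_name P x y \<^bold>\<in> f'" "q \<tturnstile> opair_name P x y' \<^bold>\<in> f'"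
    then have "q \<tturnstile> opair_name P x y \<^bold>\<in> f" "q \<tturnstile> opair_name P x y' \<^bold>\<in> f"
      by (simp_all add: m)
    then show "q \<tturnstile> y \<^bold>= y'" by (rule Fun_unique[OF assms(2) n q])
  qed
qed

lemma InjI:
  fixes f :: "('p, 'i) name"
  assumes "\<And>q x x' y. q \<preceq> p \<Longrightarrow> is_name P x \<Longrightarrow> is_name P x' \<Longrightarrow> is_name P y \<Longrightarrow>
      q \<tturnstile> opair_name P x y \<^bold>\<in> f \<Longrightarrow> q \<tturnstile> opair_name P x' y \<^bold>\<in> f \<Longrightarrow> q \<tturnstile> x \<^bold>= x'"
  shows "p \<tturnstile> fInj f"
  unfolding fInj_def using assms by (simp add: forced_All forced_Imp forced_And forced_Rel)

lemma InjD:
  fixes f :: "('p, 'i) name"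
  assumes "p \<tturnstile> fInj f" "is_name P x" "is_name P x'" "is_name P y" "q \<preceq> p"
    "q \<tturnstile> opair_name P x y \<^bold>\<in> f" "q \<tturnstile> opair_name P x' y \<^bold>\<in> f"
  shows "q \<tturnstile> x \<^bold>= x'"
  using assms unfolding fInj_def by (simp add: forced_All forced_Imp forced_And forced_Rel)

text \<open>The pair \<open>(a j, b j)\<close> is attached only to the conditions in
  \<open>C j\<close>, so the generic filter selects which part of the indexed graph is
  realized.\<close>

definition fun_name :: "'j set \<Rightarrow> ('j \<Rightarrow> ('p, 'i) name) \<Rightarrow> ('j \<Rightarrow> ('p, 'i) name) \<Rightarrow> ('j \<Rightarrow> 'p set) \<Rightarrow> ('p, 'i) name"
  where "fun_name J a b C = mk_name (\<Union>j\<in>J. {opair_name P (a j) (b j)} \<times> C j)"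

context
  fixes J :: "'j set" and a b :: "'j \<Rightarrow> ('p, 'i) name" and C :: "'j \<Rightarrow> 'p set"
  assumes J: "J \<lesssim> (UNIV :: 'i set)"
    and ab: "\<And>j. j \<in> J \<Longrightarrow> is_name P (a j)" "\<And>j. j \<in> J \<Longrightarrow> is_name P (b j)"
    and C: "\<And>j. j \<in> J \<Longrightarrow> C j \<subseteq> Field P"
begin

lemma is_name_fun_name: "is_name P (fun_name J a b C)"
  unfolding fun_name_def by (rule is_name_mk[OF J is_name_opair[OF ab] C])

lemma mem_fun_name:
  assumes "is_name P x" "is_name P y"
  shows "p \<tturnstile> opair_name P x y \<^bold>\<in> fun_name J a b C \<longleftrightarrow>
    (\<forall>q. q \<preceq> p \<longrightarrow> (\<exists>r. r \<preceq> q \<and> (\<exists>j\<in>J. \<exists>s\<in>C j. r \<preceq> s \<and> r \<tturnstile> x \<^bold>= a j \<and> r \<tturnstile> y \<^bold>= b j)))"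
proof -
  have "r \<tturnstile> opair_name P x y \<^bold>= opair_name P (a j) (b j) \<longleftrightarrow> r \<tturnstile> x \<^bold>= a j \<and> r \<tturnstile> y \<^bold>= b j"
    if "j \<in> J" for r j
    using opair_inject opair_cong that assms ab by blast
  then show ?thesis
    unfolding fun_name_def mem_mk[OF J] by (simp cong: bex_cong)
qed

lemma Fun_fun_name:
  assumes dom: "\<And>j s q. j \<in> J \<Longrightarrow> s \<in> C j \<Longrightarrow> q \<preceq> s \<Longrightarrow> q \<preceq> p \<Longrightarrow> q \<tturnstile> a j \<^bold>\<in> A \<and> q \<tturnstile> b j \<^bold>\<in> B"
    and func: "\<And>j k s t q. j \<in> J \<Longrightarrow> k \<in> J \<Longrightarrow> s \<in> C j \<Longrightarrow> t \<in> C k \<Longrightarrow> q \<preceq> p \<Longrightarrow> q \<preceq> s \<Longrightarrow> q \<preceq> t \<Longrightarrow>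
      q \<tturnstile> a j \<^bold>= a k \<Longrightarrow> q \<tturnstile> b j \<^bold>= b k"
    and tot: "\<And>q x. q \<preceq> p \<Longrightarrow> is_name P x \<Longrightarrow> q \<tturnstile> x \<^bold>\<in> A \<Longrightarrow>
      \<exists>r. r \<preceq> q \<and> (\<exists>j\<in>J. \<exists>s\<in>C j. r \<preceq> s \<and> r \<tturnstile> x \<^bold>= a j)"
  shows "p \<tturnstile> fFun (fun_name J a b C) A B"
proof (rule FunI)
  fix q z assume q: "q \<preceq> p" "q \<tturnstile> z \<^bold>\<in> fun_name J a b C"
  then obtain r j s where "r \<preceq> q" "j \<in> J" "s \<in> C j" "r \<preceq> s" "r \<tturnstile> z \<^bold>= opair_name P (a j) (b j)"
    using le_refl'[OF q(1)] unfolding fun_name_def mem_mk[OF J] by blast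
  then show "\<exists>r. r \<preceq> q \<and> (\<exists>x y. is_name P x \<and> is_name P y \<and> r \<tturnstile> x \<^bold>\<in> A \<and> r \<tturnstile> y \<^bold>\<in> B \<and> r \<tturnstile> z \<^bold>= opair_name P x y)"
    using dom ab q le_trans by meson
next
  fix q x assume q: "q \<preceq> p" "is_name P x" "q \<tturnstile> x \<^bold>\<in> A"
  then obtain r j s where r: "r \<preceq> q" "j \<in> J" "s \<in> C j" "r \<preceq> s" "r \<tturnstile> x \<^bold>= a j"
    using tot by blast
  then have "r \<tturnstile> opair_name P x (b j) \<^bold>\<in> fun_name J a b C"
    unfolding mem_fun_name[OF q(2) ab(2)[OF r(2)]] using eq_refl le_refl' le_trans eq_mono by meson
  then show "\<exists>r. r \<preceq> q \<and> (\<exists>y. is_name P y \<and> r \<tturnstile> opair_name P x y \<^bold>\<in> fun_name J a b C)"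
    using r ab by blast
next
  fix q x y y' assume q: "q \<preceq> p" and n: "is_name P x" "is_name P y" "is_name P y'"
    and m: "q \<tturnstile> opair_name P x y \<^bold>\<in> fun_name J a b C" "q \<tturnstile> opair_name P x y' \<^bold>\<in> fun_name J a b C"
  show "q \<tturnstile> y \<^bold>= y'"
  proof (rule stable_dense[OF stable_eq])
    fix q' assume "q' \<preceq> q"
    then obtain r j s where r: "r \<preceq> q'" "j \<in> J" "s \<in> C j" "r \<preceq> s" "r \<tturnstile> x \<^bold>= a j" "r \<tturnstile> y \<^bold>= b j"
      using m(1) unfolding mem_fun_name[OF n(1,2)] by blast
    have "r \<preceq> q" using r \<open>q' \<preceq> q\<close> le_trans by blast
    then obtain r' k t where r': "r' \<preceq> r" "k \<in> J" "t \<in> C k" "r' \<preceq> t" "r' \<tturnstile> x \<^bold>= a k" "r' \<tturnstile> y' \<^bold>= b k"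
      using m(2) unfolding mem_fun_name[OF n(1,3)] by blast
    have "r' \<tturnstile> a j \<^bold>= a k" using r r' by (meson eq_mono eq_sym eq_trans)
    moreover have "r' \<preceq> s" "r' \<preceq> p" using r r' \<open>r \<preceq> q\<close> q le_trans by meson+
    ultimately have "r' \<tturnstile> b j \<^bold>= b k" using func r r' by blast
    then have "r' \<tturnstile> y \<^bold>= y'" using r r' by (meson eq_mono eq_sym eq_trans)
    then show "\<exists>r. r \<preceq> q' \<and> r \<tturnstile> y \<^bold>= y'" using r r' le_trans by blast
  qed
qed

lemma Inj_fun_name:
  assumes inj: "\<And>j k s t q. j \<in> J \<Longrightarrow> k \<in> J \<Longrightarrow> s \<in> C j \<Longrightarrow> t \<in> C k \<Longrightarrow> q \<preceq> p \<Longrightarrow> q \<preceq> s \<Longrightarrow> q \<preceq> t \<Longrightarrow>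
      q \<tturnstile> b j \<^bold>= b k \<Longrightarrow> q \<tturnstile> a j \<^bold>= a k"
  shows "p \<tturnstile> fInj (fun_name J a b C)"
proof (rule InjI)
  fix q x x' y assume q: "q \<preceq> p" and n: "is_name P x" "is_name P x'" "is_name P y"
    and m: "q \<tturnstile> opair_name P x y \<^bold>\<in> fun_name J a b C" "q \<tturnstile> opair_name P x' y \<^bold>\<in> fun_name J a b C"
  show "q \<tturnstile> x \<^bold>= x'"
  proof (rule stable_dense[OF stable_eq])
    fix q' assume "q' \<preceq> q"
    then obtain r j s where r: "r \<preceq> q'" "j \<in> J" "s \<in> C j" "r \<preceq> s" "r \<tturnstile> x \<^bold>= a j" "r \<tturnstile> y \<^bold>= b j"
      using m(1) unfolding mem_fun_name[OF n(1,3)] by blast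
    have "r \<preceq> q" using r \<open>q' \<preceq> q\<close> le_trans by blast
    then obtain r' k t where r': "r' \<preceq> r" "k \<in> J" "t \<in> C k" "r' \<preceq> t" "r' \<tturnstile> x' \<^bold>= a k" "r' \<tturnstile> y \<^bold>= b k"
      using m(2) unfolding mem_fun_name[OF n(2,3)] by blast
    have "r' \<tturnstile> b j \<^bold>= b k" using r r' by (meson eq_mono eq_sym eq_trans)
    moreover have "r' \<preceq> s" "r' \<preceq> p" using r r' \<open>r \<preceq> q\<close> q le_trans by meson+
    ultimately have "r' \<tturnstile> a j \<^bold>= a k" using inj r r' by blast
    then have "r' \<tturnstile> x \<^bold>= x'" using r r' by (meson eq_mono eq_sym eq_trans)
    then show "\<exists>r. r \<preceq> q' \<and> r \<tturnstile> x \<^bold>= x'" using r r' le_trans by blast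
  qed
qed

end

section \<open>Names of ordinals\<close>

lemma mem_right_iff: "p \<tturnstile> x \<^bold>= y \<Longrightarrow> p \<tturnstile> z \<^bold>\<in> x \<longleftrightarrow> p \<tturnstile> z \<^bold>\<in> y" for x y z :: "('p, 'i) name"
  using mem_cong_right eq_sym by metis

lemma mem_left_iff: "p \<tturnstile> x \<^bold>= y \<Longrightarrow> p \<tturnstile> x \<^bold>\<in> z \<longleftrightarrow> p \<tturnstile> y \<^bold>\<in> z" for x y z :: "('p, 'i) name"
  using mem_cong_left eq_sym by metis

lemma eq_right_iff: "p \<tturnstile> x \<^bold>= y \<Longrightarrow> p \<tturnstile> z \<^bold>= x \<longleftrightarrow> p \<tturnstile> z \<^bold>= y" for x y z :: "('p, 'i) name"
  using eq_trans eq_sym by metis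

lemma omega1_lepoll_names: "(S :: omega1 set) \<lesssim> (UNIV :: 'i set)"
  by (meson omega1_lepoll large lepoll_trans subset_imp_lepoll subset_UNIV)

abbreviation ord :: "'w::countable_segments \<Rightarrow> ('p, 'i) name" where
  "ord \<equiv> ord_name P"

lemma is_name_ord [simp]: "is_name P (ord \<alpha>)"
proof (induction \<alpha> rule: less_induct)
  case (less \<alpha>)
  then show ?case
    by (subst ord_name.simps)
      (auto intro!: is_name_mk countable_lepoll_names countable_segment)
qed

lemma mem_ord: "p \<tturnstile> x \<^bold>\<in> ord \<alpha> \<longleftrightarrow> (\<forall>q. q \<preceq> p \<longrightarrow> (\<exists>r. r \<preceq> q \<and> (\<exists>\<beta><\<alpha>. r \<tturnstile> x \<^bold>= ord \<beta>)))"
  by (subst ord_name.simps, subst mem_mk_Field)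
    (auto intro!: countable_lepoll_names countable_segment simp: Bex_def)

lemma ord_memI: "\<beta> < \<alpha> \<Longrightarrow> p \<tturnstile> ord \<beta> \<^bold>\<in> ord \<alpha>"
  unfolding mem_ord using eq_refl le_refl' by blast

lemma mem_ordD:
  assumes "p \<in> Field P" "p \<tturnstile> x \<^bold>\<in> ord \<alpha>"
  obtains r \<beta> where "r \<preceq> p" "\<beta> < \<alpha>" "r \<tturnstile> x \<^bold>= ord \<beta>"
  using assms le_refl unfolding mem_ord by blast

text \<open>For \<alpha> < \<beta> a forced equality would make \<alpha> an element of itself, hence
  equal to some smaller \<gamma> at an extension, which the induction hypothesis for \<gamma>
  excludes. For \<beta> < \<alpha> the induction hypothesis for \<beta> applies directly. Membership
  of \<open>p\<close> in the field matters, since every equality is forced outside it.\<close>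

lemma ord_inject: "p \<in> Field P \<Longrightarrow> p \<tturnstile> ord \<alpha> \<^bold>= ord \<beta> \<Longrightarrow> \<alpha> = \<beta>"
proof (induction \<alpha> arbitrary: \<beta> p rule: less_induct)
  case (less \<alpha>)
  show ?case
  proof (cases \<alpha> \<beta> rule: linorder_cases)
    case lt: less
    then have "p \<tturnstile> ord \<alpha> \<^bold>\<in> ord \<alpha>"
      using mem_right_iff[OF less.prems(2)] ord_memI by simp
    then obtain r \<gamma> where r: "r \<preceq> p" "\<gamma> < \<alpha>" "r \<tturnstile> ord \<alpha> \<^bold>= ord \<gamma>"
      by (rule mem_ordD[OF less.prems(1)])
    then have "\<gamma> = \<alpha>" using less.IH[of \<gamma> r \<alpha>] eq_sym[OF r(3)] le_Field(1)[OF r(1)] by blast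
    then show ?thesis using r by simp
  next
    case greater
    then show ?thesis using less.IH[of \<beta> p \<alpha>] less.prems(1) eq_sym[OF less.prems(2)] by blast
  qed
qed

lemma is_name_ord_set:
  "S \<lesssim> (UNIV :: 'i set) \<Longrightarrow> is_name P (ord_set_name P S :: ('p, 'i) name)"
  for S :: "'w::countable_segments set"
  unfolding ord_set_name_def by (auto intro!: is_name_mk)

lemma mem_ord_set:
  fixes S :: "'w::countable_segments set" and x :: "('p, 'i) name"
  assumes "S \<lesssim> (UNIV :: 'i set)"
  shows "p \<tturnstile> x \<^bold>\<in> ord_set_name P S \<longleftrightarrow>
    (\<forall>q. q \<preceq> p \<longrightarrow> (\<exists>r. r \<preceq> q \<and> (\<exists>\<beta>\<in>S. r \<tturnstile> x \<^bold>= ord \<beta>)))"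
  unfolding ord_set_name_def by (rule mem_mk_Field[OF assms])

lemma mem_coloring:
  fixes x :: "('p, 'i) name"
  shows "p \<tturnstile> x \<^bold>\<in> coloring_name P \<pi> \<longleftrightarrow> (\<forall>q. q \<preceq> p \<longrightarrow> (\<exists>r. r \<preceq> q \<and>
    (\<exists>s\<in>[UNIV]\<^bsup>2\<^esup>. r \<tturnstile> x \<^bold>= opair_name P (ord_set_name P s) (ord (\<pi> s)))))"
  unfolding coloring_name_def
  by (rule mem_mk_Field) (meson omega1_pairs_lepoll omega1_lepoll large lepoll_trans)

section \<open>Natural numbers in the forcing language\<close>

lemma forced_Subset:
  "p \<tturnstile> x \<^bold>\<subseteq> y \<longleftrightarrow> (\<forall>z. is_name P z \<longrightarrow> (\<forall>q. q \<preceq> p \<longrightarrow> q \<tturnstile> z \<^bold>\<in> x \<longrightarrow> q \<tturnstile> z \<^bold>\<in> y))"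
  for x y :: "('p, 'i) name"
  unfolding fSubset_def by (simp add: forced_All forced_Imp)

lemma forced_Transitive:
  "p \<tturnstile> fTransitive n \<longleftrightarrow> (\<forall>x y q. is_name P x \<longrightarrow> is_name P y \<longrightarrow> q \<preceq> p \<longrightarrow>
     q \<tturnstile> x \<^bold>\<in> n \<longrightarrow> q \<tturnstile> y \<^bold>\<in> x \<longrightarrow> q \<tturnstile> y \<^bold>\<in> n)" (is "?L \<longleftrightarrow> ?R")
  for n :: "('p, 'i) name"
proof -
  have "?L \<longleftrightarrow> (\<forall>x. is_name P x \<longrightarrow> (\<forall>q. q \<preceq> p \<longrightarrow> q \<tturnstile> x \<^bold>\<in> n \<longrightarrow>
      (\<forall>y. is_name P y \<longrightarrow> (\<forall>r. r \<preceq> q \<longrightarrow> r \<tturnstile> y \<^bold>\<in> x \<longrightarrow> r \<tturnstile> y \<^bold>\<in> n))))"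
    unfolding fTransitive_def by (simp add: forced_All forced_Imp forced_Subset)
  also have "\<dots> \<longleftrightarrow> ?R"
  proof
    assume "\<forall>x. is_name P x \<longrightarrow> (\<forall>q. q \<preceq> p \<longrightarrow> q \<tturnstile> x \<^bold>\<in> n \<longrightarrow>
      (\<forall>y. is_name P y \<longrightarrow> (\<forall>r. r \<preceq> q \<longrightarrow> r \<tturnstile> y \<^bold>\<in> x \<longrightarrow> r \<tturnstile> y \<^bold>\<in> n)))"
    then show ?R by (meson le_refl')
  next
    assume R: ?R
    show "\<forall>x. is_name P x \<longrightarrow> (\<forall>q. q \<preceq> p \<longrightarrow> q \<tturnstile> x \<^bold>\<in> n \<longrightarrow>
      (\<forall>y. is_name P y \<longrightarrow> (\<forall>r. r \<preceq> q \<longrightarrow> r \<tturnstile> y \<^bold>\<in> x \<longrightarrow> r \<tturnstile> y \<^bold>\<in> n)))"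
    proof (intro allI impI)
      fix x q y r assume *: "is_name P x" "q \<preceq> p" "q \<tturnstile> x \<^bold>\<in> n" "is_name P y" "r \<preceq> q" "r \<tturnstile> y \<^bold>\<in> x"
      have "r \<preceq> p" "r \<tturnstile> x \<^bold>\<in> n" using * le_trans mem_mono by blast+
      then show "r \<tturnstile> y \<^bold>\<in> n" using R * by blast
    qed
  qed
  finally show ?thesis .
qed

lemma forced_Empty: "p \<tturnstile> fEmpty n \<longleftrightarrow> (\<forall>x q. is_name P x \<longrightarrow> q \<preceq> p \<longrightarrow> \<not> q \<tturnstile> x \<^bold>\<in> n)"
  for n :: "('p, 'i) name"
  unfolding fEmpty_def by (auto simp: forced_All forced_Not)

lemma forced_Succ: "p \<tturnstile> fSucc m k \<longleftrightarrow> (\<forall>x q. is_name P x \<longrightarrow> q \<preceq> p \<longrightarrow>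
    q \<tturnstile> x \<^bold>\<in> m \<longleftrightarrow> (\<forall>r. r \<preceq> q \<longrightarrow> (\<exists>s. s \<preceq> r \<and> (s \<tturnstile> x \<^bold>\<in> k \<or> s \<tturnstile> x \<^bold>= k))))"
  for m k :: "('p, 'i) name"
  unfolding fSucc_def by (auto simp: forced_All forced_Iff forced_Or)

lemma forced_Nat:
  "p \<tturnstile> fNat n \<longleftrightarrow> p \<tturnstile> fTransitive n \<and>
     (\<forall>x q. is_name P x \<longrightarrow> q \<preceq> p \<longrightarrow> q \<tturnstile> x \<^bold>\<in> n \<longrightarrow> q \<tturnstile> fTransitive x) \<and>
     (\<forall>m q. is_name P m \<longrightarrow> q \<preceq> p \<longrightarrow> q \<tturnstile> m \<^bold>\<in> n \<or> q \<tturnstile> m \<^bold>= n \<longrightarrow>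
        (\<exists>r. r \<preceq> q \<and> (r \<tturnstile> fEmpty m \<or> (\<exists>k. is_name P k \<and> r \<tturnstile> fSucc m k))))"
  (is "?L \<longleftrightarrow> ?T \<and> ?U \<and> ?R")
  for n :: "('p, 'i) name"
proof -
  let ?\<chi> = "\<lambda>m. fEmpty m \<^bold>\<or> (\<^bold>\<exists>k. fSucc m k) :: 'p fml"
  have "?L \<longleftrightarrow> ?T \<and> ?U \<and>
     (\<forall>m q. is_name P m \<longrightarrow> q \<preceq> p \<longrightarrow> q \<tturnstile> (m \<^bold>\<in> n \<^bold>\<or> m \<^bold>= n) \<longrightarrow> q \<tturnstile> ?\<chi> m)"
    unfolding fNat_def by (simp add: forced_And forced_All forced_Imp)
  also have "(\<forall>m q. is_name P m \<longrightarrow> q \<preceq> p \<longrightarrow> q \<tturnstile> (m \<^bold>\<in> n \<^bold>\<or> m \<^bold>= n) \<longrightarrow> q \<tturnstile> ?\<chi> m) \<longleftrightarrow> ?R"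
  proof
    assume *: "\<forall>m q. is_name P m \<longrightarrow> q \<preceq> p \<longrightarrow> q \<tturnstile> (m \<^bold>\<in> n \<^bold>\<or> m \<^bold>= n) \<longrightarrow> q \<tturnstile> ?\<chi> m"
    show ?R
    proof (intro allI impI)
      fix m q assume m: "is_name P m" "q \<preceq> p" and "q \<tturnstile> m \<^bold>\<in> n \<or> q \<tturnstile> m \<^bold>= n"
      then have "q \<tturnstile> (m \<^bold>\<in> n \<^bold>\<or> m \<^bold>= n)"
        unfolding forced_Or using mem_mono eq_mono le_refl' by blast
      then have "q \<tturnstile> ?\<chi> m" using * m by blast
      then obtain r where r: "r \<preceq> q" "r \<tturnstile> fEmpty m \<or> r \<tturnstile> (\<^bold>\<exists>k. fSucc m k)"
        unfolding forced_Or using le_refl'[OF m(2)] by blast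
      then consider "r \<tturnstile> fEmpty m" | s k where "s \<preceq> r" "is_name P k" "s \<tturnstile> fSucc m k"
        unfolding forced_Ex using le_refl'[OF r(1)] by blast
      then show "\<exists>r. r \<preceq> q \<and> (r \<tturnstile> fEmpty m \<or> (\<exists>k. is_name P k \<and> r \<tturnstile> fSucc m k))"
        using r(1) le_trans by cases blast+
    qed
  next
    assume R: ?R
    show "\<forall>m q. is_name P m \<longrightarrow> q \<preceq> p \<longrightarrow> q \<tturnstile> (m \<^bold>\<in> n \<^bold>\<or> m \<^bold>= n) \<longrightarrow> q \<tturnstile> ?\<chi> m"
    proof (intro allI impI)
      fix m q assume m: "is_name P m" "q \<preceq> p" "q \<tturnstile> (m \<^bold>\<in> n \<^bold>\<or> m \<^bold>= n)"
      have "\<exists>r. r \<preceq> q' \<and> (r \<tturnstile> fEmpty m \<or> r \<tturnstile> (\<^bold>\<exists>k. fSucc m k))" if q': "q' \<preceq> q" for q'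
      proof -
        obtain r where r: "r \<preceq> q'" "r \<tturnstile> m \<^bold>\<in> n \<or> r \<tturnstile> m \<^bold>= n"
          using m(3) q' unfolding forced_Or by blast
        have "r \<preceq> p" using r q' m le_trans by blast
        then obtain s where s: "s \<preceq> r" "s \<tturnstile> fEmpty m \<or> (\<exists>k. is_name P k \<and> s \<tturnstile> fSucc m k)"
          using R m(1) r(2) by blast
        then have "s \<tturnstile> fEmpty m \<or> s \<tturnstile> (\<^bold>\<exists>k. fSucc m k)"
          unfolding forced_Ex using stable_mono[OF stable_Succ] le_refl' by blast
        then show ?thesis using s r le_trans by blast
      qed
      then show "q \<tturnstile> ?\<chi> m" unfolding forced_Or by blast
    qed
  qed
  finally show ?thesis .
qed

lemma ord_mem_trans: "p \<tturnstile> x \<^bold>\<in> ord \<alpha> \<Longrightarrow> p \<tturnstile> y \<^bold>\<in> x \<Longrightarrow> p \<tturnstile> y \<^bold>\<in> ord \<alpha>"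
proof (rule stable_dense[OF stable_mem])
  fix q assume *: "p \<tturnstile> x \<^bold>\<in> ord \<alpha>" "p \<tturnstile> y \<^bold>\<in> x" "q \<preceq> p"
  then obtain r \<beta> where r: "r \<preceq> q" "\<beta> < \<alpha>" "r \<tturnstile> x \<^bold>= ord \<beta>" unfolding mem_ord by blast
  have "r \<preceq> p" using r * le_trans by blast
  then have "r \<tturnstile> y \<^bold>\<in> ord \<beta>" using mem_mono[OF *(2)] mem_right_iff[OF r(3)] by blast
  then obtain s \<gamma> where s: "s \<preceq> r" "\<gamma> < \<beta>" "s \<tturnstile> y \<^bold>= ord \<gamma>"
    using mem_ordD le_Field r by blast
  then have "s \<tturnstile> y \<^bold>\<in> ord \<alpha>" using ord_memI[OF less_trans[OF s(2) r(2)]] mem_left_iff[OF s(3)] by simp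
  then show "\<exists>r. r \<preceq> q \<and> r \<tturnstile> y \<^bold>\<in> ord \<alpha>" using s r le_trans by blast
qed

lemma Succ_ord: "p \<tturnstile> fSucc (ord (Suc k)) (ord k)"
  unfolding forced_Succ
proof (intro allI impI)
  fix x q assume q: "q \<preceq> p"
  have "r \<tturnstile> x \<^bold>= ord j \<Longrightarrow> j < k \<Longrightarrow> r \<tturnstile> x \<^bold>\<in> ord k" for r j
    using ord_memI mem_left_iff by simp
  note aux = this
  show "q \<tturnstile> x \<^bold>\<in> ord (Suc k) \<longleftrightarrow>
      (\<forall>r. r \<preceq> q \<longrightarrow> (\<exists>s. s \<preceq> r \<and> (s \<tturnstile> x \<^bold>\<in> ord k \<or> s \<tturnstile> x \<^bold>= ord k)))" (is "?L \<longleftrightarrow> ?R")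
  proof
    assume ?L
    show ?R
    proof (intro allI impI)
      fix r assume "r \<preceq> q"
      then obtain s j where s: "s \<preceq> r" "j < Suc k" "s \<tturnstile> x \<^bold>= ord j"
        using \<open>?L\<close> unfolding mem_ord by blast
      then have "s \<tturnstile> x \<^bold>\<in> ord k \<or> s \<tturnstile> x \<^bold>= ord k"
        using aux by (cases "j < k") (auto simp: less_Suc_eq)
      then show "\<exists>s. s \<preceq> r \<and> (s \<tturnstile> x \<^bold>\<in> ord k \<or> s \<tturnstile> x \<^bold>= ord k)" using s by blast
    qed
  next
    assume ?R
    show ?L
      unfolding mem_ord
    proof (intro allI impI)
      fix r assume "r \<preceq> q"
      then obtain s where s: "s \<preceq> r" "s \<tturnstile> x \<^bold>\<in> ord k \<or> s \<tturnstile> x \<^bold>= ord k"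
        using \<open>?R\<close> by blast
      from s(2) show "\<exists>r'. r' \<preceq> r \<and> (\<exists>j<Suc k. r' \<tturnstile> x \<^bold>= ord j)"
      proof
        assume "s \<tturnstile> x \<^bold>\<in> ord k"
        then obtain t j where "t \<preceq> s" "j < k" "t \<tturnstile> x \<^bold>= ord j"
          by (rule mem_ordD[OF le_Field(1)[OF s(1)]])
        then show ?thesis using le_trans[OF _ s(1)] less_SucI by blast
      qed (use s(1) in blast)
    qed
  qed
qed

text \<open>Any \<open>m\<close> that is an element of \<open>n\<close> or equal to \<open>n\<close>
  becomes equal to the canonical name of some natural number at an extension, and that number is
  zero or a successor in the ground model.\<close>

lemma Nat_ord:
  fixes k :: nat
  assumes n: "p \<tturnstile> n \<^bold>= ord k"
  shows "p \<tturnstile> fNat n"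
proof -
  have mem: "q \<tturnstile> x \<^bold>\<in> n \<longleftrightarrow> q \<tturnstile> x \<^bold>\<in> ord k" if "q \<preceq> p" for q x
    by (rule mem_right_iff[OF eq_mono[OF n that]])
  have 1: "p \<tturnstile> fTransitive n"
    unfolding forced_Transitive using mem ord_mem_trans by blast
  have 2: "q \<tturnstile> fTransitive x" if "is_name P x" "q \<preceq> p" "q \<tturnstile> x \<^bold>\<in> n" for x q
  proof (rule stable_dense[OF stable_Transitive])
    fix q' assume q': "q' \<preceq> q"
    then have "q' \<in> Field P" "q' \<tturnstile> x \<^bold>\<in> ord k"
      using that mem mem_mono le_Field by blast+
    then obtain r and j :: nat where r: "r \<preceq> q'" "r \<tturnstile> x \<^bold>= ord j"
      by (rule mem_ordD)
    have "r' \<tturnstile> z \<^bold>\<in> x \<longleftrightarrow> r' \<tturnstile> z \<^bold>\<in> ord j" if "r' \<preceq> r" for r' z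
      by (rule mem_right_iff[OF eq_mono[OF r(2) that]])
    then have "r \<tturnstile> fTransitive x"
      unfolding forced_Transitive using ord_mem_trans by blast
    then show "\<exists>r. r \<preceq> q' \<and> r \<tturnstile> fTransitive x" using r by blast
  qed
  have 3: "\<exists>r. r \<preceq> q \<and> (r \<tturnstile> fEmpty m \<or> (\<exists>k. is_name P k \<and> r \<tturnstile> fSucc m k))"
    if m: "is_name P m" "q \<preceq> p" "q \<tturnstile> m \<^bold>\<in> n \<or> q \<tturnstile> m \<^bold>= n" for m q
  proof -
    have "\<exists>r. \<exists>j::nat. r \<preceq> q \<and> r \<tturnstile> m \<^bold>= ord j"
      using m(3)
    proof
      assume "q \<tturnstile> m \<^bold>\<in> n"
      then show ?thesis using mem m(2) mem_ordD le_Field by meson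
    next
      assume "q \<tturnstile> m \<^bold>= n"
      then show ?thesis using eq_mono[OF n m(2)] eq_trans le_refl' m(2) by blast
    qed
    then obtain r and j :: nat where r: "r \<preceq> q" "r \<tturnstile> m \<^bold>= ord j" by blast
    have mm: "q \<tturnstile> x \<^bold>\<in> m \<longleftrightarrow> q \<tturnstile> x \<^bold>\<in> ord j" if "q \<preceq> r" for q x
      by (rule mem_right_iff[OF eq_mono[OF r(2) that]])
    show ?thesis
    proof (cases j)
      case 0
      then have "r \<tturnstile> fEmpty m"
        unfolding forced_Empty using mm mem_ordD le_Field by (metis not_less_zero)
      then show ?thesis using r by blast
    next
      case (Suc i)
      then have "r \<tturnstile> fSucc m (ord i)"
        using Succ_ord[of i r] mm unfolding forced_Succ by simp
      then show ?thesis using r by (meson is_name_ord)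
    qed
  qed
  show ?thesis
    unfolding forced_Nat using 1 2 3 by blast
qed

lemma Nat_decided:
  "p \<tturnstile> fNat n \<Longrightarrow> is_name P n \<Longrightarrow> p \<in> Field P \<Longrightarrow> \<exists>r. r \<preceq> p \<and> (\<exists>k::nat. r \<tturnstile> n \<^bold>= ord k)"
  for n :: "('p, 'i) name"
proof (induction n arbitrary: p rule: wf_induct_rule[OF wf_name_child])
  case (1 n)
  note n = 1(3)
  have nat1: "p \<tturnstile> fTransitive n"
    and nat2: "\<And>x q. is_name P x \<Longrightarrow> q \<preceq> p \<Longrightarrow> q \<tturnstile> x \<^bold>\<in> n \<Longrightarrow> q \<tturnstile> fTransitive x"
    and nat3: "\<And>m q. is_name P m \<Longrightarrow> q \<preceq> p \<Longrightarrow> q \<tturnstile> m \<^bold>\<in> n \<or> q \<tturnstile> m \<^bold>= n \<Longrightarrow>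
        \<exists>r. r \<preceq> q \<and> (r \<tturnstile> fEmpty m \<or> (\<exists>k. is_name P k \<and> r \<tturnstile> fSucc m k))"
    using 1(2) unfolding forced_Nat by auto
  obtain q where q: "q \<preceq> p" "q \<tturnstile> fEmpty n \<or> (\<exists>k. is_name P k \<and> q \<tturnstile> fSucc n k)"
    using nat3[OF n le_refl[OF 1(4)] disjI2[OF eq_refl]] by blast
  from q(2) show ?case
  proof
    assume e: "q \<tturnstile> fEmpty n"
    have "q \<tturnstile> n \<^bold>= ord (0::nat)"
    proof (rule eq_ext[OF n is_name_ord])
      fix r and x :: "('p, 'i) name" assume r: "r \<preceq> q" "is_name P x"
      have "\<not> r \<tturnstile> x \<^bold>\<in> ord (0::nat)"
        using mem_ordD le_Field[OF r(1)] by (metis not_less_zero)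
      then show "r \<tturnstile> x \<^bold>\<in> n \<longleftrightarrow> r \<tturnstile> x \<^bold>\<in> ord (0::nat)"
        using e r unfolding forced_Empty by blast
    qed
    then show ?thesis using q by blast
  next
    assume "\<exists>k. is_name P k \<and> q \<tturnstile> fSucc n k"
    then obtain k where k: "is_name P k" "q \<tturnstile> fSucc n k" by blast
    have "q \<tturnstile> k \<^bold>\<in> n"
      using k(2)[unfolded forced_Succ, rule_format, OF k(1) le_refl'[OF q(1)], THEN iffD2]
      by (meson eq_refl le_refl')
    then obtain r k' s where r: "r \<preceq> q" "(k', s) \<in> elts n" "r \<preceq> s" "r \<tturnstile> k \<^bold>= k'"
      using le_refl'[OF q(1)] unfolding forced_mem by blast
    have rp: "r \<preceq> p" using r q le_trans by blast
    have k': "is_name P k'" "(k', n) \<in> name_child"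
      using n r(2) is_name_child by (auto simp: name_child_def)
    have k'n: "t \<tturnstile> k' \<^bold>\<in> n" if "t \<preceq> r" for t
      using child_mem[OF r(2)] le_trans[OF that r(3)] by blast
    have tr: "t \<tturnstile> x \<^bold>\<in> n" if "t \<preceq> r" "is_name P x" "t \<tturnstile> x \<^bold>\<in> k'" for t x
      using nat1 k'n[OF that(1)] that k'(1) le_trans[OF that(1) rp] unfolding forced_Transitive by blast
    \<comment> \<open>Since \<open>n\<close> is transitive and contains \<open>k'\<close>, elements
      of \<open>k'\<close> are elements of \<open>n\<close>. So each clause for \<open>k'\<close> is
      an instance of a clause for \<open>n\<close>.\<close>
    have "r \<tturnstile> fNat k'"
      unfolding forced_Nat
    proof (intro conjI allI impI)
      show "r \<tturnstile> fTransitive k'"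
        by (rule nat2[OF k'(1) rp k'n[OF le_refl'[OF rp]]])
    next
      fix x t assume x: "is_name P x" "t \<preceq> r" "t \<tturnstile> x \<^bold>\<in> k'"
      show "t \<tturnstile> fTransitive x" by (rule nat2[OF x(1) le_trans[OF x(2) rp] tr[OF x(2,1,3)]])
    next
      fix m t assume m: "is_name P m" "t \<preceq> r" "t \<tturnstile> m \<^bold>\<in> k' \<or> t \<tturnstile> m \<^bold>= k'"
      then have "t \<tturnstile> m \<^bold>\<in> n" using tr k'n mem_left_iff by metis
      then show "\<exists>r. r \<preceq> t \<and> (r \<tturnstile> fEmpty m \<or> (\<exists>k. is_name P k \<and> r \<tturnstile> fSucc m k))"
        using nat3[OF m(1) le_trans[OF m(2) rp]] by blast
    qed
    then obtain t and j :: nat where t: "t \<preceq> r" "t \<tturnstile> k' \<^bold>= ord j"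
      using 1(1)[OF k'(2) _ k'(1)] le_Field[OF rp] by blast
    have tk: "t \<tturnstile> k \<^bold>= ord j" using t r(4) by (meson eq_mono eq_trans)
    have "t \<preceq> q" using t r le_trans by blast
    have "t \<tturnstile> n \<^bold>= ord (Suc j)"
    proof (rule eq_ext[OF n is_name_ord])
      fix u and x :: "('p, 'i) name" assume u: "u \<preceq> t" "is_name P x"
      have "v \<tturnstile> x \<^bold>\<in> k \<longleftrightarrow> v \<tturnstile> x \<^bold>\<in> ord j" "v \<tturnstile> x \<^bold>= k \<longleftrightarrow> v \<tturnstile> x \<^bold>= ord j" if "v \<preceq> u" for v
        using mem_right_iff[OF eq_mono[OF tk le_trans[OF that u(1)]]]
          eq_right_iff[OF eq_mono[OF tk le_trans[OF that u(1)]]] by simp_all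
      then have *: "(\<forall>r. r \<preceq> u \<longrightarrow> (\<exists>s. s \<preceq> r \<and> (s \<tturnstile> x \<^bold>\<in> k \<or> s \<tturnstile> x \<^bold>= k))) \<longleftrightarrow>
          (\<forall>r. r \<preceq> u \<longrightarrow> (\<exists>s. s \<preceq> r \<and> (s \<tturnstile> x \<^bold>\<in> ord j \<or> s \<tturnstile> x \<^bold>= ord j)))"
        by (meson le_trans)
      show "u \<tturnstile> x \<^bold>\<in> n \<longleftrightarrow> u \<tturnstile> x \<^bold>\<in> ord (Suc j)"
        using k(2) Succ_ord[of j t] u le_trans[OF u(1) \<open>t \<preceq> q\<close>] * unfolding forced_Succ by blast
    qed
    then show ?thesis using t rp le_trans by blast
  qed
qed

end

section \<open>Uncountable sets of countable ordinals\<close>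

lemma countable_bounded_omega1:
  assumes "countable (A :: omega1 set)"
  obtains b where "\<And>a. a \<in> A \<Longrightarrow> a < b"
proof -
  have "countable (\<Union>a\<in>A. {..a})"
  proof (rule countable_UN[OF assms])
    fix a :: omega1
    have "{..a} = insert a {..<a}" by auto
    then show "countable {..a}" by (simp add: countable_initial_segment_omega1)
  qed
  then have "(\<Union>a\<in>A. {..a}) \<noteq> UNIV" using uncountable_omega1 by metis
  then obtain b where "\<forall>a\<in>A. \<not> b \<le> a" by auto
  then show thesis using that by (meson not_le)
qed

lemma uncountable_unbounded_omega1:
  assumes "uncountable (A :: omega1 set)" "countable B"
  obtains a where "a \<in> A" "\<And>b. b \<in> B \<Longrightarrow> b < a"
proof -
  obtain c where c: "\<And>b. b \<in> B \<Longrightarrow> b < c" using countable_bounded_omega1[OF assms(2)] by blast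
  have "\<not> A \<subseteq> {..<c}"
    using assms(1) countable_initial_segment_omega1 countable_subset by blast
  then obtain a where "a \<in> A" "c \<le> a" by (auto simp: not_less subset_eq)
  then show thesis using that c by (meson less_le_trans)
qed

text \<open>Transfinite recursion: each new element is chosen above the countably many earlier ones
  and above their values under \<open>f\<close>. If \<open>f x\<close> bounds all indices that
  conflict with \<open>x\<close>, the resulting set is free of conflicts.\<close>

lemma uncountable_thinning:
  fixes f :: "omega1 \<Rightarrow> omega1"
  assumes "uncountable A"
  obtains Z where "Z \<subseteq> A" "uncountable Z" "\<And>x y. x \<in> Z \<Longrightarrow> y \<in> Z \<Longrightarrow> x < y \<Longrightarrow> f x < y"
proof -
  have "\<exists>g :: omega1 \<Rightarrow> omega1. \<forall>x. g x \<in> A \<and> (\<forall>y<x. g y < g x \<and> f (g y) < g x)"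
  proof (rule dependent_wellorder_choice[where P = "\<lambda>g x z. z \<in> A \<and> (\<forall>y<x. g y < z \<and> f (g y) < z)"])
    fix x and g :: "omega1 \<Rightarrow> omega1"
    obtain a where "a \<in> A" "\<And>b. b \<in> g ` {..<x} \<union> (\<lambda>y. f (g y)) ` {..<x} \<Longrightarrow> b < a"
      by (rule uncountable_unbounded_omega1[OF assms, of "g ` {..<x} \<union> (\<lambda>y. f (g y)) ` {..<x}"])
        (auto simp: countable_initial_segment_omega1)
    then show "\<exists>r. r \<in> A \<and> (\<forall>y<x. g y < r \<and> f (g y) < r)" by auto
  qed auto
  then obtain g :: "omega1 \<Rightarrow> omega1" where g: "\<And>x. g x \<in> A"
      "\<And>x y. y < x \<Longrightarrow> g y < g x" "\<And>x y. y < x \<Longrightarrow> f (g y) < g x"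
    by metis
  have mono: "strict_mono g" using g(2) by (simp add: strict_mono_def)
  have "uncountable (range g)"
    using uncountable_omega1 countable_image_inj_on[OF _ strict_mono_imp_inj_on[OF mono]] by blast
  moreover have "f x < y" if xy: "x \<in> range g" "y \<in> range g" "x < y" for x y
  proof -
    obtain a b where "x = g a" "y = g b" using xy(1,2) by blast
    then show ?thesis using g(3) xy(3) strict_mono_less[OF mono] by simp
  qed
  ultimately show thesis using that[of "range g"] g(1) by blast
qed

text \<open>The chain condition speaks of sets, but families may repeat a condition. Two indices
  with the same condition are compatible by reflexivity.\<close>

lemma ccc_indexed:
  assumes P: "Preorder P" "ccc P" and U: "uncountable U" "\<And>x. x \<in> U \<Longrightarrow> s x \<in> Field P"
  obtains x y where "x \<in> U" "y \<in> U" "x \<noteq> y" "compatible P (s x) (s y)"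
proof (cases "inj_on s U")
  case True
  then have "uncountable (s ` U)" using U(1) countable_image_inj_on by blast
  then obtain p q where "p \<in> s ` U" "q \<in> s ` U" "p \<noteq> q" "compatible P p q"
    using P(2) U(2) unfolding ccc_def by (meson image_subsetI)
  then show thesis using that by auto
next
  case False
  then obtain x y where xy: "x \<in> U" "y \<in> U" "x \<noteq> y" "s x = s y" unfolding inj_on_def by blast
  have "(s x, s x) \<in> P" using U(2)[OF xy(1)] P(1) by (auto simp: preorder_on_def refl_on_def)
  then have "compatible P (s x) (s y)" using xy(4) by (auto simp: compatible_def)
  then show thesis using that xy by blast
qed

text \<open>Such an index \<open>\<xi>\<close> is one for which \<open>r \<xi>\<close> forces that uncountably many \<open>r \<eta>\<close> are in the generic
  filter.\<close>

lemma ccc_uncountably_compatible: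
  fixes r :: "omega1 \<Rightarrow> 'p"
  assumes P: "Preorder P" "ccc P" and r: "\<And>\<xi>. r \<xi> \<in> Field P"
  obtains \<xi> where "\<And>s. (s, r \<xi>) \<in> P \<Longrightarrow> uncountable {\<eta>. compatible P s (r \<eta>)}"
proof (rule ccontr)
  assume "\<not> thesis"
  then have "\<forall>\<xi>. \<exists>s. (s, r \<xi>) \<in> P \<and> countable {\<eta>. compatible P s (r \<eta>)}" using that by blast
  then obtain s where s: "\<And>\<xi>. (s \<xi>, r \<xi>) \<in> P" "\<And>\<xi>. countable {\<eta>. compatible P (s \<xi>) (r \<eta>)}"
    by metis
  have "\<forall>\<xi>. \<exists>b. \<forall>\<eta>. compatible P (s \<xi>) (r \<eta>) \<longrightarrow> \<eta> < b"
    using countable_bounded_omega1[OF s(2)] by (metis mem_Collect_eq)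
  then obtain f where f: "\<And>\<xi> \<eta>. compatible P (s \<xi>) (r \<eta>) \<Longrightarrow> \<eta> < f \<xi>" by metis
  \<comment> \<open>For x < y in \<open>Z\<close> the index \<open>y\<close> lies above every index
    compatible with \<open>s x\<close>. Hence \<open>s x\<close> is incompatible with
    \<open>r y\<close>, and all the more with its extension \<open>s y\<close>: the
    \<open>s x\<close> would form an uncountable antichain.\<close>
  obtain Z where Z: "uncountable Z" "\<And>x y. x \<in> Z \<Longrightarrow> y \<in> Z \<Longrightarrow> x < y \<Longrightarrow> f x < y"
    using uncountable_thinning[OF uncountable_omega1] by metis
  have "s \<xi> \<in> Field P" for \<xi> using s(1) by (auto simp: Field_def)
  then obtain x y where xy: "x \<in> Z" "y \<in> Z" "x \<noteq> y" "compatible P (s x) (s y)"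
    using ccc_indexed[OF P Z(1)] by metis
  have *: False if xy: "x \<in> Z" "y \<in> Z" "x < y" "compatible P (s x) (s y)" for x y
  proof -
    obtain t where "(t, s x) \<in> P" "(t, s y) \<in> P" using xy(4) by (auto simp: compatible_def)
    then have "compatible P (s x) (r y)"
      using s(1)[of y] P(1) unfolding compatible_def preorder_on_def by (metis transD)
    then show False using f Z(2) xy by (meson less_asym)
  qed
  have "compatible P (s y) (s x)" using xy(4) by (auto simp: compatible_def)
  then show False using * xy by (metis linorder_neqE)
qed

text \<open>Stated for indexed families, which may repeat conditions: some uncountable subfamily is
  centered. Indices are countable ordinals, because the coloring is evaluated on them.\<close>

definition precaliber_omega1 :: "'a rel \<Rightarrow> bool" where
  "precaliber_omega1 P \<longleftrightarrow> (\<forall>A r. uncountable (A :: omega1 set) \<and> r ` A \<subseteq> Field P \<longrightarrow>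
     (\<exists>Z\<subseteq>A. uncountable Z \<and> (\<forall>F\<subseteq>Z. finite F \<and> F \<noteq> {} \<longrightarrow> (\<exists>s. \<forall>x\<in>F. (s, r x) \<in> P))))"

text \<open>The combinatorial property of a poset from which it follows that it adds no uncountable
  homogeneous sets.\<close>

definition breaks_homogeneous :: "(omega1 set \<Rightarrow> nat) \<Rightarrow> 'a rel \<Rightarrow> bool" where
  "breaks_homogeneous \<pi> P \<longleftrightarrow> (\<forall>A r. \<forall>l<2. uncountable A \<and> r ` A \<subseteq> Field P \<longrightarrow>
     (\<exists>x\<in>A. \<exists>y\<in>A. x < y \<and> \<pi> {x, y} = l \<and> compatible P (r x) (r y)))"

section \<open>Forced countability and the absence of homogeneous sets\<close>

context forcing
begin

text \<open>Countably many names, no two of which can be forced equal, cover \<open>X\<close>. The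
  injection into \<omega> sends \<open>t j\<close> to the number of \<open>j\<close>; attaching this
  pair to exactly the conditions that force \<open>t j\<close> into \<open>X\<close> makes
  \<open>X\<close> the domain.\<close>

lemma CountableI:
  fixes X :: "('p, 'i) name" and t :: "'j \<Rightarrow> ('p, 'i) name"
  assumes J: "countable J" and t: "\<And>j. j \<in> J \<Longrightarrow> is_name P (t j)"
    and inj: "\<And>j k q. j \<in> J \<Longrightarrow> k \<in> J \<Longrightarrow> q \<in> Field P \<Longrightarrow> q \<tturnstile> t j \<^bold>= t k \<Longrightarrow> j = k"
    and cover: "\<And>q x. q \<preceq> p \<Longrightarrow> is_name P x \<Longrightarrow> q \<tturnstile> x \<^bold>\<in> X \<Longrightarrow>
      \<exists>r. r \<preceq> q \<and> (\<exists>j\<in>J. r \<tturnstile> x \<^bold>= t j)"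
  shows "p \<tturnstile> fCountable X"
proof -
  let ?w = "ord_set_name P (UNIV :: nat set) :: ('p, 'i) name"
  define C where "C = (\<lambda>j. {s \<in> Field P. s \<tturnstile> t j \<^bold>\<in> X})"
  let ?f = "fun_name J t (\<lambda>j. ord (to_nat_on J j)) C"
  have lep: "(UNIV :: nat set) \<lesssim> (UNIV :: 'i set)" by (intro countable_lepoll_names) simp
  have C: "C j \<subseteq> Field P" for j by (auto simp: C_def)
  note fn = countable_lepoll_names[OF J] t is_name_ord C
  have w: "q \<tturnstile> n \<^bold>\<in> ?w \<longleftrightarrow> q \<tturnstile> fNat n" if "is_name P n" for q n
  proof
    assume m: "q \<tturnstile> n \<^bold>\<in> ?w"
    show "q \<tturnstile> fNat n"
      by (rule stable_dense[OF stable_Nat]) (use m Nat_ord in \<open>unfold mem_ord_set[OF lep], blast\<close>)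
  next
    assume "q \<tturnstile> fNat n"
    then show "q \<tturnstile> n \<^bold>\<in> ?w"
      unfolding mem_ord_set[OF lep]
      using Nat_decided[OF stable_mono[OF stable_Nat] that le_Field(1)] by blast
  qed
  have "q \<tturnstile> (\<^bold>\<forall>n. n \<^bold>\<in> ?w \<^bold>\<longleftrightarrow> fNat n) \<and> q \<tturnstile> fFun ?f X ?w \<and> q \<tturnstile> fInj ?f" if q: "q \<preceq> p" for q
  proof (intro conjI)
    show "q \<tturnstile> (\<^bold>\<forall>n. n \<^bold>\<in> ?w \<^bold>\<longleftrightarrow> fNat n)"
      using w by (simp add: forced_All forced_Iff)
    show "q \<tturnstile> fFun ?f X ?w"
    proof (rule Fun_fun_name[OF fn])
      fix j s u assume *: "j \<in> J" "s \<in> C j" "u \<preceq> s" "u \<preceq> q"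
      have "u \<tturnstile> t j \<^bold>\<in> X" using * mem_mono by (auto simp: C_def)
      moreover have "u \<tturnstile> ord (to_nat_on J j) \<^bold>\<in> ?w"
        by (simp add: w Nat_ord[OF eq_refl])
      ultimately show "u \<tturnstile> t j \<^bold>\<in> X \<and> u \<tturnstile> ord (to_nat_on J j) \<^bold>\<in> ?w" by blast
    next
      fix j k s u v assume "j \<in> J" "k \<in> J" "v \<preceq> q" "v \<tturnstile> t j \<^bold>= t k"
      then have "j = k" using inj le_Field by blast
      then show "v \<tturnstile> ord (to_nat_on J j) \<^bold>= ord (to_nat_on J k)" by (simp add: eq_refl)
    next
      fix u x assume u: "u \<preceq> q" "is_name P x" "u \<tturnstile> x \<^bold>\<in> X"
      then obtain r j where r: "r \<preceq> u" "j \<in> J" "r \<tturnstile> x \<^bold>= t j" using cover le_trans[OF _ q] by blast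
      then have "r \<in> C j"
        using mem_left_iff[OF r(3)] mem_mono[OF u(3) r(1)] le_Field[OF r(1)] by (simp add: C_def)
      then show "\<exists>r. r \<preceq> u \<and> (\<exists>j\<in>J. \<exists>s\<in>C j. r \<preceq> s \<and> r \<tturnstile> x \<^bold>= t j)"
        using r le_refl'[OF r(1)] by blast
    qed
    show "q \<tturnstile> fInj ?f"
    proof (rule Inj_fun_name[OF fn])
      fix j k s u v assume *: "j \<in> J" "k \<in> J" "v \<preceq> q" "v \<tturnstile> ord (to_nat_on J j) \<^bold>= ord (to_nat_on J k)"
      then have "to_nat_on J j = to_nat_on J k" using ord_inject le_Field by blast
      then have "j = k" using * J by (simp add: inj_on_eq_iff)
      then show "v \<tturnstile> t j \<^bold>= t k" by (simp add: eq_refl)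
    qed
  qed
  moreover have "is_name P ?w" "is_name P ?f"
    using is_name_ord_set[OF lep] is_name_fun_name[OF fn] by auto
  ultimately show ?thesis
    unfolding fCountable_def by (subst forced_Ex2) (simp, unfold forced_And, blast dest: le_refl')
qed

text \<open>The values of the injection are forced natural numbers, so extensions decide them. The
  conclusion therefore speaks of actual numbers \<open>k\<close>, which allows a pigeonhole argument
  in the ground model.\<close>

lemma CountableD:
  fixes A :: "('p, 'i) name"
  assumes p: "p \<in> Field P" "p \<tturnstile> fCountable A"
  obtains r f where "r \<preceq> p" "is_name P f"
    "\<And>q x. q \<preceq> r \<Longrightarrow> is_name P x \<Longrightarrow> q \<tturnstile> x \<^bold>\<in> A \<Longrightarrow>
      \<exists>s. s \<preceq> q \<and> (\<exists>k::nat. s \<tturnstile> opair_name P x (ord k) \<^bold>\<in> f)"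
    "\<And>q x x' k. q \<preceq> r \<Longrightarrow> is_name P x \<Longrightarrow> is_name P x' \<Longrightarrow> q \<tturnstile> opair_name P x (ord (k::nat)) \<^bold>\<in> f \<Longrightarrow>
      q \<tturnstile> opair_name P x' (ord k) \<^bold>\<in> f \<Longrightarrow> q \<tturnstile> x \<^bold>= x'"
proof -
  have "p \<preceq> p" using p le_refl by blast
  then obtain r w f where r: "r \<preceq> p" "is_name P w" "is_name P f"
      "r \<tturnstile> (\<^bold>\<forall>n. n \<^bold>\<in> w \<^bold>\<longleftrightarrow> fNat n)" "r \<tturnstile> fFun f A w" "r \<tturnstile> fInj f"
    using p(2) unfolding fCountable_def by (subst (asm) forced_Ex2) (simp, unfold forced_And, blast)
  have w: "q \<tturnstile> n \<^bold>\<in> w \<Longrightarrow> q \<tturnstile> fNat n" if "q \<preceq> r" "is_name P n" for q n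
    using r(4) that by (simp add: forced_All forced_Iff)
  have "\<exists>s. s \<preceq> q \<and> (\<exists>k::nat. s \<tturnstile> opair_name P x (ord k) \<^bold>\<in> f)"
    if q: "q \<preceq> r" "is_name P x" "q \<tturnstile> x \<^bold>\<in> A" for q x
  proof -
    obtain s y where s: "s \<preceq> q" "is_name P y" "s \<tturnstile> opair_name P x y \<^bold>\<in> f"
      using Fun_total[OF r(5) q(2,1,3)] by blast
    obtain t x' y' where t: "t \<preceq> s" "is_name P x'" "is_name P y'" "t \<tturnstile> y' \<^bold>\<in> w"
        "t \<tturnstile> opair_name P x y \<^bold>= opair_name P x' y'"
      using Fun_elem[OF r(5) is_name_opair[OF q(2) s(2)] le_trans[OF s(1) q(1)] s(3)] by blast
    have "t \<tturnstile> y \<^bold>\<in> w" using mem_left_iff[OF opair_inject(2)[OF t(5)]] t(4) by blast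
    then have "t \<tturnstile> fNat y" using w[OF le_trans[OF t(1) le_trans[OF s(1) q(1)]] s(2)] by blast
    then obtain u and k :: nat where u: "u \<preceq> t" "u \<tturnstile> y \<^bold>= ord k"
      using Nat_decided[OF _ s(2) le_Field(1)[OF t(1)]] by blast
    have "u \<preceq> s" using u t le_trans by blast
    then have "u \<tturnstile> opair_name P x (ord k) \<^bold>\<in> f"
      using mem_left_iff[OF opair_cong[OF eq_refl u(2) q(2) s(2) q(2) is_name_ord]] mem_mono[OF s(3)] by blast
    then show ?thesis using le_trans[OF \<open>u \<preceq> s\<close> s(1)] by blast
  qed
  then show thesis
    using that[OF r(1,3)] InjD[OF r(6) _ _ is_name_ord] by blast
qed

text \<open>Each ordinal that may still enter \<open>X\<close> comes with a condition putting it
  there. Two compatible such conditions whose ordinals have the wrong color are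
  contradictory.\<close>

lemma forces_no_homogeneousI:
  assumes br: "breaks_homogeneous \<pi> P"
  shows "forces_no_homogeneous P TYPE('i) \<pi>"
proof -
  let ?c = "coloring_name P \<pi> :: ('p, 'i) name" and ?W = "ord_set_name P (UNIV :: omega1 set) :: ('p, 'i) name"
  have False
    if r: "r \<in> Field P" "is_name P X" "r \<tturnstile> X \<^bold>\<subseteq> ?W" "r \<tturnstile> (\<^bold>\<not> fCountable X)" 
      "r \<tturnstile> fHomogeneous ?c (ord l) X" and l: "l < (2::nat)" for r X l
  proof -
    \<comment> \<open>The ordinals that can be forced into \<open>X\<close> below \<open>r\<close>.
      Were there only countably many, their canonical names would cover \<open>X\<close> and
      \<open>r\<close> would force \<open>X\<close> to be countable.\<close>
    define S where "S = {x :: omega1. \<exists>q. q \<preceq> r \<and> q \<tturnstile> ord x \<^bold>\<in> X}"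
    have "uncountable S"
    proof
      assume S: "countable S"
      have "r \<tturnstile> fCountable X"
      proof (rule CountableI[OF S is_name_ord])
        fix q x assume q: "q \<preceq> r" "is_name P x" "q \<tturnstile> x \<^bold>\<in> X"
        then have "q \<tturnstile> x \<^bold>\<in> ?W" using r(3) by (simp add: forced_Subset)
        then obtain u \<beta> where u: "u \<preceq> q" "u \<tturnstile> x \<^bold>= ord (\<beta> :: omega1)"
          using le_refl'[OF q(1)] unfolding mem_ord_set[OF omega1_lepoll_names] by blast
        have "u \<tturnstile> ord \<beta> \<^bold>\<in> X" using mem_left_iff[OF u(2)] mem_mono[OF q(3) u(1)] by blast
        then have "\<beta> \<in> S" using le_trans[OF u(1) q(1)] by (auto simp: S_def)
        then show "\<exists>u. u \<preceq> q \<and> (\<exists>j\<in>S. u \<tturnstile> x \<^bold>= ord j)" using u by blast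
      qed (use ord_inject in blast)
      then show False using r(4) le_refl[OF r(1)] by (simp add: forced_Not)
    qed
    have "\<forall>x\<in>S. \<exists>q. q \<preceq> r \<and> q \<tturnstile> ord x \<^bold>\<in> X" by (auto simp: S_def)
    then obtain p where p: "\<And>x. x \<in> S \<Longrightarrow> p x \<preceq> r" "\<And>x. x \<in> S \<Longrightarrow> p x \<tturnstile> ord x \<^bold>\<in> X" by metis
    have pS: "p ` S \<subseteq> Field P" using p(1) le_Field by blast
    \<comment> \<open>The color opposite to the one that \<open>X\<close> is supposed to
      have.\<close>
    have "1 - l < 2" by simp
    then obtain x y where xy: "x \<in> S" "y \<in> S" "x < y" "\<pi> {x, y} = 1 - l" "compatible P (p x) (p y)"
      using br[unfolded breaks_homogeneous_def, rule_format, OF _ conjI[OF \<open>uncountable S\<close> pS]] by blast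
    then obtain t where t: "t \<preceq> p x" "t \<preceq> p y" by (auto simp: compatible_def)
    have "t \<preceq> r" using t(1) p(1) xy(1) le_trans by blast
    have "t \<tturnstile> (\<^bold>\<exists>u. fUpair u (ord x) (ord y) \<^bold>\<and> fRel ?c u (ord l))"
      using r(5) \<open>t \<preceq> r\<close> mem_mono[OF p(2)[OF xy(1)] t(1)] mem_mono[OF p(2)[OF xy(2)] t(2)] ord_memI[OF xy(3)]
      unfolding fHomogeneous_def by (simp add: forced_All forced_Imp forced_And)
    then obtain t' u where t': "t' \<preceq> t" "is_name P u" "t' \<tturnstile> fUpair u (ord x) (ord y)" "t' \<tturnstile> fRel ?c u (ord l)"
      using le_refl'[OF \<open>t \<preceq> r\<close>] unfolding forced_Ex forced_And by blast
    have u: "t' \<tturnstile> u \<^bold>= upair_name P (ord x) (ord y)" using t'(2,3) by (simp add: forced_Upair)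
    have "t' \<tturnstile> opair_name P u (ord l) \<^bold>\<in> ?c" using t'(2,4) by (simp add: forced_Rel)
    \<comment> \<open>The name of the coloring only provides some ground-model pair \<open>s\<close>
      of color \<open>l\<close> whose canonical name is forced equal to the pair of \<open>x\<close>
      and \<open>y\<close>. That \<open>s\<close> is \<open>{x, y}\<close> is then recovered from
      the injectivity of canonical names.\<close>
    then obtain v s where v: "v \<preceq> t'" "s \<in> [UNIV]\<^bsup>2\<^esup>"
        "v \<tturnstile> opair_name P u (ord l) \<^bold>= opair_name P (ord_set_name P s) (ord (\<pi> s))"
      using le_refl'[OF t'(1)] unfolding mem_coloring by blast
    have "v \<in> Field P" using v(1) le_Field by blast
    have "l = \<pi> s" using ord_inject[OF \<open>v \<in> Field P\<close> opair_inject(2)[OF v(3)]] .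
    have vu: "v \<tturnstile> upair_name P (ord x) (ord y) \<^bold>= ord_set_name P s"
      using opair_inject(1)[OF v(3)] eq_mono[OF u v(1)] eq_sym eq_trans by blast
    have "z \<in> s" if "v \<tturnstile> ord z \<^bold>\<in> upair_name P (ord x) (ord y)" for z
    proof -
      have "v \<tturnstile> ord z \<^bold>\<in> ord_set_name P s" using that mem_right_iff[OF vu] by blast
      then obtain w \<beta> where "w \<preceq> v" "\<beta> \<in> s" "w \<tturnstile> ord z \<^bold>= ord \<beta>"
        using le_refl[OF \<open>v \<in> Field P\<close>] unfolding mem_ord_set[OF omega1_lepoll_names] by blast
      then show ?thesis using ord_inject le_Field by blast
    qed
    then have "x \<in> s" "y \<in> s" using upair_mem_left upair_mem_right by blast+
    then have "s = {x, y}" using v(2) xy(3) unfolding nsets_2_eq by auto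
    then show False using xy(4) \<open>l = \<pi> s\<close> by arith
  qed
  then have "p \<tturnstile> fNo_homogeneous ?c ?W (ord l)" if "l < 2" for p and l :: nat
    using that le_Field unfolding fNo_homogeneous_def forced_Not forced_Ex forced_And
    by (metis le_refl')
  then show ?thesis
    unfolding forces_no_homogeneous_def Let_def forces_def forced_And by simp
qed

section \<open>Forced chain conditions of finite powers\<close>

lemma stable_Power_le [simp]: "stable (fPower_le n L h f)" for n L h f :: "('p, 'i) name"
  unfolding fPower_le_def by simp

lemma stable_Power_ccc [simp]: "stable (fPower_ccc n Q L)" for n Q L :: "('p, 'i) name"
  unfolding fPower_ccc_def by simp

lemma Power_leD:
  fixes n L h f k :: "('p, 'i) name"
  assumes "p \<tturnstile> fPower_le n L h f" "q \<preceq> p" "is_name P k" "q \<tturnstile> k \<^bold>\<in> n"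
  obtains r x y where "r \<preceq> q" "is_name P x" "is_name P y"
    "r \<tturnstile> opair_name P k x \<^bold>\<in> h" "r \<tturnstile> opair_name P k y \<^bold>\<in> f" "r \<tturnstile> fRel L x y"
proof -
  have "q \<tturnstile> (\<^bold>\<exists>x y. fRel h k x \<^bold>\<and> fRel f k y \<^bold>\<and> fRel L x y)"
    using assms unfolding fPower_le_def by (simp add: forced_All forced_Imp)
  then obtain r x y where "r \<preceq> q" "is_name P x" "is_name P y" "r \<tturnstile> fRel h k x" "r \<tturnstile> fRel f k y" "r \<tturnstile> fRel L x y"
    using le_refl'[OF assms(2)] by (auto simp: forced_Ex2 forced_And)
  then show thesis using that assms(3) by (simp add: forced_Rel)
qed

lemma Power_cccD:
  fixes n Q L A :: "('p, 'i) name"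
  assumes "p \<tturnstile> fPower_ccc n Q L" "p \<in> Field P" "is_name P A"
    and "\<And>q f. q \<preceq> p \<Longrightarrow> is_name P f \<Longrightarrow> q \<tturnstile> f \<^bold>\<in> A \<Longrightarrow> q \<tturnstile> fFun f n Q"
    and "p \<tturnstile> (\<^bold>\<not> fCountable A)"
  obtains r f g h where "r \<preceq> p" "is_name P f" "is_name P g" "is_name P h" "r \<tturnstile> f \<^bold>\<in> A" "r \<tturnstile> g \<^bold>\<in> A"
    "r \<tturnstile> (\<^bold>\<not> f \<^bold>= g)" "r \<tturnstile> fFun h n Q" "r \<tturnstile> fPower_le n L h f" "r \<tturnstile> fPower_le n L h g"
proof -
  have pp: "p \<preceq> p" using assms(2) le_refl by blast
  have "p \<tturnstile> (\<^bold>\<forall>f. f \<^bold>\<in> A \<^bold>\<longrightarrow> fFun f n Q)"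
    using assms(4) by (simp add: forced_All forced_Imp)
  then have "p \<tturnstile> (\<^bold>\<exists>f g. f \<^bold>\<in> A \<^bold>\<and> g \<^bold>\<in> A \<^bold>\<and> \<^bold>\<not> f \<^bold>= g \<^bold>\<and>
        (\<^bold>\<exists>h. fFun h n Q \<^bold>\<and> fPower_le n L h f \<^bold>\<and> fPower_le n L h g))"
    using assms(1,3,5) pp unfolding fPower_ccc_def by (simp add: forced_All forced_Imp forced_And)
  then obtain q f g where q: "q \<preceq> p" "is_name P f" "is_name P g" "q \<tturnstile> f \<^bold>\<in> A" "q \<tturnstile> g \<^bold>\<in> A"
      "q \<tturnstile> (\<^bold>\<not> f \<^bold>= g)" "q \<tturnstile> (\<^bold>\<exists>h. fFun h n Q \<^bold>\<and> fPower_le n L h f \<^bold>\<and> fPower_le n L h g)"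
    using pp by (auto simp: forced_Ex2 forced_And)
  obtain r h where r: "r \<preceq> q" "is_name P h" "r \<tturnstile> fFun h n Q" "r \<tturnstile> fPower_le n L h f" "r \<tturnstile> fPower_le n L h g"
    using q(7) le_refl'[OF q(1)] unfolding forced_Ex forced_And by blast
  show thesis
    using that[OF le_trans[OF r(1) q(1)] q(2,3) r(2) mem_mono[OF q(4) r(1)] mem_mono[OF q(5) r(1)] _ r(3-5)]
      stable_mono[OF stable_Not[OF stable_eq] q(6) r(1)] by blast
qed

section \<open>Consequences of being a forced poset\<close>

context
  fixes Q L :: "('p, 'i) name" and p
  assumes poset: "p \<tturnstile> fPoset Q L"
begin

lemma Poset_refl: "q \<preceq> p \<Longrightarrow> is_name P x \<Longrightarrow> q \<tturnstile> x \<^bold>\<in> Q \<Longrightarrow> q \<tturnstile> fRel L x x"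
  using poset unfolding fPoset_def by (simp add: forced_All forced_Imp forced_And)

lemma Poset_trans:
  "q \<preceq> p \<Longrightarrow> is_name P x \<Longrightarrow> is_name P y \<Longrightarrow> is_name P z \<Longrightarrow>
    q \<tturnstile> fRel L x y \<Longrightarrow> q \<tturnstile> fRel L y z \<Longrightarrow> q \<tturnstile> fRel L x z"
proof -
  assume *: "q \<preceq> p" "is_name P x" "is_name P y" "is_name P z" "q \<tturnstile> fRel L x y" "q \<tturnstile> fRel L y z"
  have "p \<tturnstile> (\<^bold>\<forall>x y z. fRel L x y \<^bold>\<and> fRel L y z \<^bold>\<longrightarrow> fRel L x z)"
    using poset unfolding fPoset_def forced_And by blast
  then have "p \<tturnstile> (fRel L x y \<^bold>\<and> fRel L y z \<^bold>\<longrightarrow> fRel L x z)"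
    unfolding forced_All using *(2-4) by metis
  then have "q \<tturnstile> (fRel L x y \<^bold>\<and> fRel L y z) \<longrightarrow> q \<tturnstile> fRel L x z"
    using forced_Imp[OF stable_And[OF stable_Rel stable_Rel] stable_Rel, THEN iffD1, rule_format, OF _ *(1)] by metis
  then show ?thesis using *(5,6) unfolding forced_And by metis
qed

lemma Poset_dom:
  assumes q: "q \<preceq> p" and n: "is_name P x" "is_name P y" and xy: "q \<tturnstile> fRel L x y"
  shows "q \<tturnstile> x \<^bold>\<in> Q"
proof (rule stable_dense[OF stable_mem])
  fix r assume r: "r \<preceq> q"
  then have "r \<preceq> p" using q le_trans by blast
  have "r \<tturnstile> opair_name P x y \<^bold>\<in> L" using stable_mono[OF stable_Rel xy r] n by (simp add: forced_Rel)
  then have "r \<tturnstile> (\<^bold>\<exists>a b. a \<^bold>\<in> Q \<^bold>\<and> b \<^bold>\<in> Q \<^bold>\<and> fOpair (opair_name P x y) a b)"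
    using poset \<open>r \<preceq> p\<close> is_name_opair[OF n] unfolding fPoset_def
    by (simp add: forced_All forced_Imp forced_And)
  then obtain s a b where s: "s \<preceq> r" "is_name P a" "is_name P b" "s \<tturnstile> a \<^bold>\<in> Q" "s \<tturnstile> fOpair (opair_name P x y) a b"
    using le_refl'[OF r] by (auto simp: forced_Ex2 forced_And)
  have "s \<tturnstile> opair_name P x y \<^bold>= opair_name P a b" using s n is_name_opair[OF n] by (simp add: forced_Opair)
  then have "s \<tturnstile> x \<^bold>\<in> Q" using mem_left_iff[OF opair_inject(1)] s(4) by blast
  then show "\<exists>s. s \<preceq> r \<and> s \<tturnstile> x \<^bold>\<in> Q" using s by blast
qed

end

text \<open>Conditions of an iteration store indices into the name of the iterand, so an arbitrary
  forced element has to be replaced, at an extension, by one listed in \<open>Q\<close>.\<close>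

lemma mem_name_at:
  fixes x Q :: "('p, 'i) name"
  assumes p: "p \<in> Field P" and x: "p \<tturnstile> x \<^bold>\<in> Q"
  obtains q j where "q \<preceq> p" "j \<in> name_dom Q" "q \<tturnstile> x \<^bold>= name_at Q j" "q \<tturnstile> name_at Q j \<^bold>\<in> Q"
proof -
  obtain q y t where q: "q \<preceq> p" "(y, t) \<in> elts Q" "q \<preceq> t" "q \<tturnstile> x \<^bold>= y"
    using x le_refl[OF p] unfolding forced_mem by blast
  then obtain j C where "entry Q j = Some (y, C)" "t \<in> C" by (auto simp: elts_def)
  then have "j \<in> name_dom Q" "name_at Q j = y" by (auto simp: name_dom_def name_at_def)
  then show thesis using that q child_mem[OF q(2,3)] by blast
qed

lemma is_name_name_at: "is_name P Q \<Longrightarrow> j \<in> name_dom Q \<Longrightarrow> is_name P (name_at Q j)"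
  for Q :: "('p, 'i) name"
proof -
  assume "is_name P Q" "j \<in> name_dom Q"
  then obtain \<sigma> C s where "entry Q j = Some (\<sigma>, C)" "s \<in> C" by (auto simp: name_dom_def)
  then have "(\<sigma>, s) \<in> elts Q" "name_at Q j = \<sigma>" by (auto simp: elts_def name_at_def)
  then show ?thesis using is_name_child \<open>is_name P Q\<close> by metis
qed

text \<open>Each coordinate has its lower bound only at some extension, and replacing it by a listed
  name costs a further one. There are finitely many coordinates, so successive refinements lead to
  one condition for all of them.\<close>

lemma common_lower_bounds:
  fixes Q L :: "('p, 'i) name" and a b :: "nat \<Rightarrow> ('p, 'i) name"
  assumes Q: "is_name P Q" and s: "s \<in> Field P"
    and ab: "\<And>i. i < m \<Longrightarrow> is_name P (a i)" "\<And>i. i < m \<Longrightarrow> is_name P (b i)"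
    and ex: "\<And>i u. i < m \<Longrightarrow> u \<preceq> s \<Longrightarrow>
      \<exists>v x. v \<preceq> u \<and> is_name P x \<and> v \<tturnstile> x \<^bold>\<in> Q \<and> v \<tturnstile> fRel L x (a i) \<and> v \<tturnstile> fRel L x (b i)"
  shows "\<exists>v j. v \<preceq> s \<and> (\<forall>i<m. j i \<in> name_dom Q \<and> v \<tturnstile> name_at Q (j i) \<^bold>\<in> Q \<and>
      v \<tturnstile> fRel L (name_at Q (j i)) (a i) \<and> v \<tturnstile> fRel L (name_at Q (j i)) (b i))"
  using ab ex
proof (induction m)
  case 0
  then show ?case using le_refl[OF s] by auto
next
  case (Suc m)
  obtain v j where v: "v \<preceq> s" and j: "\<And>i. i < m \<Longrightarrow> j i \<in> name_dom Q \<and> v \<tturnstile> name_at Q (j i) \<^bold>\<in> Q \<and>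
      v \<tturnstile> fRel L (name_at Q (j i)) (a i) \<and> v \<tturnstile> fRel L (name_at Q (j i)) (b i)"
    using Suc.IH Suc.prems less_SucI by blast
  obtain u x where u: "u \<preceq> v" "is_name P x" "u \<tturnstile> x \<^bold>\<in> Q" "u \<tturnstile> fRel L x (a m)" "u \<tturnstile> fRel L x (b m)"
    using Suc.prems(3)[OF lessI v] by blast
  obtain w k where w: "w \<preceq> u" "k \<in> name_dom Q" "w \<tturnstile> x \<^bold>= name_at Q k" "w \<tturnstile> name_at Q k \<^bold>\<in> Q"
    by (rule mem_name_at[OF le_Field(1)[OF u(1)] u(3)])
  have k: "is_name P (name_at Q k)" using is_name_name_at Q w(2) by blast
  have am: "is_name P (a m)" and bm: "is_name P (b m)" using Suc.prems(1,2) by blast+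
  have "w \<tturnstile> fRel L (name_at Q k) (a m)" "w \<tturnstile> fRel L (name_at Q k) (b m)"
    using Rel_cong[OF w(3) eq_refl stable_mono[OF stable_Rel u(4) w(1)] u(2) am k am]
      Rel_cong[OF w(3) eq_refl stable_mono[OF stable_Rel u(5) w(1)] u(2) bm k bm] by blast+
  moreover have wv: "w \<preceq> v" using w u le_trans by blast
  moreover have "w \<tturnstile> name_at Q (j i) \<^bold>\<in> Q \<and> w \<tturnstile> fRel L (name_at Q (j i)) (a i) \<and> w \<tturnstile> fRel L (name_at Q (j i)) (b i)"
    if "i < m" for i
    using j[OF that] wv stable_mono[OF stable_Rel] mem_mono by blast
  ultimately have "\<forall>i<Suc m. (j(m := k)) i \<in> name_dom Q \<and> w \<tturnstile> name_at Q ((j(m := k)) i) \<^bold>\<in> Q \<and>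
      w \<tturnstile> fRel L (name_at Q ((j(m := k)) i)) (a i) \<and> w \<tturnstile> fRel L (name_at Q ((j(m := k)) i)) (b i)"
    using j w by (auto simp: less_Suc_eq)
  then show ?case using le_trans[OF wv v] by blast
qed

text \<open>Collect the tuples whose \<open>r \<xi>\<close> is in the generic filter into a set
  named \<open>A\<close>. Where \<open>A\<close> is forced uncountable, the chain condition of the
  m-th power gives two compatible tuples. Where it is forced countable, two indices share the same
  tuple, and reflexivity gives the lower bounds.\<close>

lemma powerfully_ccc_compatible:
  fixes Q L :: "('p, 'i) name" and a :: "omega1 \<Rightarrow> nat \<Rightarrow> ('p, 'i) name"
  assumes ccc: "ccc P" and Q: "is_name P Q"
    and poset: "forces P (fPoset Q L)" and pccc: "forces P (fPowerfully_ccc Q L)"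
    and r: "\<And>\<xi>. r \<xi> \<in> Field P"
    and a: "\<And>\<xi> i. i < m \<Longrightarrow> is_name P (a \<xi> i)" "\<And>\<xi> i. i < m \<Longrightarrow> r \<xi> \<tturnstile> a \<xi> i \<^bold>\<in> Q"
  obtains \<xi> \<eta> s j where "\<xi> \<noteq> \<eta>" "s \<preceq> r \<xi>" "s \<preceq> r \<eta>"
    "\<And>i. i < m \<Longrightarrow> j i \<in> name_dom Q \<and> s \<tturnstile> name_at Q (j i) \<^bold>\<in> Q \<and>
      s \<tturnstile> fRel L (name_at Q (j i)) (a \<xi> i) \<and> s \<tturnstile> fRel L (name_at Q (j i)) (a \<eta> i)"
proof -
  note result = that
  \<comment> \<open>The tuple is a function on \<open>m\<close> at every condition; only its values
    need \<open>r \<xi>\<close> to lie in \<open>Q\<close>.\<close>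
  define tuple where "tuple \<xi> = fun_name {..<m} ord (a \<xi>) (\<lambda>_. Field P)" for \<xi>
  note fn = countable_lepoll_names[OF countable_finite[OF finite_lessThan]] is_name_ord a(1)[OF lessThan_iff[THEN iffD1]] subset_refl
  have tuple_name: "is_name P (tuple \<xi>)" for \<xi>
    unfolding tuple_def by (rule is_name_fun_name[OF fn])
  have tuple_fun: "q \<tturnstile> fFun (tuple \<xi>) (ord m) Q" if q: "q \<preceq> r \<xi>" for q \<xi>
    unfolding tuple_def
  proof (rule Fun_fun_name[OF fn])
    fix i s u assume "i \<in> {..<m}" "u \<preceq> q"
    then show "u \<tturnstile> ord i \<^bold>\<in> ord m \<and> u \<tturnstile> a \<xi> i \<^bold>\<in> Q"
      using ord_memI mem_mono[OF a(2) le_trans[OF _ q]] by simp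
  next
    fix i k :: nat and s t u assume "u \<preceq> q" "u \<tturnstile> ord i \<^bold>= ord k"
    then have "i = k" using ord_inject le_Field by blast
    then show "u \<tturnstile> a \<xi> i \<^bold>= a \<xi> k" by (simp add: eq_refl)
  next
    fix u x assume u: "u \<preceq> q" "u \<tturnstile> x \<^bold>\<in> ord m"
    obtain v i where v: "v \<preceq> u" "i < m" "v \<tturnstile> x \<^bold>= ord i" by (rule mem_ordD[OF le_Field(1)[OF u(1)] u(2)])
    then show "\<exists>v. v \<preceq> u \<and> (\<exists>i\<in>{..<m}. \<exists>s\<in>Field P. v \<preceq> s \<and> v \<tturnstile> x \<^bold>= ord i)"
      using le_refl'[OF v(1)] le_Field[OF v(1)] by blast
  qed
  have mem_tuple: "v \<tturnstile> opair_name P x y \<^bold>\<in> tuple \<xi> \<longleftrightarrow>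
      (\<forall>u. u \<preceq> v \<longrightarrow> (\<exists>w. w \<preceq> u \<and> (\<exists>k<m. w \<tturnstile> x \<^bold>= ord k \<and> w \<tturnstile> y \<^bold>= a \<xi> k)))"
    if xy: "is_name P x" "is_name P y" for v x y \<xi>
  proof -
    have "v \<tturnstile> opair_name P x y \<^bold>\<in> tuple \<xi> \<longleftrightarrow> (\<forall>u. u \<preceq> v \<longrightarrow> (\<exists>w. w \<preceq> u \<and>
        (\<exists>k\<in>{..<m}. \<exists>s\<in>Field P. w \<preceq> s \<and> w \<tturnstile> x \<^bold>= ord k \<and> w \<tturnstile> y \<^bold>= a \<xi> k)))"
      unfolding tuple_def by (rule mem_fun_name[OF fn xy])
    then show ?thesis by (meson lessThan_iff le_Field le_refl)
  qed
  have tuple_val: "v \<tturnstile> y \<^bold>= a \<xi> i" if v: "v \<tturnstile> opair_name P (ord i) y \<^bold>\<in> tuple \<xi>" "is_name P y" for v y \<xi> and i :: nat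
  proof (rule stable_dense[OF stable_eq])
    fix u assume "u \<preceq> v"
    then obtain w k where w: "w \<preceq> u" "w \<tturnstile> ord i \<^bold>= ord k" "w \<tturnstile> y \<^bold>= a \<xi> k"
      using v(1) unfolding mem_tuple[OF is_name_ord v(2)] by blast
    then have "i = k" using ord_inject le_Field by blast
    then show "\<exists>w. w \<preceq> u \<and> w \<tturnstile> y \<^bold>= a \<xi> i" using w by blast
  qed
  have tuple_mem: "v \<tturnstile> opair_name P (ord i) (a \<xi> i) \<^bold>\<in> tuple \<xi>" if "i < m" for v i \<xi>
    unfolding mem_tuple[OF is_name_ord a(1)[OF that]] using that eq_refl le_refl' by blast
  have UN: "(UNIV :: omega1 set) \<lesssim> (UNIV :: 'i set)" by (rule omega1_lepoll_names)
  \<comment> \<open>Attaching the tuple to \<open>r \<xi>\<close> makes it a member of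
    \<open>A\<close> when \<open>r \<xi>\<close> is in the generic filter. This also guarantees that
    all members of \<open>A\<close> are functions into \<open>Q\<close>.\<close>
  define A where "A = mk_name (\<Union>\<xi>\<in>UNIV. {tuple \<xi>} \<times> {r \<xi>})"
  have A_name: "is_name P A" unfolding A_def using tuple_name r by (intro is_name_mk[OF UN]) auto
  have A_mem: "q \<tturnstile> f \<^bold>\<in> A \<longleftrightarrow> (\<forall>u. u \<preceq> q \<longrightarrow> (\<exists>v. v \<preceq> u \<and> (\<exists>\<xi>. v \<preceq> r \<xi> \<and> v \<tturnstile> f \<^bold>= tuple \<xi>)))" for q f
    unfolding A_def mem_mk[OF UN] by simp
  have tuple_A: "v \<tturnstile> tuple \<xi> \<^bold>\<in> A" if "v \<preceq> r \<xi>" for v \<xi>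
    unfolding A_mem using that eq_refl le_refl' le_trans by blast
  have A_fun: "q \<tturnstile> fFun f (ord m) Q" if q: "q \<tturnstile> f \<^bold>\<in> A" for q f
  proof (rule stable_dense[OF stable_Fun])
    fix u assume "u \<preceq> q"
    then obtain v \<xi> where v: "v \<preceq> u" "v \<preceq> r \<xi>" "v \<tturnstile> f \<^bold>= tuple \<xi>" using q unfolding A_mem by blast
    show "\<exists>v. v \<preceq> u \<and> v \<tturnstile> fFun f (ord m) Q"
      using v(1) Fun_cong[OF eq_sym[OF v(3)] tuple_fun[OF v(2)]] by blast
  qed
  have P: "p \<tturnstile> fPoset Q L" if "p \<in> Field P" for p using poset that by (simp add: forces_def)
  have main: thesis
    if \<xi>\<eta>: "\<xi> \<noteq> \<eta>" and s: "s \<preceq> r \<xi>" "s \<preceq> r \<eta>" and ex: "\<And>i u. i < m \<Longrightarrow> u \<preceq> s \<Longrightarrow>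
      \<exists>v x. v \<preceq> u \<and> is_name P x \<and> v \<tturnstile> x \<^bold>\<in> Q \<and> v \<tturnstile> fRel L x (a \<xi> i) \<and> v \<tturnstile> fRel L x (a \<eta> i)" for \<xi> \<eta> s
  proof -
    obtain v j where v: "v \<preceq> s" "\<And>i. i < m \<Longrightarrow> j i \<in> name_dom Q \<and> v \<tturnstile> name_at Q (j i) \<^bold>\<in> Q \<and>
        v \<tturnstile> fRel L (name_at Q (j i)) (a \<xi> i) \<and> v \<tturnstile> fRel L (name_at Q (j i)) (a \<eta> i)"
      using common_lower_bounds[where m = m and a = "a \<xi>" and b = "a \<eta>",
          OF Q le_Field(1)[OF s(1)] a(1) a(1) ex] by blast
    show thesis by (rule result[OF \<xi>\<eta> le_trans[OF v(1) s(1)] le_trans[OF v(1) s(2)] v(2)])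
  qed
  have pre: "Preorder P" by (rule preorder)
  obtain \<xi>0 where \<xi>0: "\<And>s. s \<preceq> r \<xi>0 \<Longrightarrow> uncountable {\<eta>. compatible P s (r \<eta>)}"
    using ccc_uncountably_compatible[where r = r, OF pre ccc r] by metis
  show thesis
  proof (cases "r \<xi>0 \<tturnstile> (\<^bold>\<not> fCountable A)")
    \<comment> \<open>An extension fixes an injection of \<open>A\<close> into \<omega>. By the
      choice of \<open>\<xi>0\<close> uncountably many indices remain available below it;
      uncountably many of them get the same decided value \<open>n\<close>, and two of these have
      compatible witnesses, which forces their tuples to be equal.\<close>
    case False
    then obtain p where p: "p \<preceq> r \<xi>0" "p \<tturnstile> fCountable A" unfolding forced_Not by blast
    obtain p' f where p': "p' \<preceq> p" "is_name P f"
      and tot: "\<And>q x. q \<preceq> p' \<Longrightarrow> is_name P x \<Longrightarrow> q \<tturnstile> x \<^bold>\<in> A \<Longrightarrow>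
          \<exists>s. s \<preceq> q \<and> (\<exists>k::nat. s \<tturnstile> opair_name P x (ord k) \<^bold>\<in> f)"
      and inj: "\<And>q x x' k. q \<preceq> p' \<Longrightarrow> is_name P x \<Longrightarrow> is_name P x' \<Longrightarrow>
          q \<tturnstile> opair_name P x (ord (k::nat)) \<^bold>\<in> f \<Longrightarrow> q \<tturnstile> opair_name P x' (ord k) \<^bold>\<in> f \<Longrightarrow> q \<tturnstile> x \<^bold>= x'"
      using CountableD[OF le_Field(1)[OF p(1)] p(2)] by metis
    define U where "U = {\<eta>. compatible P p' (r \<eta>)}"
    have U: "uncountable U" unfolding U_def by (rule \<xi>0[OF le_trans[OF p'(1) p(1)]])
    have "\<exists>s k. s \<preceq> p' \<and> s \<preceq> r \<eta> \<and> s \<tturnstile> opair_name P (tuple \<eta>) (ord (k::nat)) \<^bold>\<in> f" if \<eta>: "\<eta> \<in> U" for \<eta>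
    proof -
      obtain t where t: "t \<preceq> p'" "t \<preceq> r \<eta>" using \<eta> by (auto simp: U_def compatible_def)
      then obtain s k where "s \<preceq> t" "s \<tturnstile> opair_name P (tuple \<eta>) (ord (k::nat)) \<^bold>\<in> f"
        using tot[OF t(1) tuple_name tuple_A[OF t(2)]] by blast
      then show ?thesis using t le_trans by blast
    qed
    then obtain s and k :: "omega1 \<Rightarrow> nat" where s: "\<And>\<eta>. \<eta> \<in> U \<Longrightarrow> s \<eta> \<preceq> p'" "\<And>\<eta>. \<eta> \<in> U \<Longrightarrow> s \<eta> \<preceq> r \<eta>"
        "\<And>\<eta>. \<eta> \<in> U \<Longrightarrow> s \<eta> \<tturnstile> opair_name P (tuple \<eta>) (ord (k \<eta>)) \<^bold>\<in> f"
      by metis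
    have "\<exists>n. uncountable {\<eta> \<in> U. k \<eta> = n}"
    proof (rule ccontr)
      assume "\<not> ?thesis"
      then have "countable (\<Union>n. {\<eta> \<in> U. k \<eta> = n})" by (intro countable_UN) auto
      moreover have "(\<Union>n. {\<eta> \<in> U. k \<eta> = n}) = U" by auto
      ultimately show False using U by simp
    qed
    then obtain n where n: "uncountable {\<eta> \<in> U. k \<eta> = n}" by blast
    obtain \<xi> \<eta> where \<xi>\<eta>: "\<xi> \<in> U" "\<eta> \<in> U" "k \<xi> = n" "k \<eta> = n" "\<xi> \<noteq> \<eta>" "compatible P (s \<xi>) (s \<eta>)"
      by (rule ccc_indexed[OF pre ccc n, of s]) (use le_Field(1)[OF s(1)] in auto)
    then obtain t where t: "t \<preceq> s \<xi>" "t \<preceq> s \<eta>" by (auto simp: compatible_def)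
    have "t \<tturnstile> tuple \<xi> \<^bold>= tuple \<eta>"
      using inj[OF le_trans[OF t(1) s(1)[OF \<xi>\<eta>(1)]] tuple_name tuple_name]
        mem_mono[OF s(3)[OF \<xi>\<eta>(1)] t(1)] mem_mono[OF s(3)[OF \<xi>\<eta>(2)] t(2)] \<xi>\<eta>(3,4) by metis
    have eq: "u \<tturnstile> a \<xi> i \<^bold>= a \<eta> i" if "i < m" "u \<preceq> t" for i u
    proof -
      have "u \<tturnstile> opair_name P (ord i) (a \<xi> i) \<^bold>\<in> tuple \<eta>"
        using tuple_mem[OF that(1)] mem_right_iff[OF eq_mono[OF \<open>t \<tturnstile> tuple \<xi> \<^bold>= tuple \<eta>\<close> that(2)]] by blast
      then show ?thesis using tuple_val a(1)[OF that(1)] by blast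
    qed
    have tr: "t \<preceq> r \<xi>" "t \<preceq> r \<eta>" using t s(2) \<xi>\<eta>(1,2) le_trans by blast+
    show thesis
    proof (rule main[OF \<xi>\<eta>(5) tr])
      fix i u assume i: "i < m" and u: "u \<preceq> t"
      have aQ: "u \<tturnstile> a \<xi> i \<^bold>\<in> Q" using mem_mono[OF a(2)[OF i] le_trans[OF u tr(1)]] .
      have rel: "u \<tturnstile> fRel L (a \<xi> i) (a \<xi> i)"
        using Poset_refl[OF P[OF le_Field(1)[OF u]] le_refl'[OF u] a(1)[OF i] aQ] .
      show "\<exists>v x. v \<preceq> u \<and> is_name P x \<and> v \<tturnstile> x \<^bold>\<in> Q \<and> v \<tturnstile> fRel L x (a \<xi> i) \<and> v \<tturnstile> fRel L x (a \<eta> i)"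
        using le_refl'[OF u] a(1)[OF i] aQ rel
          Rel_cong[OF eq_refl eq[OF i u] rel a(1)[OF i] a(1)[OF i] a(1)[OF i] a(1)[OF i]] by blast
    qed
  next
    case True
    have "r \<xi>0 \<tturnstile> fPower_ccc (ord m) Q L"
      using pccc r[of \<xi>0] Nat_ord[OF eq_refl] le_refl[OF r]
      by (simp add: forces_def fPowerfully_ccc_def forced_All forced_Imp)
    then obtain q f g h where q: "q \<preceq> r \<xi>0" "is_name P f" "is_name P g" "is_name P h" "q \<tturnstile> f \<^bold>\<in> A" "q \<tturnstile> g \<^bold>\<in> A"
      "q \<tturnstile> (\<^bold>\<not> f \<^bold>= g)" "q \<tturnstile> fFun h (ord m) Q" "q \<tturnstile> fPower_le (ord m) L h f" "q \<tturnstile> fPower_le (ord m) L h g"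
      by (rule Power_cccD[OF _ r A_name A_fun True])
    obtain q1 \<xi> where q1: "q1 \<preceq> q" "q1 \<preceq> r \<xi>" "q1 \<tturnstile> f \<^bold>= tuple \<xi>"
      using q(5) le_refl'[OF q(1)] unfolding A_mem by blast
    obtain s \<eta> where s: "s \<preceq> q1" "s \<preceq> r \<eta>" "s \<tturnstile> g \<^bold>= tuple \<eta>"
      using q(6) q1(1) unfolding A_mem by blast
    have sq: "s \<preceq> q" using s(1) q1(1) le_trans by blast
    have f: "s \<tturnstile> f \<^bold>= tuple \<xi>" using eq_mono[OF q1(3) s(1)] .
    \<comment> \<open>The chain condition provides members of \<open>A\<close> that are forced
      distinct; this is what separates their indices.\<close>
    have "\<xi> \<noteq> \<eta>"
    proof
      assume "\<xi> = \<eta>"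
      then have "s \<tturnstile> f \<^bold>= g" using f eq_sym[OF s(3)] eq_trans by metis
      then show False using q(7) sq unfolding forced_Not by blast
    qed
    then show thesis
    proof (rule main[OF _ le_trans[OF s(1) q1(2)] s(2)])
      fix i u assume i: "i < m" and u: "u \<preceq> s"
      have uq: "u \<preceq> q" using le_trans[OF u sq] .
      obtain v x y where v: "v \<preceq> u" "is_name P x" "is_name P y"
          "v \<tturnstile> opair_name P (ord i) x \<^bold>\<in> h" "v \<tturnstile> opair_name P (ord i) y \<^bold>\<in> f" "v \<tturnstile> fRel L x y"
        by (rule Power_leD[OF q(9) uq is_name_ord ord_memI[OF i]])
      have vq: "v \<preceq> q" using le_trans[OF v(1) uq] .
      obtain w x' y' where w: "w \<preceq> v" "is_name P x'" "is_name P y'"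
          "w \<tturnstile> opair_name P (ord i) x' \<^bold>\<in> h" "w \<tturnstile> opair_name P (ord i) y' \<^bold>\<in> g" "w \<tturnstile> fRel L x' y'"
        by (rule Power_leD[OF q(10) vq is_name_ord ord_memI[OF i]])
      have ws: "w \<preceq> s" and wq: "w \<preceq> q" using le_trans[OF w(1) le_trans[OF v(1) u]] le_trans[OF w(1) vq] by blast+
      have y: "w \<tturnstile> y \<^bold>= a \<xi> i"
        using tuple_val[OF _ v(3)] mem_right_iff[OF eq_mono[OF f ws]] mem_mono[OF v(5) w(1)] by blast
      have y': "w \<tturnstile> y' \<^bold>= a \<eta> i"
        using tuple_val[OF _ w(3)] mem_right_iff[OF eq_mono[OF s(3) ws]] w(5) by blast
      \<comment> \<open>The comparisons with \<open>f\<close> and with \<open>g\<close> each produce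
        their own value of \<open>h\<close> at \<open>i\<close>. As \<open>h\<close> is a function,
        the two values agree, and a single element bounds both coordinates.\<close>
      have x': "w \<tturnstile> x' \<^bold>= x"
        by (rule Fun_unique[OF q(8) is_name_ord w(2) v(2) wq w(4) mem_mono[OF v(4) w(1)]])
      have rel: "w \<tturnstile> fRel L x (a \<xi> i)"
        by (rule Rel_cong[OF eq_refl y stable_mono[OF stable_Rel v(6) w(1)] v(2,3,2) a(1)[OF i]])
      have rel': "w \<tturnstile> fRel L x (a \<eta> i)"
        by (rule Rel_cong[OF x' y' w(6) w(2,3) v(2) a(1)[OF i]])
      have "w \<tturnstile> x \<^bold>\<in> Q"
        by (rule Poset_dom[OF P[OF le_Field(1)[OF ws]] le_refl'[OF ws] v(2) a(1)[OF i] rel])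
      then show "\<exists>v x. v \<preceq> u \<and> is_name P x \<and> v \<tturnstile> x \<^bold>\<in> Q \<and> v \<tturnstile> fRel L x (a \<xi> i) \<and> v \<tturnstile> fRel L x (a \<eta> i)"
        using le_trans[OF w(1) v(1)] v(2) rel rel' by blast
    qed
  qed
qed

end

section \<open>Precaliber\<close>

lemma uncountable_image_inj: "inj_on e U \<Longrightarrow> uncountable U \<Longrightarrow> uncountable (e ` U)"
  using countable_image_inj_on by blast

text \<open>If some point lies in uncountably many of the sets, it joins the root and the sets
  shrink by one. Otherwise each point lies in countably many, so each set meets only countably many
  others, and thinning leaves a disjoint family.\<close>

lemma delta_system_card:
  fixes d :: "omega1 \<Rightarrow> 'a set"
  assumes "uncountable A" "\<And>x. x \<in> A \<Longrightarrow> finite (d x) \<and> card (d x) = n"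
  shows "\<exists>Z R. Z \<subseteq> A \<and> uncountable Z \<and> (\<forall>x\<in>Z. \<forall>y\<in>Z. x \<noteq> y \<longrightarrow> d x \<inter> d y = R)"
  using assms
proof (induction n arbitrary: A d)
  case 0
  have "d x = {}" if "x \<in> A" for x using 0(2)[OF that] card_0_eq by metis
  then show ?case using 0(1) by (intro exI[of _ A] exI[of _ "{}"]) auto
next
  case (Suc n)
  show ?case
  proof (cases "\<exists>a. uncountable {x \<in> A. a \<in> d x}")
    case True
    then obtain a where a: "uncountable {x \<in> A. a \<in> d x}" by blast
    have "\<exists>Z R. Z \<subseteq> {x \<in> A. a \<in> d x} \<and> uncountable Z \<and>
        (\<forall>x\<in>Z. \<forall>y\<in>Z. x \<noteq> y \<longrightarrow> (d x - {a}) \<inter> (d y - {a}) = R)"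
      by (rule Suc.IH[OF a]) (use Suc.prems(2) in auto)
    then obtain Z R where Z: "Z \<subseteq> {x \<in> A. a \<in> d x}" "uncountable Z"
        "\<And>x y. x \<in> Z \<Longrightarrow> y \<in> Z \<Longrightarrow> x \<noteq> y \<Longrightarrow> (d x - {a}) \<inter> (d y - {a}) = R" by metis
    have "d x \<inter> d y = insert a R" if "x \<in> Z" "y \<in> Z" "x \<noteq> y" for x y
      using Z(3)[OF that] Z(1) that by blast
    then show ?thesis using Z(1,2) by (intro exI[of _ Z] exI[of _ "insert a R"]) auto
  next
    case False
    have "\<exists>b. \<forall>y\<in>A. d x \<inter> d y \<noteq> {} \<longrightarrow> y < b" if x: "x \<in> A" for x
    proof -
      have "countable (\<Union>a\<in>d x. {y \<in> A. a \<in> d y})"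
        using False Suc.prems(2)[OF x] by (intro countable_UN) (auto intro: countable_finite)
      then obtain b where "\<And>y. y \<in> (\<Union>a\<in>d x. {y \<in> A. a \<in> d y}) \<Longrightarrow> y < b"
        by (rule countable_bounded_omega1) blast
      then show ?thesis by blast
    qed
    then obtain f where f: "\<And>x y. x \<in> A \<Longrightarrow> y \<in> A \<Longrightarrow> d x \<inter> d y \<noteq> {} \<Longrightarrow> y < f x" by metis
    obtain Z where Z: "Z \<subseteq> A" "uncountable Z" "\<And>x y. x \<in> Z \<Longrightarrow> y \<in> Z \<Longrightarrow> x < y \<Longrightarrow> f x < y"
      using uncountable_thinning[OF Suc.prems(1)] by metis
    have "d x \<inter> d y = {}" if "x \<in> Z" "y \<in> Z" "x < y" for x y
      using f Z(1,3) that by (meson less_asym subsetD)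
    then have "d x \<inter> d y = {}" if "x \<in> Z" "y \<in> Z" "x \<noteq> y" for x y
      using that by (metis inf_commute linorder_neqE)
    then show ?thesis using Z by blast
  qed
qed

lemma delta_system:
  fixes d :: "omega1 \<Rightarrow> 'a set"
  assumes A: "uncountable A" and d: "\<And>x. x \<in> A \<Longrightarrow> finite (d x)"
  obtains Z R where "Z \<subseteq> A" "uncountable Z" "\<And>x y. x \<in> Z \<Longrightarrow> y \<in> Z \<Longrightarrow> x \<noteq> y \<Longrightarrow> d x \<inter> d y = R"
proof -
  have "\<exists>n. uncountable {x \<in> A. card (d x) = n}"
  proof (rule ccontr)
    assume "\<not> ?thesis"
    then have "countable (\<Union>n. {x \<in> A. card (d x) = n})" by (intro countable_UN) auto
    moreover have "(\<Union>n. {x \<in> A. card (d x) = n}) = A" by auto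
    ultimately show False using A by simp
  qed
  then obtain n where n: "uncountable {x \<in> A. card (d x) = n}" by blast
  have "\<exists>Z R. Z \<subseteq> {x \<in> A. card (d x) = n} \<and> uncountable Z \<and> (\<forall>x\<in>Z. \<forall>y\<in>Z. x \<noteq> y \<longrightarrow> d x \<inter> d y = R)"
    by (rule delta_system_card[OF n]) (use d in auto)
  then show thesis using that by (metis (no_types, lifting) mem_Collect_eq subset_eq)
qed

section \<open>Chain conditions from precaliber and from broken homogeneity\<close>

lemma breaks_homogeneous_imp_ccc:
  assumes "breaks_homogeneous \<pi> P"
  shows "ccc P"
  unfolding ccc_def
proof (intro allI impI)
  fix A assume A: "A \<subseteq> Field P" "uncountable A"
  obtain e :: "omega1 \<Rightarrow> 'a" where e: "inj e" "\<And>\<xi>. e \<xi> \<in> A"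
    using uncountable_omega1_embedding[OF A(2)] by metis
  have "range e \<subseteq> Field P" using e(2) A(1) by blast
  then obtain x y where "x < y" "compatible P (e x) (e y)"
    using assms[unfolded breaks_homogeneous_def, rule_format, OF _ conjI[OF uncountable_omega1]]
    by (metis zero_less_numeral)
  then show "\<exists>p\<in>A. \<exists>q\<in>A. p \<noteq> q \<and> compatible P p q"
    using e by (metis injD less_irrefl)
qed

lemma precaliber_omega1_imp_ccc:
  assumes "precaliber_omega1 P"
  shows "ccc P"
  unfolding ccc_def
proof (intro allI impI)
  fix A assume A: "A \<subseteq> Field P" "uncountable A"
  obtain e :: "omega1 \<Rightarrow> 'a" where e: "inj e" "\<And>\<xi>. e \<xi> \<in> A"
    using uncountable_omega1_embedding[OF A(2)] by metis
  have "range e \<subseteq> Field P" using e(2) A(1) by blast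
  then obtain Z where Z: "uncountable Z" "\<And>F. F \<subseteq> Z \<Longrightarrow> finite F \<Longrightarrow> F \<noteq> {} \<Longrightarrow> \<exists>s. \<forall>x\<in>F. (s, e x) \<in> P"
    using assms[unfolded precaliber_omega1_def, rule_format, OF conjI[OF uncountable_omega1]] by metis
  obtain x where "x \<in> Z" using Z(1) by (metis all_not_in_conv countable_empty)
  moreover obtain y where y: "y \<in> Z" "x < y"
    using uncountable_unbounded_omega1[OF Z(1), of "{x}"] by auto
  ultimately have "compatible P (e x) (e y)"
    using Z(2)[of "{x, y}"] by (auto simp: compatible_def)
  then show "\<exists>p\<in>A. \<exists>q\<in>A. p \<noteq> q \<and> compatible P p q"
    using e y(2) by (metis injD less_irrefl)
qed

lemma Field_poset_power:
  assumes "ps \<in> Field (poset_power P n)"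
  shows "length ps = n" "i < n \<Longrightarrow> ps ! i \<in> Field P"
  using assms unfolding Field_def poset_power_def by (auto simp: list_all2_conv_all_nth)

text \<open>Thin out the family once per coordinate. Centeredness survives passing to smaller index
  sets, so in the end any two indices are compatible in every coordinate.\<close>

lemma precaliber_omega1_imp_powerfully_ccc:
  assumes "precaliber_omega1 P"
  shows "powerfully_ccc P"
  unfolding powerfully_ccc_def ccc_def
proof (intro allI impI)
  fix n A assume A: "A \<subseteq> Field (poset_power P n)" "uncountable A"
  obtain e :: "omega1 \<Rightarrow> 'a list" where e: "inj e" "\<And>\<xi>. e \<xi> \<in> A"
    using uncountable_omega1_embedding[OF A(2)] by metis
  have eF: "e \<xi> \<in> Field (poset_power P n)" for \<xi> using e A by blast
  have "\<exists>Z. uncountable Z \<and> (\<forall>i<k. \<forall>F\<subseteq>Z. finite F \<and> F \<noteq> {} \<longrightarrow> (\<exists>s. \<forall>x\<in>F. (s, e x ! i) \<in> P))"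
    if "k \<le> n" for k
    using that
  proof (induction k)
    case 0
    then show ?case using uncountable_omega1 by auto
  next
    case (Suc k)
    then obtain Y where Y: "uncountable Y" "\<forall>i<k. \<forall>F\<subseteq>Y. finite F \<and> F \<noteq> {} \<longrightarrow> (\<exists>s. \<forall>x\<in>F. (s, e x ! i) \<in> P)"
      by auto
    have "(\<lambda>x. e x ! k) ` Y \<subseteq> Field P" using Field_poset_power(2)[OF eF] Suc.prems by auto
    then obtain Z where Z: "Z \<subseteq> Y" "uncountable Z" "\<forall>F\<subseteq>Z. finite F \<and> F \<noteq> {} \<longrightarrow> (\<exists>s. \<forall>x\<in>F. (s, e x ! k) \<in> P)"
      using assms[unfolded precaliber_omega1_def, rule_format, OF conjI[OF Y(1)]] by metis
    show ?case
      using Y(2) Z by (intro exI[of _ Z]) (auto simp: less_Suc_eq dest: subset_trans)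
  qed
  then obtain Z where Z: "uncountable Z" "\<And>i F. i < n \<Longrightarrow> F \<subseteq> Z \<Longrightarrow> finite F \<Longrightarrow> F \<noteq> {} \<Longrightarrow> \<exists>s. \<forall>x\<in>F. (s, e x ! i) \<in> P"
    by (metis order_refl)
  obtain x where x: "x \<in> Z" using Z(1) by (metis all_not_in_conv countable_empty)
  obtain y where y: "y \<in> Z" "x < y"
    using uncountable_unbounded_omega1[OF Z(1), of "{x}"] by auto
  have "\<forall>i<n. \<exists>s. (s, e x ! i) \<in> P \<and> (s, e y ! i) \<in> P"
    using Z(2)[of _ "{x, y}"] x y by auto
  then obtain s where s: "\<And>i. i < n \<Longrightarrow> (s i, e x ! i) \<in> P \<and> (s i, e y ! i) \<in> P" by metis
  have "compatible (poset_power P n) (e x) (e y)"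
    unfolding compatible_def poset_power_def
    using s Field_poset_power(1)[OF eF]
    by (intro exI[of _ "map s [0..<n]"]) (auto simp: list_all2_conv_all_nth)
  then show "\<exists>p\<in>A. \<exists>q\<in>A. p \<noteq> q \<and> compatible (poset_power P n) p q"
    using e y(2) by (metis injD less_irrefl)
qed

section \<open>Cones of a poset and the application of Martin's axiom\<close>

definition below :: "'a rel \<Rightarrow> 'a \<Rightarrow> 'a rel" where
  "below P r = {(p, q) \<in> P. (q, r) \<in> P}"

context
  fixes P :: "'a rel"
  assumes P: "Preorder P"
begin

lemma Preorder_refl: "p \<in> Field P \<Longrightarrow> (p, p) \<in> P"
  using P by (auto simp: preorder_on_def refl_on_def)

lemma Preorder_trans: "(p, q) \<in> P \<Longrightarrow> (q, r) \<in> P \<Longrightarrow> (p, r) \<in> P"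
  using P by (auto simp: preorder_on_def dest: transD)

lemma Field_below: "Field (below P r) = {p. (p, r) \<in> P}"
proof (intro equalityI subsetI)
  fix p assume "p \<in> {p. (p, r) \<in> P}"
  then have "(p, p) \<in> below P r" using Preorder_refl by (auto simp: below_def Field_def)
  then show "p \<in> Field (below P r)" by (auto simp: Field_def)
qed (auto simp: below_def Field_def intro: Preorder_trans)

lemma Preorder_below: "Preorder (below P r)"
  unfolding preorder_on_def refl_on_def Field_below trans_def
  using Preorder_trans Preorder_refl[OF FieldI1] by (auto simp: below_def)

lemma compatible_below:
  "p \<in> Field (below P r) \<Longrightarrow> q \<in> Field (below P r) \<Longrightarrow> compatible P p q \<Longrightarrow> compatible (below P r) p q"
  unfolding Field_below compatible_def by (auto simp: below_def)

text \<open>A common extension of two conditions below \<open>r\<close> is itself below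
  \<open>r\<close>, so compatibility in the cone is the same as in \<open>P\<close>.\<close>

lemma breaks_homogeneous_below:
  assumes br: "breaks_homogeneous \<pi> P"
  shows "breaks_homogeneous \<pi> (below P r)"
  unfolding breaks_homogeneous_def
proof (intro allI impI, elim conjE)
  fix A :: "omega1 set" and s and l :: nat
  assume l: "l < 2" and A: "uncountable A" "s ` A \<subseteq> Field (below P r)"
  then have "s ` A \<subseteq> Field P" by (auto simp: below_def Field_def)
  then obtain x y where "x \<in> A" "y \<in> A" "x < y" "\<pi> {x, y} = l" "compatible P (s x) (s y)"
    using br[unfolded breaks_homogeneous_def, rule_format, OF l conjI[OF A(1)]] by metis
  then show "\<exists>x\<in>A. \<exists>y\<in>A. x < y \<and> \<pi> {x, y} = l \<and> compatible (below P r) (s x) (s y)"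
    using compatible_below A(2) by blast
qed

text \<open>Martin's axiom is applied below a condition which forces uncountably many members of the given
  family into the generic filter.\<close>

lemma precaliber_omega1I:
  assumes large: "(UNIV :: nat set set) \<lesssim> (UNIV :: 'i set)"
    and not_CH: "\<not> CH"
    and MA: "\<And>T :: 'a rel. forcing_poset T \<Longrightarrow> ccc T \<Longrightarrow> forces_no_homogeneous T TYPE('i) \<pi> \<Longrightarrow> MA {T}"
    and br: "breaks_homogeneous \<pi> P"
  shows "precaliber_omega1 P"
  unfolding precaliber_omega1_def
proof (intro allI impI, elim conjE)
  fix A :: "omega1 set" and r0
  assume A: "uncountable A" "r0 ` A \<subseteq> Field P"
  \<comment> \<open>Reindexes the family by all of \<open>omega1\<close>; the subset found at the
    end is carried back into \<open>A\<close> by \<open>e\<close>.\<close>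
  obtain e :: "omega1 \<Rightarrow> omega1" where e: "inj e" "\<And>\<xi>. e \<xi> \<in> A"
    using uncountable_omega1_embedding[OF A(1)] by metis
  define r where "r \<xi> = r0 (e \<xi>)" for \<xi>
  have rF: "r \<xi> \<in> Field P" for \<xi> using A(2) e(2) by (auto simp: r_def)
  have ccc: "ccc P" using breaks_homogeneous_imp_ccc[OF br] .
  obtain \<xi>0 where \<xi>0: "\<And>s. (s, r \<xi>0) \<in> P \<Longrightarrow> uncountable {\<eta>. compatible P s (r \<eta>)}"
    using ccc_uncountably_compatible[where r = r, OF P ccc rF] by metis
  define T where "T = below P (r \<xi>0)"
  have T: "Preorder T" unfolding T_def by (rule Preorder_below)
  have FT: "Field T = {p. (p, r \<xi>0) \<in> P}" unfolding T_def by (rule Field_below)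
  have br_T: "breaks_homogeneous \<pi> T" unfolding T_def by (rule breaks_homogeneous_below[OF br])
  interpret T: forcing T "TYPE('i)" using T large by unfold_locales
  have "forcing_poset T" unfolding forcing_poset_def using T FT Preorder_refl[OF rF] by blast
  then have "MA {T}"
    using MA breaks_homogeneous_imp_ccc[OF br_T] T.forces_no_homogeneousI[OF br_T] by blast
  \<comment> \<open>In \<open>MA\<close> the dense sets are indexed by sets of natural numbers, so
    \<open>omega1\<close> is copied there. The failure of CH makes the copy strictly smaller than
    the continuum.\<close>
  obtain g :: "omega1 \<Rightarrow> nat set" where g: "inj g" using omega1_lepoll unfolding lepoll_def by blast
  have "range g \<prec> (UNIV :: nat set set)"
    unfolding lesspoll_def
  proof
    show "range g \<lesssim> (UNIV :: nat set set)" by (rule subset_imp_lepoll) simp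
    show "\<not> range g \<approx> (UNIV :: nat set set)"
    proof
      assume "range g \<approx> (UNIV :: nat set set)"
      moreover have "range g \<approx> (UNIV :: omega1 set)"
        using g by (rule inj_on_image_eqpoll_self)
      ultimately have CH unfolding CH_def using eqpoll_sym eqpoll_trans by blast
      then show False using not_CH by blast
    qed
  qed
  then have "MA_at (range g) {T}" using \<open>MA {T}\<close> unfolding MA_def by blast
  \<comment> \<open>A filter meeting the set with label \<open>g b\<close> contains a condition
    below some \<open>r \<eta>\<close> with \<open>\<eta>\<close> at least \<open>b\<close>. Meeting
    all of them makes the set of such indices unbounded, hence uncountable.\<close>
  moreover define D where "D a = {s \<in> Field T. \<exists>\<eta>\<ge>inv g a. (s, r \<eta>) \<in> P}" for a
  moreover have "dense_in (D a) T" for a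
    unfolding dense_in_def
  proof (intro conjI ballI)
    show "D a \<subseteq> Field T" by (auto simp: D_def)
    fix p assume "p \<in> Field T"
    then have p: "(p, r \<xi>0) \<in> P" by (simp add: FT)
    \<comment> \<open>Density is where the cone is needed: \<open>p\<close> lies below
      \<open>r \<xi>0\<close>, so it is compatible with uncountably many members and in particular
      with a late one.\<close>
    obtain \<eta> where \<eta>: "compatible P p (r \<eta>)" "inv g a < \<eta>"
      by (rule uncountable_unbounded_omega1[OF \<xi>0[OF p], of "{inv g a}"]) auto
    then obtain s where s: "(s, p) \<in> P" "(s, r \<eta>) \<in> P" by (auto simp: compatible_def)
    have "s \<in> D a" using s p \<eta>(2) Preorder_trans by (auto simp: D_def FT intro: less_imp_le)
    moreover have "(s, p) \<in> T" using s p by (simp add: T_def below_def)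
    ultimately show "\<exists>d\<in>D a. (d, p) \<in> T" by blast
  qed
  ultimately obtain G where G: "filter_on G T" "\<And>a. a \<in> range g \<Longrightarrow> G \<inter> D a \<noteq> {}"
    unfolding MA_at_def by (metis singletonI)
  define Y where "Y = {\<eta>. \<exists>s\<in>G. (s, r \<eta>) \<in> P}"
  have "uncountable Y"
  proof
    assume "countable Y"
    then obtain b where b: "\<And>\<eta>. \<eta> \<in> Y \<Longrightarrow> \<eta> < b" by (rule countable_bounded_omega1) blast
    obtain s \<eta> where "s \<in> G" "b \<le> \<eta>" "(s, r \<eta>) \<in> P"
      using G(2)[of "g b"] g by (auto simp: D_def)
    then show False using b by (force simp: Y_def)
  qed
  \<comment> \<open>Directedness of the filter combines the witnesses of finitely many indices into
    one.\<close>
  have centered: "\<exists>s\<in>G. \<forall>\<eta>\<in>F. (s, r \<eta>) \<in> P" if "finite F" "F \<subseteq> Y" for F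
    using that
  proof (induction F)
    case empty
    then show ?case using G(1) by (auto simp: filter_on_def)
  next
    case (insert \<eta> F)
    then obtain s t where st: "s \<in> G" "\<forall>\<eta>\<in>F. (s, r \<eta>) \<in> P" "t \<in> G" "(t, r \<eta>) \<in> P"
      by (auto simp: Y_def)
    then obtain u where u: "u \<in> G" "(u, s) \<in> T" "(u, t) \<in> T" using G(1) unfolding filter_on_def by blast
    then have "(u, s) \<in> P" "(u, t) \<in> P" by (simp_all add: T_def below_def)
    then have "(u, r \<zeta>) \<in> P" if "\<zeta> \<in> insert \<eta> F" for \<zeta>
      using that st(2,4) Preorder_trans by (metis insert_iff)
    then show ?case using u(1) by blast
  qed
  have "\<exists>s. \<forall>x\<in>F. (s, r0 x) \<in> P" if F: "F \<subseteq> e ` Y" "finite F" for F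
  proof -
    obtain F' where F': "F' \<subseteq> Y" "finite F'" "F = e ` F'" using F by (meson finite_subset_image)
    then obtain s where "\<forall>\<eta>\<in>F'. (s, r \<eta>) \<in> P" using centered by blast
    then show ?thesis using F'(3) by (auto simp: r_def)
  qed
  moreover have "e ` Y \<subseteq> A" "uncountable (e ` Y)"
    using e uncountable_image_inj[OF inj_on_subset[OF e(1)] \<open>uncountable Y\<close>] by auto
  ultimately show "\<exists>Z\<subseteq>A. uncountable Z \<and> (\<forall>F\<subseteq>Z. finite F \<and> F \<noteq> {} \<longrightarrow> (\<exists>s. \<forall>x\<in>F. (s, r0 x) \<in> P))"
    by blast
qed

end

section \<open>Finite support iterations\<close>

lemma lessThan_Int_lessThan [simp]:
  "\<beta> \<le> \<gamma> \<Longrightarrow> {..<\<gamma>} \<inter> {..<\<beta>} = {..<\<beta>}" for \<beta> \<gamma> :: "'o::linorder"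
  by auto

lemma restrict_lessThan_id: "dom p \<subseteq> {..<\<alpha>} \<Longrightarrow> p |` {..<\<alpha>} = p" for \<alpha> :: "'o::linorder"
  by (rule ext) (metis domIff restrict_map_def subsetD)

locale finite_support_iteration =
  fixes \<nu> :: "'o::wellorder" and P :: "'o \<Rightarrow> ('o, 'i) cond rel" and Q L :: "'o \<Rightarrow> ('o, 'i) iname"
  assumes iteration: "fs_iteration \<nu> P Q L"
    and large: "(UNIV :: nat set set) \<lesssim> (UNIV :: 'i set)"
begin

abbreviation conditions where "conditions \<equiv> fs_conditions P Q"

abbreviation coord :: "'o \<Rightarrow> ('o, 'i) cond \<Rightarrow> ('o, 'i) iname" where
  "coord \<beta> p \<equiv> name_at (Q \<beta>) (the (p \<beta>))"

section \<open>Conditions, restrictions and the order of the stages\<close>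

lemma le_iff:
  "\<alpha> \<le> \<nu> \<Longrightarrow> (p, q) \<in> P \<alpha> \<longleftrightarrow> p \<in> conditions \<alpha> \<and> q \<in> conditions \<alpha> \<and>
    (\<forall>\<beta>\<in>dom q. \<beta> \<in> dom p \<and> fRel (L \<beta>) (coord \<beta> p) (coord \<beta> q) (P \<beta>) (p |` {..<\<beta>}))"
proof -
  assume \<alpha>: "\<alpha> \<le> \<nu>"
  have "P \<alpha> = {(p, q). p \<in> fs_conditions P Q \<alpha> \<and> q \<in> fs_conditions P Q \<alpha> \<and>
        (\<forall>\<beta>\<in>dom q. \<beta> \<in> dom p \<and>
           fRel (L \<beta>) (name_at (Q \<beta>) (the (p \<beta>))) (name_at (Q \<beta>) (the (q \<beta>)))
             (P \<beta>) (p |` {..<\<beta>}))}"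
    by (rule iteration[unfolded fs_iteration_def, THEN conjunct1, rule_format, OF \<alpha>])
  then show ?thesis by simp
qed

lemma iterand:
  assumes "\<beta> < \<nu>"
  shows "is_name (P \<beta>) (Q \<beta>)" "is_name (P \<beta>) (L \<beta>)" "forces (P \<beta>) (fPoset (Q \<beta>) (L \<beta>))"
  using iteration[unfolded fs_iteration_def, THEN conjunct2, rule_format, OF assms] by blast+

lemma conditionsD:
  assumes "p \<in> conditions \<alpha>"
  shows "finite (dom p)" "dom p \<subseteq> {..<\<alpha>}"
    "\<beta> \<in> dom p \<Longrightarrow> p |` {..<\<beta>} \<in> Field (P \<beta>)" "\<beta> \<in> dom p \<Longrightarrow> the (p \<beta>) \<in> name_dom (Q \<beta>)"
    "\<beta> \<in> dom p \<Longrightarrow> (coord \<beta> p \<^bold>\<in> Q \<beta>) (P \<beta>) (p |` {..<\<beta>})"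
  using assms unfolding fs_conditions_def by auto

lemma conditionsI:
  assumes "finite (dom p)" "dom p \<subseteq> {..<\<alpha>}"
    "\<And>\<beta>. \<beta> \<in> dom p \<Longrightarrow> p |` {..<\<beta>} \<in> Field (P \<beta>) \<and> the (p \<beta>) \<in> name_dom (Q \<beta>) \<and>
      (coord \<beta> p \<^bold>\<in> Q \<beta>) (P \<beta>) (p |` {..<\<beta>})"
  shows "p \<in> conditions \<alpha>"
  using assms unfolding fs_conditions_def by auto

lemma restrict_conditions: "p \<in> conditions \<alpha> \<Longrightarrow> p |` {..<\<gamma>} \<in> conditions \<gamma>"
proof (rule conditionsI)
  fix \<beta> assume p: "p \<in> conditions \<alpha>" and "\<beta> \<in> dom (p |` {..<\<gamma>})"
  then have "\<beta> < \<gamma>" "\<beta> \<in> dom p" by auto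
  then show "(p |` {..<\<gamma>}) |` {..<\<beta>} \<in> Field (P \<beta>) \<and> the ((p |` {..<\<gamma>}) \<beta>) \<in> name_dom (Q \<beta>) \<and>
      (coord \<beta> (p |` {..<\<gamma>}) \<^bold>\<in> Q \<beta>) (P \<beta>) ((p |` {..<\<gamma>}) |` {..<\<beta>})"
    using conditionsD(3-5)[OF p] by simp
qed (auto dest: conditionsD(1))

lemma restrict_le:
  assumes "\<alpha> \<le> \<nu>" "\<gamma> \<le> \<nu>" "(p, q) \<in> P \<alpha>"
  shows "(p |` {..<\<gamma>}, q |` {..<\<gamma>}) \<in> P \<gamma>"
  unfolding le_iff[OF assms(2)]
proof (intro conjI ballI)
  have pq: "p \<in> conditions \<alpha>" "q \<in> conditions \<alpha>" using assms(3) by (simp_all add: le_iff[OF assms(1)])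
  then show "p |` {..<\<gamma>} \<in> conditions \<gamma>" "q |` {..<\<gamma>} \<in> conditions \<gamma>"
    using restrict_conditions by metis+
  fix \<beta> assume "\<beta> \<in> dom (q |` {..<\<gamma>})"
  then have \<beta>: "\<beta> < \<gamma>" "\<beta> \<in> dom q" by auto
  then have "\<beta> \<in> dom p" "fRel (L \<beta>) (coord \<beta> p) (coord \<beta> q) (P \<beta>) (p |` {..<\<beta>})"
    using assms(3) unfolding le_iff[OF assms(1)] by blast+
  then show "\<beta> \<in> dom (p |` {..<\<gamma>})"
    "fRel (L \<beta>) (coord \<beta> (p |` {..<\<gamma>})) (coord \<beta> (q |` {..<\<gamma>})) (P \<beta>) ((p |` {..<\<gamma>}) |` {..<\<beta>})"
    using \<beta>(1) by simp_all
qed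

text \<open>Reflexivity and transitivity at \<alpha> use forced statements at stages below \<alpha>,
  whose calculus presupposes that those stages are preorders. That every condition occurs in the
  field in turn rests on reflexivity, so both claims are proved in one induction.\<close>

lemma stage: "\<alpha> \<le> \<nu> \<Longrightarrow> Field (P \<alpha>) = conditions \<alpha> \<and> Preorder (P \<alpha>)"
proof (induction \<alpha> rule: less_induct)
  case (less \<alpha>)
  have F: "forcing TYPE('i) (P \<beta>)" if "\<beta> < \<alpha>" for \<beta>
    by (rule forcing.intro[OF conjunct2[OF less.IH[OF that]] large]) (use that less.prems in simp)
  have refl: "(p, p) \<in> P \<alpha>" if p: "p \<in> conditions \<alpha>" for p
    unfolding le_iff[OF less.prems]
  proof (intro conjI ballI p)
    fix \<beta> assume \<beta>: "\<beta> \<in> dom p"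
    then have lt: "\<beta> < \<alpha>" "\<beta> < \<nu>" using conditionsD(2)[OF p] less.prems by auto
    interpret F: forcing "P \<beta>" "TYPE('i)" by (rule F[OF lt(1)])
    note c = conditionsD(3-5)[OF p \<beta>]
    have "fPoset (Q \<beta>) (L \<beta>) (P \<beta>) (p |` {..<\<beta>})"
      using iterand(3)[OF lt(2)] c(1) by (simp add: forces_def)
    then show "fRel (L \<beta>) (coord \<beta> p) (coord \<beta> p) (P \<beta>) (p |` {..<\<beta>})"
      by (rule F.Poset_refl[OF _ F.le_refl[OF c(1)] F.is_name_name_at[OF iterand(1)[OF lt(2)] c(2)] c(3)])
  qed
  have Field: "Field (P \<alpha>) = conditions \<alpha>"
  proof (intro equalityI subsetI)
    fix p assume "p \<in> conditions \<alpha>"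
    then show "p \<in> Field (P \<alpha>)" using refl FieldI1 by fast
  qed (auto simp: Field_def le_iff[OF less.prems])
  have trans: "(p, r) \<in> P \<alpha>" if pq: "(p, q) \<in> P \<alpha>" and qr: "(q, r) \<in> P \<alpha>" for p q r
  proof -
    have C: "p \<in> conditions \<alpha>" "q \<in> conditions \<alpha>" "r \<in> conditions \<alpha>"
      using pq qr by (auto simp: le_iff[OF less.prems])
    have "\<beta> \<in> dom p \<and> fRel (L \<beta>) (coord \<beta> p) (coord \<beta> r) (P \<beta>) (p |` {..<\<beta>})" if \<beta>: "\<beta> \<in> dom r" for \<beta>
    proof -
      have lt: "\<beta> < \<alpha>" "\<beta> < \<nu>" using conditionsD(2)[OF C(3)] \<beta> less.prems by auto
      interpret F: forcing "P \<beta>" "TYPE('i)" by (rule F[OF lt(1)])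
      have q: "\<beta> \<in> dom q" "fRel (L \<beta>) (coord \<beta> q) (coord \<beta> r) (P \<beta>) (q |` {..<\<beta>})"
        using qr \<beta> by (auto simp: le_iff[OF less.prems])
      have p: "\<beta> \<in> dom p" "fRel (L \<beta>) (coord \<beta> p) (coord \<beta> q) (P \<beta>) (p |` {..<\<beta>})"
        using pq q(1) by (auto simp: le_iff[OF less.prems])
      \<comment> \<open>The relation between \<open>q\<close> and \<open>r\<close> at
        \<open>\<beta>\<close> is forced by a restriction of \<open>q\<close>. It has to be brought
        down to the restriction of \<open>p\<close> before transitivity of the iterand
        applies.\<close>
      have le: "(p |` {..<\<beta>}, q |` {..<\<beta>}) \<in> P \<beta>"
        using restrict_le[OF less.prems less_imp_le[OF lt(2)] pq] .
      have nm: "is_name (P \<beta>) (coord \<beta> s)" if "s \<in> conditions \<alpha>" "\<beta> \<in> dom s" for s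
        using F.is_name_name_at[OF iterand(1)[OF lt(2)] conditionsD(4)[OF that]] .
      have "fPoset (Q \<beta>) (L \<beta>) (P \<beta>) (p |` {..<\<beta>})"
        using iterand(3)[OF lt(2)] conditionsD(3)[OF C(1) p(1)] by (simp add: forces_def)
      then have "fRel (L \<beta>) (coord \<beta> p) (coord \<beta> r) (P \<beta>) (p |` {..<\<beta>})"
        by (rule F.Poset_trans[OF _ F.le_refl'[OF le] nm[OF C(1) p(1)] nm[OF C(2) q(1)] nm[OF C(3) \<beta>] p(2)
              F.stable_mono[OF F.stable_Rel q(2) le]])
      then show ?thesis using p(1) by blast
    qed
    then show ?thesis using C by (simp add: le_iff[OF less.prems])
  qed
  have "Preorder (P \<alpha>)"
    unfolding preorder_on_def
  proof (intro conjI)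
    show "P \<alpha> \<subseteq> Field (P \<alpha>) \<times> Field (P \<alpha>)" by (auto simp: Field_def)
    show "refl_on (Field (P \<alpha>)) (P \<alpha>)" using refl by (auto simp: refl_on_def Field)
    show "trans (P \<alpha>)" using trans by (rule transI)
  qed
  with Field show ?case by blast
qed

lemmas Field_stage = stage[THEN conjunct1] and Preorder_stage = stage[THEN conjunct2]

lemma forcing_stage: "\<alpha> \<le> \<nu> \<Longrightarrow> forcing TYPE('i) (P \<alpha>)"
  by (intro forcing.intro Preorder_stage large)

lemma coord_name: "p \<in> conditions \<alpha> \<Longrightarrow> \<alpha> \<le> \<nu> \<Longrightarrow> \<beta> \<in> dom p \<Longrightarrow> is_name (P \<beta>) (coord \<beta> p)"
proof -
  assume *: "p \<in> conditions \<alpha>" "\<alpha> \<le> \<nu>" "\<beta> \<in> dom p"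
  then have lt: "\<beta> < \<nu>" using conditionsD(2) by fastforce
  interpret F: forcing "P \<beta>" "TYPE('i)" by (rule forcing_stage[OF less_imp_le[OF lt]])
  show ?thesis using F.is_name_name_at[OF iterand(1)[OF lt] conditionsD(4)[OF *(1,3)]] .
qed

section \<open>Gluing of conditions and stages without a largest predecessor\<close>

lemma restrict_Field: "p \<in> Field (P \<alpha>) \<Longrightarrow> \<alpha> \<le> \<nu> \<Longrightarrow> \<gamma> \<le> \<nu> \<Longrightarrow> p |` {..<\<gamma>} \<in> Field (P \<gamma>)"
  by (simp add: Field_stage restrict_conditions)

text \<open>From \<delta> on the supports are disjoint, so each coordinate can be copied from the
  one member that has it, while \<open>t\<close> takes care of the part below \<delta>.\<close>

lemma amalgamation:
  assumes \<alpha>: "\<alpha> \<le> \<nu>" and \<delta>: "\<delta> < \<alpha>"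
    and F: "finite F" and r: "\<And>x. x \<in> F \<Longrightarrow> r x \<in> Field (P \<alpha>)"
    and root: "\<And>x y. x \<in> F \<Longrightarrow> y \<in> F \<Longrightarrow> x \<noteq> y \<Longrightarrow> dom (r x) \<inter> dom (r y) \<subseteq> {..<\<delta>}"
    and t: "t \<in> Field (P \<delta>)" "\<And>x. x \<in> F \<Longrightarrow> (t, r x |` {..<\<delta>}) \<in> P \<delta>"
  shows "\<exists>s. \<forall>x\<in>F. (s, r x) \<in> P \<alpha>"
proof -
  have \<delta>\<nu>: "\<delta> \<le> \<nu>" using \<alpha> \<delta> by simp
  have rC: "r x \<in> conditions \<alpha>" if "x \<in> F" for x using r[OF that] Field_stage[OF \<alpha>] by simp
  have tC: "t \<in> conditions \<delta>" using t(1) Field_stage[OF \<delta>\<nu>] by simp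
  define s where "s \<gamma> = (if \<gamma> < \<delta> then t \<gamma> else
      if \<exists>x\<in>F. \<gamma> \<in> dom (r x) then r (SOME x. x \<in> F \<and> \<gamma> \<in> dom (r x)) \<gamma> else None)" for \<gamma>
  have s_r: "s \<gamma> = r x \<gamma>" if "x \<in> F" "\<gamma> \<in> dom (r x)" "\<delta> \<le> \<gamma>" for x \<gamma>
  proof -
    define y where "y = (SOME x. x \<in> F \<and> \<gamma> \<in> dom (r x))"
    have y: "y \<in> F \<and> \<gamma> \<in> dom (r y)" unfolding y_def by (rule someI[of _ x]) (use that in blast)
    have "y = x"
    proof (rule ccontr)
      assume "y \<noteq> x"
      then have "\<gamma> \<in> {..<\<delta>}" using root y that by blast
      then show False using that by simp
    qed
    moreover have "s \<gamma> = r y \<gamma>" unfolding s_def y_def using that by auto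
    ultimately show ?thesis by simp
  qed
  have s_t: "s \<gamma> = t \<gamma>" if "\<gamma> < \<delta>" for \<gamma> using that by (simp add: s_def)
  have s_dom: "\<gamma> \<in> dom t \<and> \<gamma> < \<delta> \<or> (\<exists>x\<in>F. \<gamma> \<in> dom (r x) \<and> \<delta> \<le> \<gamma>)" if "\<gamma> \<in> dom s" for \<gamma>
    using that by (auto simp: s_def split: if_splits)
  have s_restrict: "s |` {..<\<gamma>} = t |` {..<\<gamma>}" if "\<gamma> \<le> \<delta>" for \<gamma>
    using that s_t by (auto simp: restrict_map_def fun_eq_iff)
  have "dom s \<subseteq> dom t \<union> (\<Union>x\<in>F. dom (r x))" using s_dom by blast
  moreover have "finite (dom t \<union> (\<Union>x\<in>F. dom (r x)))" using F conditionsD(1)[OF tC] conditionsD(1)[OF rC] by simp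
  ultimately have fin: "finite (dom s)" using finite_subset by blast
  \<comment> \<open>Both assertions must be proved together: a coordinate copied from
    \<open>r x\<close> is forced into the iterand only by the restriction of \<open>r x\<close>, and
    it is the earlier instance of the second assertion that makes \<open>s\<close> force it
    too.\<close>
  have main: "s |` {..<\<gamma>} \<in> conditions \<gamma> \<and> (\<forall>x\<in>F. (s |` {..<\<gamma>}, r x |` {..<\<gamma>}) \<in> P \<gamma>)" if "\<gamma> \<le> \<alpha>" for \<gamma>
    using that
  proof (induction \<gamma> rule: less_induct)
    case (less \<gamma>)
    have \<gamma>\<nu>: "\<gamma> \<le> \<nu>" using less.prems \<alpha> by simp
    have upper: "s |` {..<\<beta>} \<in> Field (P \<beta>) \<and> the (s \<beta>) \<in> name_dom (Q \<beta>) \<and> (coord \<beta> s \<^bold>\<in> Q \<beta>) (P \<beta>) (s |` {..<\<beta>})"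
      if \<beta>: "\<beta> < \<gamma>" "\<delta> \<le> \<beta>" and x: "x \<in> F" "\<beta> \<in> dom (r x)" for \<beta> x
    proof -
      have \<beta>\<nu>: "\<beta> \<le> \<nu>" using \<beta>(1) \<gamma>\<nu> by simp
      interpret F: forcing "P \<beta>" "TYPE('i)" by (rule forcing_stage[OF \<beta>\<nu>])
      have IH: "s |` {..<\<beta>} \<in> conditions \<beta>" "(s |` {..<\<beta>}, r x |` {..<\<beta>}) \<in> P \<beta>"
        using less.IH[OF \<beta>(1)] \<beta>(1) less.prems x(1) by auto
      have "(coord \<beta> (r x) \<^bold>\<in> Q \<beta>) (P \<beta>) (s |` {..<\<beta>})"
        by (rule F.mem_mono[OF conditionsD(5)[OF rC[OF x(1)] x(2)] IH(2)])
      then show ?thesis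
        using IH(1) Field_stage[OF \<beta>\<nu>] s_r[OF x \<beta>(2)] conditionsD(4)[OF rC[OF x(1)] x(2)] by simp
    qed
    have C: "s |` {..<\<gamma>} \<in> conditions \<gamma>"
    proof (rule conditionsI)
      fix \<beta> assume "\<beta> \<in> dom (s |` {..<\<gamma>})"
      then have \<beta>: "\<beta> < \<gamma>" "\<beta> \<in> dom s" by auto
      have "s |` {..<\<beta>} \<in> Field (P \<beta>) \<and> the (s \<beta>) \<in> name_dom (Q \<beta>) \<and> (coord \<beta> s \<^bold>\<in> Q \<beta>) (P \<beta>) (s |` {..<\<beta>})"
        using s_dom[OF \<beta>(2)]
      proof (elim disjE conjE bexE)
        assume "\<beta> \<in> dom t" "\<beta> < \<delta>"
        then show ?thesis using conditionsD(3-5)[OF tC, of \<beta>] s_t[of \<beta>] s_restrict[of \<beta>] by simp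
      next
        fix x assume "x \<in> F" "\<beta> \<in> dom (r x)" "\<delta> \<le> \<beta>"
        then show ?thesis using upper \<beta>(1) by blast
      qed
      then show "(s |` {..<\<gamma>}) |` {..<\<beta>} \<in> Field (P \<beta>) \<and> the ((s |` {..<\<gamma>}) \<beta>) \<in> name_dom (Q \<beta>) \<and>
          (coord \<beta> (s |` {..<\<gamma>}) \<^bold>\<in> Q \<beta>) (P \<beta>) ((s |` {..<\<gamma>}) |` {..<\<beta>})"
        using \<beta>(1) by simp
    qed (use fin in auto)
    moreover have "(s |` {..<\<gamma>}, r x |` {..<\<gamma>}) \<in> P \<gamma>" if x: "x \<in> F" for x
      unfolding le_iff[OF \<gamma>\<nu>]
    proof (intro conjI ballI C restrict_conditions[OF rC[OF x]])
      fix \<beta> assume "\<beta> \<in> dom (r x |` {..<\<gamma>})"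
      then have \<beta>: "\<beta> < \<gamma>" "\<beta> \<in> dom (r x)" by auto
      have \<beta>\<nu>: "\<beta> < \<nu>" using \<beta>(1) \<gamma>\<nu> by simp
      have "\<beta> \<in> dom s \<and> fRel (L \<beta>) (coord \<beta> s) (coord \<beta> (r x)) (P \<beta>) (s |` {..<\<beta>})"
      proof (cases "\<beta> < \<delta>")
        case True
        then have "\<beta> \<in> dom (r x |` {..<\<delta>})" using \<beta> by simp
        then have "\<beta> \<in> dom t \<and> fRel (L \<beta>) (coord \<beta> t) (coord \<beta> (r x |` {..<\<delta>})) (P \<beta>) (t |` {..<\<beta>})"
          using t(2)[OF x] unfolding le_iff[OF \<delta>\<nu>] by blast
        then show ?thesis using True s_t[OF True] s_restrict[of \<beta>] by (simp add: dom_def)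
      next
        case False
        then have le: "\<delta> \<le> \<beta>" by simp
        note up = upper[OF \<beta>(1) le x \<beta>(2)] and sr = s_r[OF x \<beta>(2) le]
        interpret F: forcing "P \<beta>" "TYPE('i)" by (rule forcing_stage[OF less_imp_le[OF \<beta>\<nu>]])
        have po: "fPoset (Q \<beta>) (L \<beta>) (P \<beta>) (s |` {..<\<beta>})"
          using iterand(3)[OF \<beta>\<nu>] up by (simp add: forces_def)
        have nm: "is_name (P \<beta>) (coord \<beta> (r x))" by (rule coord_name[OF rC[OF x] \<alpha> \<beta>(2)])
        have "fRel (L \<beta>) (coord \<beta> (r x)) (coord \<beta> (r x)) (P \<beta>) (s |` {..<\<beta>})"
          using F.Poset_refl[OF po _ nm] F.le_refl up sr by simp
        then show ?thesis using sr \<beta>(2) by (simp add: dom_def)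
      qed
      then show "\<beta> \<in> dom (s |` {..<\<gamma>})"
        "fRel (L \<beta>) (coord \<beta> (s |` {..<\<gamma>})) (coord \<beta> (r x |` {..<\<gamma>})) (P \<beta>) ((s |` {..<\<gamma>}) |` {..<\<beta>})"
        using \<beta>(1) by auto
    qed
    ultimately show ?case by blast
  qed
  have "dom s \<subseteq> {..<\<alpha>}"
  proof
    fix \<gamma> assume "\<gamma> \<in> dom s"
    from s_dom[OF this] show "\<gamma> \<in> {..<\<alpha>}" using \<delta> conditionsD(2)[OF rC] by fastforce
  qed
  then have "s |` {..<\<alpha>} = s" by (rule restrict_lessThan_id)
  moreover have "r x |` {..<\<alpha>} = r x" if "x \<in> F" for x
    by (rule restrict_lessThan_id[OF conditionsD(2)[OF rC[OF that]]])
  ultimately show ?thesis using main[of \<alpha>] by auto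
qed

text \<open>Supports are finite, so the root of the Delta-system is bounded by some \<delta> below
  \<alpha>. Precaliber at \<delta> makes the restrictions to \<delta> centered, and the remaining
  parts have disjoint supports and can be glued on.\<close>

lemma precaliber_limit:
  assumes \<alpha>: "\<alpha> \<le> \<nu>" and limit: "\<And>\<beta>. \<beta> < \<alpha> \<Longrightarrow> \<exists>\<gamma>. \<beta> < \<gamma> \<and> \<gamma> < \<alpha>"
    and IH: "\<And>\<beta>. \<beta> < \<alpha> \<Longrightarrow> precaliber_omega1 (P \<beta>)"
  shows "precaliber_omega1 (P \<alpha>)"
  unfolding precaliber_omega1_def
proof (intro allI impI, elim conjE)
  fix A :: "omega1 set" and r assume A: "uncountable A" "r ` A \<subseteq> Field (P \<alpha>)"
  then have rC: "r x \<in> conditions \<alpha>" if "x \<in> A" for x using that Field_stage[OF \<alpha>] by auto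
  show "\<exists>Z\<subseteq>A. uncountable Z \<and> (\<forall>F\<subseteq>Z. finite F \<and> F \<noteq> {} \<longrightarrow> (\<exists>s. \<forall>x\<in>F. (s, r x) \<in> P \<alpha>))"
  proof (cases "\<exists>\<beta>. \<beta> < \<alpha>")
    \<comment> \<open>The assumption on \<alpha> also admits the least element. There the empty
      sequence is the only condition.\<close>
    case False
    have "r x = Map.empty" if "x \<in> A" for x
      using conditionsD(2)[OF rC[OF that]] False by auto
    moreover have "(r x, r x) \<in> P \<alpha>" if "x \<in> A" for x
      using rC[OF that] Preorder_stage[OF \<alpha>] Field_stage[OF \<alpha>] by (auto simp: preorder_on_def refl_on_def)
    ultimately show ?thesis using A(1) by (intro exI[of _ A]) (metis subset_iff subset_refl)
  next
    case True
    obtain Z R where Z: "Z \<subseteq> A" "uncountable Z" "\<And>x y. x \<in> Z \<Longrightarrow> y \<in> Z \<Longrightarrow> x \<noteq> y \<Longrightarrow> dom (r x) \<inter> dom (r y) = R"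
      using delta_system[OF A(1), of "\<lambda>x. dom (r x)"] conditionsD(1)[OF rC] by metis
    obtain x where x: "x \<in> Z" using Z(2) by (metis all_not_in_conv countable_empty)
    obtain y where y: "y \<in> Z" "x < y"
      using uncountable_unbounded_omega1[OF Z(2), of "{x}"] by auto
    have R: "R \<subseteq> dom (r x)" using Z(3)[OF x y(1)] y(2) by auto
    have fin: "finite R" "R \<subseteq> {..<\<alpha>}"
      using finite_subset[OF R] subset_trans[OF R] conditionsD(1,2)[OF rC[OF subsetD[OF Z(1) x]]] by blast+
    \<comment> \<open>An empty root has no maximum, and then every stage before \<alpha> serves.
      Otherwise \<delta> is taken above the maximum of the root, since \<delta> itself is excluded
      from \<open>{..<\<delta>}\<close>.\<close>
    obtain \<delta> where \<delta>: "\<delta> < \<alpha>" "R \<subseteq> {..<\<delta>}"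
    proof (cases "R = {}")
      case True
      then show thesis using that \<open>\<exists>\<beta>. \<beta> < \<alpha>\<close> by auto
    next
      case False
      then have "Max R < \<alpha>" using fin by auto
      then obtain \<gamma> where "Max R < \<gamma>" "\<gamma> < \<alpha>" using limit by blast
      then show thesis using that[of \<gamma>] fin(1) False by auto
    qed
    have \<delta>\<nu>: "\<delta> \<le> \<nu>" using \<delta> \<alpha> by simp
    have ZF: "(\<lambda>x. r x |` {..<\<delta>}) ` Z \<subseteq> Field (P \<delta>)"
      using A(2) Z(1) restrict_Field[OF _ \<alpha> \<delta>\<nu>] by blast
    obtain Y where Y: "Y \<subseteq> Z" "uncountable Y"
        "\<And>F. F \<subseteq> Y \<Longrightarrow> finite F \<Longrightarrow> F \<noteq> {} \<Longrightarrow> \<exists>s. \<forall>x\<in>F. (s, r x |` {..<\<delta>}) \<in> P \<delta>"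
      using IH[OF \<delta>(1), unfolded precaliber_omega1_def, rule_format, OF conjI[OF Z(2) ZF]] by metis
    have "\<exists>s. \<forall>x\<in>F. (s, r x) \<in> P \<alpha>" if F: "F \<subseteq> Y" "finite F" "F \<noteq> {}" for F
    proof -
      obtain t where t: "\<And>x. x \<in> F \<Longrightarrow> (t, r x |` {..<\<delta>}) \<in> P \<delta>" using Y(3)[OF F] by blast
      show ?thesis
      proof (rule amalgamation[OF \<alpha> \<delta>(1) F(2)])
        show "t \<in> Field (P \<delta>)" using t F(3) by (auto simp: Field_def)
        show "r x \<in> Field (P \<alpha>)" if "x \<in> F" for x using that F(1) Y(1) Z(1) A(2) by blast
        show "dom (r x) \<inter> dom (r y) \<subseteq> {..<\<delta>}" if "x \<in> F" "y \<in> F" "x \<noteq> y" for x y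
          using Z(3)[of x y] that F(1) Y(1) \<delta>(2) by blast
      qed (rule t)
    qed
    then show ?thesis using Y(1,2) Z(1) by (intro exI[of _ Y]) auto
  qed
qed

end

section \<open>Successor stages: \<beta> is the largest element below \<alpha>\<close>

lemma nth_elem_mem: "finite a \<Longrightarrow> i < card a \<Longrightarrow> nth_elem a i \<in> a"
  unfolding nth_elem_def by (metis length_sorted_list_of_set nth_mem set_sorted_list_of_set)

context finite_support_iteration
begin

context
  fixes \<alpha> \<beta>
  assumes \<alpha>: "\<alpha> \<le> \<nu>" and \<beta>\<alpha>: "\<beta> < \<alpha>" and top: "\<And>\<gamma>. \<gamma> < \<alpha> \<Longrightarrow> \<gamma> \<le> \<beta>"
begin

lemma index_below_length: "\<beta> < \<nu>" "\<beta> \<le> \<nu>"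
  using \<alpha> \<beta>\<alpha> by auto

lemma extend_condition:
  assumes s: "s \<in> Field (P \<beta>)" and j: "j \<in> name_dom (Q \<beta>)" "(name_at (Q \<beta>) j \<^bold>\<in> Q \<beta>) (P \<beta>) s"
  shows "s(\<beta> \<mapsto> j) \<in> conditions \<alpha>" "(s(\<beta> \<mapsto> j)) |` {..<\<beta>} = s"
proof -
  have sC: "s \<in> conditions \<beta>" using s Field_stage[OF index_below_length(2)] by simp
  have dom: "dom s \<subseteq> {..<\<beta>}" by (rule conditionsD(2)[OF sC])
  have restr: "(s(\<beta> \<mapsto> j)) |` {..<\<gamma>} = s |` {..<\<gamma>}" if "\<gamma> \<le> \<beta>" for \<gamma>
    using that by (auto simp: restrict_map_def fun_eq_iff)
  then show rb: "(s(\<beta> \<mapsto> j)) |` {..<\<beta>} = s" using restrict_lessThan_id[OF dom] by simp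
  show "s(\<beta> \<mapsto> j) \<in> conditions \<alpha>"
  proof (rule conditionsI)
    show "finite (dom (s(\<beta> \<mapsto> j)))" using conditionsD(1)[OF sC] by simp
    show "dom (s(\<beta> \<mapsto> j)) \<subseteq> {..<\<alpha>}" using dom \<beta>\<alpha> by auto
    fix \<gamma> assume "\<gamma> \<in> dom (s(\<beta> \<mapsto> j))"
    then consider "\<gamma> = \<beta>" | "\<gamma> \<in> dom s" "\<gamma> < \<beta>" using dom by (auto split: if_splits)
    then show "(s(\<beta> \<mapsto> j)) |` {..<\<gamma>} \<in> Field (P \<gamma>) \<and> the ((s(\<beta> \<mapsto> j)) \<gamma>) \<in> name_dom (Q \<gamma>) \<and>
        (coord \<gamma> (s(\<beta> \<mapsto> j)) \<^bold>\<in> Q \<gamma>) (P \<gamma>) ((s(\<beta> \<mapsto> j)) |` {..<\<gamma>})"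
    proof cases
      case 1
      then show ?thesis using s j rb by simp
    next
      case 2
      then have "\<gamma> \<noteq> \<beta>" "(s(\<beta> \<mapsto> j)) \<gamma> = s \<gamma>" by auto
      then show ?thesis using conditionsD(3-5)[OF sC 2(1)] restr[OF less_imp_le[OF 2(2)]] by metis
    qed
  qed
qed

text \<open>Read in the two-step iteration: a condition \<open>s\<close> below the first part of
  \<open>p\<close>, together with a listed element that \<open>s\<close> forces below the second
  part of \<open>p\<close>, lies below \<open>p\<close>.\<close>

lemma extend_le:
  assumes sp: "(s, p |` {..<\<beta>}) \<in> P \<beta>" and j: "j \<in> name_dom (Q \<beta>)" "(name_at (Q \<beta>) j \<^bold>\<in> Q \<beta>) (P \<beta>) s"
    and p: "p \<in> conditions \<alpha>" and rel: "fRel (L \<beta>) (name_at (Q \<beta>) j) (coord \<beta> p) (P \<beta>) s"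
  shows "(s(\<beta> \<mapsto> j), p) \<in> P \<alpha>"
proof -
  have s: "s \<in> Field (P \<beta>)" using sp by (auto simp: Field_def)
  have "\<gamma> \<in> dom (s(\<beta> \<mapsto> j)) \<and> fRel (L \<gamma>) (coord \<gamma> (s(\<beta> \<mapsto> j))) (coord \<gamma> p) (P \<gamma>) ((s(\<beta> \<mapsto> j)) |` {..<\<gamma>})"
    if \<gamma>: "\<gamma> \<in> dom p" for \<gamma>
  proof (cases "\<gamma> = \<beta>")
    case True
    then show ?thesis using rel extend_condition(2)[OF s j] by simp
  next
    case False
    then have lt: "\<gamma> < \<beta>" using \<gamma> conditionsD(2)[OF p] top by fastforce
    then have "\<gamma> \<in> dom (p |` {..<\<beta>})" using \<gamma> by simp
    then have *: "\<gamma> \<in> dom s" "fRel (L \<gamma>) (coord \<gamma> s) (coord \<gamma> (p |` {..<\<beta>})) (P \<gamma>) (s |` {..<\<gamma>})"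
      using sp unfolding le_iff[OF index_below_length(2)] by blast+
    have "(s(\<beta> \<mapsto> j)) |` {..<\<gamma>} = s |` {..<\<gamma>}"
      using lt by (auto simp: restrict_map_def fun_eq_iff)
    moreover have "(s(\<beta> \<mapsto> j)) \<gamma> = s \<gamma>" "(p |` {..<\<beta>}) \<gamma> = p \<gamma>" using lt by auto
    ultimately show ?thesis using * by (metis domIff)
  qed
  then show ?thesis
    unfolding le_iff[OF \<alpha>] using p extend_condition(1)[OF s j] by blast
qed

text \<open>If \<beta> is outside the support of \<open>p\<close>, then \<open>p\<close> is already
  a condition of stage \<beta>, and the undefined coordinate imposes no requirement.\<close>

lemma restrict_le_imp_le:
  assumes sp: "(s, p |` {..<\<beta>}) \<in> P \<beta>" and p: "p \<in> conditions \<alpha>" "\<beta> \<notin> dom p"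
  shows "(s, p) \<in> P \<alpha>"
proof -
  have "\<gamma> \<in> {..<\<beta>}" if "\<gamma> \<in> dom p" for \<gamma>
    using that conditionsD(2)[OF p(1)] p(2) top by (metis lessThan_iff order_le_less subset_eq)
  then have eq: "p |` {..<\<beta>} = p" by (intro restrict_lessThan_id) blast
  have s: "s \<in> conditions \<beta>" using sp unfolding le_iff[OF index_below_length(2)] by blast
  have "s \<in> conditions \<alpha>"
    using conditionsD[OF s] \<beta>\<alpha> by (intro conditionsI) (auto dest: less_trans)
  then show ?thesis
    unfolding le_iff[OF \<alpha>] using p(1) sp[unfolded eq le_iff[OF index_below_length(2)]] by blast
qed

text \<open>Whether \<beta> is in the support is assumed to be uniform. If it is not, the chain
  condition of \<open>P \<beta>\<close> suffices. If it is, the tuples of coordinates at \<beta> are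
  compared over a single \<open>s\<close>, which is then extended separately for each
  \<open>i\<close> by its own index \<open>j i\<close>.\<close>

lemma compatible_coordinates:
  fixes m :: nat and p :: "omega1 \<Rightarrow> nat \<Rightarrow> ('o, 'i) cond"
  assumes precal: "precaliber_omega1 (P \<beta>)"
    and pccc: "forces (P \<beta>) (fPowerfully_ccc (Q \<beta>) (L \<beta>))"
    and p: "\<And>\<xi> i. i < m \<Longrightarrow> p \<xi> i \<in> conditions \<alpha>"
    and dom: "(\<forall>\<xi>. \<forall>i<m. \<beta> \<in> dom (p \<xi> i)) \<or> (\<forall>\<xi>. \<forall>i<m. \<beta> \<notin> dom (p \<xi> i))"
    and r: "\<And>\<xi>. r \<xi> \<in> Field (P \<beta>)" "\<And>\<xi> i. i < m \<Longrightarrow> (r \<xi>, p \<xi> i |` {..<\<beta>}) \<in> P \<beta>"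
  obtains \<xi> \<eta> where "\<xi> \<noteq> \<eta>" "\<And>i. i < m \<Longrightarrow> compatible (P \<alpha>) (p \<xi> i) (p \<eta> i)"
proof -
  have ccc: "ccc (P \<beta>)" using precaliber_omega1_imp_ccc[OF precal] .
  interpret F: forcing "P \<beta>" "TYPE('i)" by (rule forcing_stage[OF index_below_length(2)])
  from dom show thesis
  proof
    assume dom: "\<forall>\<xi>. \<forall>i<m. \<beta> \<notin> dom (p \<xi> i)"
    obtain \<xi> \<eta> where \<xi>\<eta>: "\<xi> \<noteq> \<eta>" "compatible (P \<beta>) (r \<xi>) (r \<eta>)"
      using ccc_indexed[OF Preorder_stage[OF index_below_length(2)] ccc uncountable_omega1, of r] r(1) by metis
    then obtain s where s: "(s, r \<xi>) \<in> P \<beta>" "(s, r \<eta>) \<in> P \<beta>" by (auto simp: compatible_def)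
    have "compatible (P \<alpha>) (p \<xi> i) (p \<eta> i)" if i: "i < m" for i
      unfolding compatible_def
      using restrict_le_imp_le[OF F.le_trans[OF s(1) r(2)[OF i]] p[OF i]]
        restrict_le_imp_le[OF F.le_trans[OF s(2) r(2)[OF i]] p[OF i]] dom i by blast
    then show thesis using that \<xi>\<eta>(1) by blast
  next
    assume dom: "\<forall>\<xi>. \<forall>i<m. \<beta> \<in> dom (p \<xi> i)"
    have a: "is_name (P \<beta>) (coord \<beta> (p \<xi> i))" "(coord \<beta> (p \<xi> i) \<^bold>\<in> Q \<beta>) (P \<beta>) (r \<xi>)" if i: "i < m" for \<xi> i
    proof -
      have d: "\<beta> \<in> dom (p \<xi> i)" using dom i by blast
      show "is_name (P \<beta>) (coord \<beta> (p \<xi> i))" by (rule coord_name[OF p[OF i] \<alpha> d])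
      show "(coord \<beta> (p \<xi> i) \<^bold>\<in> Q \<beta>) (P \<beta>) (r \<xi>)"
        by (rule F.mem_mono[OF conditionsD(5)[OF p[OF i] d] r(2)[OF i]])
    qed
    obtain \<xi> \<eta> s j where \<xi>\<eta>: "\<xi> \<noteq> \<eta>" and s: "(s, r \<xi>) \<in> P \<beta>" "(s, r \<eta>) \<in> P \<beta>"
      and j: "\<And>i. i < m \<Longrightarrow> j i \<in> name_dom (Q \<beta>) \<and> (name_at (Q \<beta>) (j i) \<^bold>\<in> Q \<beta>) (P \<beta>) s \<and>
        fRel (L \<beta>) (name_at (Q \<beta>) (j i)) (coord \<beta> (p \<xi> i)) (P \<beta>) s \<and>
        fRel (L \<beta>) (name_at (Q \<beta>) (j i)) (coord \<beta> (p \<eta> i)) (P \<beta>) s"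
      by (rule F.powerfully_ccc_compatible[where r = r and m = m and a = "\<lambda>\<xi> i. coord \<beta> (p \<xi> i)",
            OF ccc iterand(1)[OF index_below_length(1)] iterand(3)[OF index_below_length(1)] pccc r(1) a]) blast+
    have "compatible (P \<alpha>) (p \<xi> i) (p \<eta> i)" if i: "i < m" for i
      unfolding compatible_def
      using extend_le[OF F.le_trans[OF s(1) r(2)[OF i]] _ _ p[OF i], of "j i"]
        extend_le[OF F.le_trans[OF s(2) r(2)[OF i]] _ _ p[OF i], of "j i"] j[OF i] by blast
    then show thesis using that \<xi>\<eta> by blast
  qed
qed

text \<open>Two compatible tuples must be compatible at all coordinates, since (ii) guarantees the
  color \<open>l\<close> at some coordinate that depends on the two tuples.\<close>

lemma breaks_homogeneous_successor:
  assumes precal: "precaliber_omega1 (P \<beta>)"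
    and pccc: "forces (P \<beta>) (fPowerfully_ccc (Q \<beta>) (L \<beta>))"
    and ii: "\<And>A l. uncountable A \<Longrightarrow> l < 2 \<Longrightarrow>
              \<exists>m. \<exists>\<B> \<subseteq> [A]\<^bsup>m\<^esup>. uncountable \<B> \<and> non_overlapping \<B> \<and>
                (\<forall>a\<in>\<B>. \<forall>b\<in>\<B>. set_before a b \<longrightarrow>
                   (\<exists>i<m. \<pi> {nth_elem a i, nth_elem b i} = l))"
  shows "breaks_homogeneous \<pi> (P \<alpha>)"
  unfolding breaks_homogeneous_def
proof (intro allI impI, elim conjE)
  fix A0 :: "omega1 set" and r and l :: nat
  assume l: "l < 2" and A0: "uncountable A0" "r ` A0 \<subseteq> Field (P \<alpha>)"
  \<comment> \<open>Makes the presence of \<beta> in the support uniform on an uncountable set of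
    indices.\<close>
  have "A0 = {x \<in> A0. \<beta> \<in> dom (r x)} \<union> {x \<in> A0. \<beta> \<notin> dom (r x)}" by auto
  then have "uncountable {x \<in> A0. \<beta> \<in> dom (r x)} \<or> uncountable {x \<in> A0. \<beta> \<notin> dom (r x)}"
    using A0(1) countable_Un by metis
  then obtain A where A: "A \<subseteq> A0" "uncountable A"
    and dom: "(\<forall>x\<in>A. \<beta> \<in> dom (r x)) \<or> (\<forall>x\<in>A. \<beta> \<notin> dom (r x))"
    by (metis (no_types, lifting) mem_Collect_eq subsetI)
  have rF: "r x \<in> Field (P \<alpha>)" if "x \<in> A" for x using that A(1) A0(2) by blast
  then have rC: "r x \<in> conditions \<alpha>" if "x \<in> A" for x using that Field_stage[OF \<alpha>] by blast
  have "(\<lambda>x. r x |` {..<\<beta>}) ` A \<subseteq> Field (P \<beta>)" using restrict_Field[OF rF \<alpha> index_below_length(2)] by blast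
  then obtain Z where Z: "Z \<subseteq> A" "uncountable Z"
      "\<And>F. F \<subseteq> Z \<Longrightarrow> finite F \<Longrightarrow> F \<noteq> {} \<Longrightarrow> \<exists>s. \<forall>x\<in>F. (s, r x |` {..<\<beta>}) \<in> P \<beta>"
    using precal[unfolded precaliber_omega1_def, rule_format, OF conjI[OF A(2)]] by metis
  \<comment> \<open>The coloring hypothesis is applied to \<open>Z\<close>, whose conditions have
    centered restrictions, so that every tuple in the family has a lower bound in
    \<open>P \<beta>\<close>.\<close>
  obtain m \<B> where B: "\<B> \<subseteq> [Z]\<^bsup>m\<^esup>" "uncountable \<B>" "non_overlapping \<B>"
      "\<And>a b. a \<in> \<B> \<Longrightarrow> b \<in> \<B> \<Longrightarrow> set_before a b \<Longrightarrow> \<exists>i<m. \<pi> {nth_elem a i, nth_elem b i} = l"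
    using ii[OF Z(2) l] by metis
  have fin: "finite a" "a \<noteq> {}" "a \<subseteq> Z" "card a = m" if "a \<in> \<B>" for a
    using that B(1,3) by (auto simp: nsets_def non_overlapping_def)
  obtain e :: "omega1 \<Rightarrow> omega1 set" where e: "inj e" "\<And>\<xi>. e \<xi> \<in> \<B>"
    using uncountable_omega1_embedding[OF B(2)] by metis
  have "\<forall>\<xi>. \<exists>s. \<forall>x\<in>e \<xi>. (s, r x |` {..<\<beta>}) \<in> P \<beta>"
    using Z(3)[OF fin(3,1,2)[OF e(2)]] by (rule allI)
  then obtain s where s: "\<And>\<xi> x. x \<in> e \<xi> \<Longrightarrow> (s \<xi>, r x |` {..<\<beta>}) \<in> P \<beta>" by metis
  have nth: "nth_elem (e \<xi>) i \<in> e \<xi>" "nth_elem (e \<xi>) i \<in> A" if "i < m" for \<xi> i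
    using nth_elem_mem[OF fin(1)[OF e(2)], of i \<xi>] fin(3,4)[OF e(2)[of \<xi>]] that Z(1) by auto
  have sF: "s \<xi> \<in> Field (P \<beta>)" for \<xi>
    using s fin(2)[OF e(2)[of \<xi>]] by (meson FieldI1 all_not_in_conv)
  obtain \<xi> \<eta> where \<xi>\<eta>: "\<xi> \<noteq> \<eta>"
      "\<And>i. i < m \<Longrightarrow> compatible (P \<alpha>) (r (nth_elem (e \<xi>) i)) (r (nth_elem (e \<eta>) i))"
  proof (rule compatible_coordinates[OF precal pccc, where m = m and r = s and p = "\<lambda>\<xi> i. r (nth_elem (e \<xi>) i)"])
    show "(\<forall>\<xi>. \<forall>i<m. \<beta> \<in> dom (r (nth_elem (e \<xi>) i))) \<or> (\<forall>\<xi>. \<forall>i<m. \<beta> \<notin> dom (r (nth_elem (e \<xi>) i)))"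
      using dom nth(2) by blast
  qed (use rC nth s sF in blast)+
  \<comment> \<open>The compatible tuples come in no particular order. The claim is proved for the
    order in which one lies before the other, where corresponding elements are increasing; symmetry
    of compatibility covers the other case.\<close>
  have *: "\<exists>x\<in>A0. \<exists>y\<in>A0. x < y \<and> \<pi> {x, y} = l \<and> compatible (P \<alpha>) (r x) (r y)"
    if before: "set_before (e \<xi>) (e \<eta>)"
      and comp: "\<And>i. i < m \<Longrightarrow> compatible (P \<alpha>) (r (nth_elem (e \<xi>) i)) (r (nth_elem (e \<eta>) i))" for \<xi> \<eta>
  proof -
    obtain i where i: "i < m" "\<pi> {nth_elem (e \<xi>) i, nth_elem (e \<eta>) i} = l"
      using B(4)[OF e(2) e(2) before] by blast
    have "nth_elem (e \<xi>) i \<le> Max (e \<xi>)" "Min (e \<eta>) \<le> nth_elem (e \<eta>) i"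
      using nth(1)[OF i(1)] fin(1)[OF e(2)] by auto
    then have "nth_elem (e \<xi>) i < nth_elem (e \<eta>) i" using before unfolding set_before_def by order
    then show ?thesis using i(2) comp[OF i(1)] nth(2)[OF i(1)] A(1) by blast
  qed
  have "e \<xi> \<noteq> e \<eta>" using \<xi>\<eta>(1) e(1) by (meson injD)
  then consider "set_before (e \<xi>) (e \<eta>)" | "set_before (e \<eta>) (e \<xi>)"
    using B(3) e(2) unfolding non_overlapping_def by blast
  then show "\<exists>x\<in>A0. \<exists>y\<in>A0. x < y \<and> \<pi> {x, y} = l \<and> compatible (P \<alpha>) (r x) (r y)"
  proof cases
    case 1
    then show ?thesis using * \<xi>\<eta>(2) by blast
  next
    case 2
    moreover have "compatible (P \<alpha>) (r (nth_elem (e \<eta>) i)) (r (nth_elem (e \<xi>) i))" if "i < m" for i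
      using \<xi>\<eta>(2)[OF that] by (auto simp: compatible_def)
    ultimately show ?thesis using * by blast
  qed
qed

end

section \<open>The induction along the iteration\<close>

lemma precaliber_stage:
  assumes not_CH: "\<not> CH"
    and i: "\<And>T :: ('o, 'i) cond rel. forcing_poset T \<Longrightarrow> ccc T \<Longrightarrow>
              forces_no_homogeneous T TYPE('i) \<pi> \<Longrightarrow> MA {T}"
    and ii: "\<And>A l. uncountable A \<Longrightarrow> l < 2 \<Longrightarrow>
              \<exists>m. \<exists>\<B> \<subseteq> [A]\<^bsup>m\<^esup>. uncountable \<B> \<and> non_overlapping \<B> \<and>
                (\<forall>a\<in>\<B>. \<forall>b\<in>\<B>. set_before a b \<longrightarrow>
                   (\<exists>i<m. \<pi> {nth_elem a i, nth_elem b i} = l))"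
    and pccc: "\<And>\<beta>. \<beta> < \<nu> \<Longrightarrow> forces (P \<beta>) (fPowerfully_ccc (Q \<beta>) (L \<beta>))"
    and "\<alpha> \<le> \<nu>"
  shows "precaliber_omega1 (P \<alpha>)"
  using \<open>\<alpha> \<le> \<nu>\<close>
proof (induction \<alpha> rule: less_induct)
  case (less \<alpha>)
  show ?case
  proof (cases "\<exists>\<beta><\<alpha>. \<forall>\<gamma><\<alpha>. \<gamma> \<le> \<beta>")
    case True
    then obtain \<beta> where \<beta>: "\<beta> < \<alpha>" "\<And>\<gamma>. \<gamma> < \<alpha> \<Longrightarrow> \<gamma> \<le> \<beta>" by blast
    then have "precaliber_omega1 (P \<beta>)" "\<beta> < \<nu>" using less by auto
    then have "breaks_homogeneous \<pi> (P \<alpha>)"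
      using breaks_homogeneous_successor[OF less.prems \<beta> _ pccc ii] by blast
    \<comment> \<open>Breaking homogeneity passes to cones, so hypothesis (i) gives Martin's axiom
      for each of them; this returns precaliber for the next stage.\<close>
    then show ?thesis
      using precaliber_omega1I[OF Preorder_stage[OF less.prems] large not_CH, of \<pi>] i by blast
  next
    \<comment> \<open>No largest predecessor: \<alpha> is a limit or the least element.\<close>
    case False
    show ?thesis
      by (rule precaliber_limit[OF less.prems]) (use False less in \<open>auto simp: not_le\<close>)
  qed
qed

end

theorem theorem6p8:
  fixes \<pi> :: "omega1 set \<Rightarrow> nat"
  assumes universe: "(UNIV :: nat set set) \<lesssim> (UNIV :: 'i set)"
    and MA: "MA {P :: ('o::wellorder, 'i) cond rel. forcing_poset P \<and> powerfully_ccc P}"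
    and not_CH: "\<not> CH"
    and coloring: "\<pi> \<in> [UNIV]\<^bsup>2\<^esup> \<rightarrow> {..<2}"
    and ccc_H: "ccc (homog_poset \<pi> 0)" "ccc (homog_poset \<pi> 1)"
    and i: "\<And>P :: ('o, 'i) cond rel. forcing_poset P \<Longrightarrow> ccc P \<Longrightarrow>
              forces_no_homogeneous P TYPE('i) \<pi> \<Longrightarrow> MA {P}"
    and ii: "\<And>A l. uncountable A \<Longrightarrow> l < 2 \<Longrightarrow>
              \<exists>m. \<exists>\<B> \<subseteq> [A]\<^bsup>m\<^esup>. uncountable \<B> \<and> non_overlapping \<B> \<and>
                (\<forall>a\<in>\<B>. \<forall>b\<in>\<B>. set_before a b \<longrightarrow>
                   (\<exists>i<m. \<pi> {nth_elem a i, nth_elem b i} = l))"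
  shows "\<forall>\<nu> (P :: 'o \<Rightarrow> ('o, 'i) cond rel) Q L.
           fs_iteration \<nu> P Q L \<longrightarrow>
           (\<forall>\<beta><\<nu>. forces (P \<beta>) (fPowerfully_ccc (Q \<beta>) (L \<beta>))) \<longrightarrow>
           powerfully_ccc (P \<nu>)"
proof (intro allI impI)
  fix \<nu> and P :: "'o \<Rightarrow> ('o, 'i) cond rel" and Q L
  assume "fs_iteration \<nu> P Q L" and pccc: "\<forall>\<beta><\<nu>. forces (P \<beta>) (fPowerfully_ccc (Q \<beta>) (L \<beta>))"
  then interpret finite_support_iteration \<nu> P Q L
    using universe by unfold_locales
  have "precaliber_omega1 (P \<nu>)"
    by (rule precaliber_stage[OF not_CH i ii]) (use pccc in auto)
  then show "powerfully_ccc (P \<nu>)"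
    by (rule precaliber_omega1_imp_powerfully_ccc)
qed

end
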